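(* Let $n,m\geqslant 1$ and let $\mu$ be a partition with $\ell(\mu)\leqslant n$. The formal power series \[ \mathbb{A}_\mu(x_1,\ldots,x_n;y_1,\ldots,y_m)=\sum_{\ell(\lambda)\leqslant n}\ \sum_{\ell(\nu)\leqslant m}\mathsf{a}^{\lambda}_{\nu[\mu]}\,x^\lambda y^\nu \] is (the expansion of) a rational function in $x_1,\ldots,x_n,y_1,\ldots,y_m$. In particular, the plethysm coefficients $\mathsf{a}^{\lambda}_{\nu[\mu]}$ (for fixed $\mu$, $n$, $m$) satisfy linear recurrences.
   Context: The plethysm coefficients $\mathsf{a}^\lambda_{\nu[\mu]}$ are defined by the expansion of the plethysm of Schur functions $s_\nu[s_\mu]=\sum_\lambda \mathsf{a}^\lambda_{\nu[\mu]}s_\lambda$. The sums run over partitions $\lambda$ with at most $n$ parts and $\nu$ with at most $m$ parts; $x^\lambda=x_1^{\lambda_1}\cdots x_n^{\lambda_n}$ and $y^\nu=y_1^{\nu_1}\cdots y_m^{\nu_m}$. *)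

theory Defs
  imports
    Complex_Main
    "HOL-Library.Poly_Mapping"
    "HOL-Library.Product_Plus"
    "HOL-Library.FuncSet"
    "HOL-Library.Countable_Set"
begin

text \<open>
  Indices start at 0. A finitely supported \<open>\<alpha> :: nat \<Rightarrow>\<^sub>0 nat\<close> is both an exponent vector (the monomial
  \<open>x\<^sup>\<alpha>\<close> in \<open>x\<^sub>0, x\<^sub>1, \<dots>\<close>) and, if weakly decreasing, a partition padded by zeros; so \<open>x\<^sup>\<lambda>\<close> is the
  monomial with exponent \<open>\<lambda>\<close>. Formal power series are given by their coefficient functions.
\<close>

type_synonym expo = "nat \<Rightarrow>\<^sub>0 nat"

definition is_partition :: "expo \<Rightarrow> bool" where
  "is_partition lam \<longleftrightarrow> antimono (Poly_Mapping.lookup lam)"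

definition part_length :: "expo \<Rightarrow> nat" where
  "part_length lam = card (Poly_Mapping.keys lam)"


definition diagram :: "expo \<Rightarrow> (nat \<times> nat) set" where
  "diagram lam = {(i, j). j < Poly_Mapping.lookup lam i}"

definition SSYT :: "expo \<Rightarrow> (nat \<times> nat \<Rightarrow> nat) set" where
  "SSYT lam = {T \<in> extensional (diagram lam).
     (\<forall>i j j'. j < j' \<and> (i, j') \<in> diagram lam \<longrightarrow> T (i, j) \<le> T (i, j')) \<and>
     (\<forall>i i' j. i < i' \<and> (i', j) \<in> diagram lam \<longrightarrow> T (i, j) < T (i', j))}"

definition has_content :: "expo \<Rightarrow> (nat \<times> nat \<Rightarrow> nat) \<Rightarrow> expo \<Rightarrow> bool" where
  "has_content lam T \<alpha> \<longleftrightarrow>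
     (\<forall>k. card {c \<in> diagram lam. T c = k} = Poly_Mapping.lookup \<alpha> k)"

text \<open>The Schur function \<open>s\<^sub>\<lambda> = \<Sum>\<^sub>T x\<^sup>T\<close> in infinitely many variables (for \<open>\<lambda>\<close> a partition).\<close>

definition schur :: "expo \<Rightarrow> expo \<Rightarrow> int" where
  "schur lam \<alpha> = int (card {T \<in> SSYT lam. has_content lam T \<alpha>})"


text \<open>
  Plethysm by substitution of monomials: if \<open>g\<close> has nonnegative integer coefficients and
  \<open>g = x\<^sup>\<theta>\<^sup>0 + x\<^sup>\<theta>\<^sup>1 + \<dots>\<close> lists its monomials with multiplicity, then \<open>f[g] = f(x\<^sup>\<theta>\<^sup>0, x\<^sup>\<theta>\<^sup>1, \<dots>)\<close>. For
  symmetric \<open>f\<close> this does not depend on the listing, for which \<^const>\<open>from_nat_into\<close> is used. If \<open>g\<close>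
  has only finitely many monomials, the remaining variables of \<open>f\<close> are set to 0, which is why only
  monomials \<open>\<beta>\<close> of \<open>f\<close> in the variables indexed by the listing contribute. The condition
  \<open>f \<beta> \<noteq> 0\<close> only serves to make the index set of the sum finite.
\<close>

definition monomials :: "(expo \<Rightarrow> int) \<Rightarrow> (expo \<times> nat) set" where
  "monomials g = {(\<gamma>, i). i < nat (g \<gamma>)}"

definition monomial_index :: "(expo \<Rightarrow> int) \<Rightarrow> nat set" where
  "monomial_index g = to_nat_on (monomials g) ` monomials g"

definition nth_monomial :: "(expo \<Rightarrow> int) \<Rightarrow> nat \<Rightarrow> expo" where
  "nth_monomial g k = fst (from_nat_into (monomials g) k)"

definition plethysm :: "(expo \<Rightarrow> int) \<Rightarrow> (expo \<Rightarrow> int) \<Rightarrow> expo \<Rightarrow> int" where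
  "plethysm f g \<alpha> =
     (\<Sum>\<beta> | f \<beta> \<noteq> 0 \<and> Poly_Mapping.keys \<beta> \<subseteq> monomial_index g \<and>
           (\<forall>j. Poly_Mapping.lookup \<alpha> j =
                (\<Sum>k\<in>Poly_Mapping.keys \<beta>.
                   Poly_Mapping.lookup \<beta> k * Poly_Mapping.lookup (nth_monomial g k) j)).
        f \<beta>)"

definition is_schur_expansion :: "(expo \<Rightarrow> int) \<Rightarrow> (expo \<Rightarrow> int) \<Rightarrow> bool" where
  "is_schur_expansion f a \<longleftrightarrow>
     finite {lam. a lam \<noteq> 0} \<and> (\<forall>lam. a lam \<noteq> 0 \<longrightarrow> is_partition lam) \<and>
     (\<forall>\<alpha>. f \<alpha> = (\<Sum>lam | a lam \<noteq> 0. a lam * schur lam \<alpha>))"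

text \<open>\<open>plethysm_coeff \<nu> \<mu> \<lambda>\<close> is the coefficient of \<open>s\<^sub>\<lambda>\<close> in \<open>s\<^sub>\<nu>[s\<^sub>\<mu>]\<close>.\<close>

definition plethysm_coeff :: "expo \<Rightarrow> expo \<Rightarrow> expo \<Rightarrow> int" where
  "plethysm_coeff \<nu> \<mu> = (THE a. is_schur_expansion (plethysm (schur \<nu>) (schur \<mu>)) a)"


text \<open>
  A pair \<open>(\<alpha>, \<beta>)\<close> stands for the monomial \<open>x\<^sup>\<alpha> y\<^sup>\<beta>\<close>; pairs add componentwise. Functions on pairs are
  formal power series, finitely supported ones are polynomials.
\<close>

definition expos_xy :: "nat \<Rightarrow> nat \<Rightarrow> (expo \<times> expo) set" where
  "expos_xy n m = {(\<alpha>, \<beta>). Poly_Mapping.keys \<alpha> \<subseteq> {..<n} \<and> Poly_Mapping.keys \<beta> \<subseteq> {..<m}}"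

definition series_mult ::
    "(expo \<times> expo \<Rightarrow> rat) \<Rightarrow> (expo \<times> expo \<Rightarrow> rat) \<Rightarrow> expo \<times> expo \<Rightarrow> rat" where
  "series_mult F G e = (\<Sum>(d, d') | d + d' = e. F d * G d')"

text \<open>
  \<open>F\<close> is the expansion at the origin of \<open>P / Q\<close>, where \<open>P, Q \<in> \<rat>[x\<^sub>0, \<dots>, x\<^sub>n\<^sub>-\<^sub>1, y\<^sub>0, \<dots>, y\<^sub>m\<^sub>-\<^sub>1]\<close>; the
  condition on the constant term of \<open>Q\<close> says that \<open>Q\<close> is invertible as a power series.
\<close>

definition is_rational_series :: "nat \<Rightarrow> nat \<Rightarrow> (expo \<times> expo \<Rightarrow> rat) \<Rightarrow> bool" where
  "is_rational_series n m F \<longleftrightarrow>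
     (\<exists>P Q :: (expo \<times> expo) \<Rightarrow>\<^sub>0 rat.
        Poly_Mapping.keys P \<subseteq> expos_xy n m \<and> Poly_Mapping.keys Q \<subseteq> expos_xy n m \<and>
        Poly_Mapping.lookup Q 0 \<noteq> 0 \<and>
        series_mult (Poly_Mapping.lookup Q) F = Poly_Mapping.lookup P)"

text \<open>
  A constant-coefficient linear recurrence \<open>F(e) = \<Sum>\<^sub>s c(s) F(e - s)\<close>, with finitely many nonzero
  shifts \<open>s\<close>, valid for all but finitely many \<open>e\<close>; terms for which \<open>e - s\<close> has a negative entry are
  absent from the sum.
\<close>

definition satisfies_linear_recurrence :: "nat \<Rightarrow> nat \<Rightarrow> (expo \<times> expo \<Rightarrow> rat) \<Rightarrow> bool" where
  "satisfies_linear_recurrence n m F \<longleftrightarrow>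
     (\<exists>S c. finite S \<and> S \<subseteq> expos_xy n m - {0} \<and>
        finite {e \<in> expos_xy n m. F e \<noteq> (\<Sum>(s, d) | s \<in> S \<and> s + d = e. c s * F d)})"


definition plethysm_series :: "nat \<Rightarrow> nat \<Rightarrow> expo \<Rightarrow> expo \<times> expo \<Rightarrow> rat" where
  "plethysm_series n m \<mu> = (\<lambda>(lam, \<nu>).
     if is_partition lam \<and> part_length lam \<le> n \<and> is_partition \<nu> \<and> part_length \<nu> \<le> m
     then of_int (plethysm_coeff \<nu> \<mu> lam) else 0)"

end

theory Submission
  imports Defs "HOL-Library.Multiset" "Jordan_Normal_Form.Determinant"
begin

text \<open>
  By the bialternant formula \<open>a\<^sub>\<rho> s\<^sub>\<lambda> = a\<^sub>\<lambda>\<^sub>+\<^sub>\<rho>\<close> in \<open>n\<close> variables, the coefficient of \<open>s\<^sub>\<lambda>\<close> in a symmetric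
  function \<open>f\<close> is the coefficient of \<open>x\<^sup>\<lambda>\<^sup>+\<^sup>\<rho>\<close> in \<open>a\<^sub>\<rho> f\<close>; this also shows that Schur expansions of symmetric
  functions exist and are unique. The monomials of \<open>s\<^sub>\<nu>[s\<^sub>\<mu>]\<close> in \<open>n\<close> variables correspond to the tableaux of
  shape \<open>\<nu>\<close> whose entries are the finitely many monomials of \<open>s\<^sub>\<mu>(x\<^sub>0, \<dots>, x\<^sub>n\<^sub>-\<^sub>1)\<close>. Recording how often each
  entry occurs in each of the \<open>m\<close> rows turns these tableaux, for all \<open>\<nu>\<close> at once, into the lattice points
  of a rational cone, and both exponents \<open>\<alpha>\<close> and \<open>\<nu>\<close> of a term \<open>x\<^sup>\<alpha> y\<^sup>\<nu>\<close> are linear functions of the lattice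
  point.

  A series whose denominator is a product of factors \<open>1 - x\<^sup>b\<close> keeps this form when it is multiplied by
  the polynomial \<open>a\<^sub>\<rho>\<close>, when a monomial substitution is applied, and when it is restricted to the exponents
  that satisfy a linear inequality (Elliott's reduction). Starting from the generating function of all
  lattice points of an orthant, these operations produce the plethysm series.
\<close>

subsection \<open>Partitions and tableaux\<close>

text \<open>Rationality rests on a fixed alphabet: \<open>s_mu\<close> is homogeneous, so only
  finitely many of its monomials involve just the first \<open>n\<close> variables, and with at most
  \<open>m\<close> rows the cone has the same finitely many coordinates for every shape. The order
  of the operations matters. Multiplication by the alternant spreads each Schur function over the
  signed rearrangements of \<open>lam + rho n\<close>; the later restriction to decreasing exponents
  keeps one term for each \<open>lam\<close>. \<open>plethysm_coeff\<close> is a definite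
  description of an expansion in infinitely many variables. Hence an expansion must be shown to
  exist with coefficients that do not depend on the number of variables, which in turn requires the
  symmetry of Schur functions and of the plethysm. Interlacing shapes are the common thread:
  deleting the largest entries of a tableau, splitting off the last variable of an alternant and
  removing the last column of a lattice point all lead to the same recursion. Comparing recursions
  replaces direct bijections between these objects.\<close>

abbreviation "lookup \<equiv> Poly_Mapping.lookup"
abbreviation "keys \<equiv> Poly_Mapping.keys"
abbreviation "single \<equiv> Poly_Mapping.single"

definition esize :: "('a \<Rightarrow>\<^sub>0 nat) \<Rightarrow> nat" where
  "esize e = (\<Sum>i\<in>keys e. lookup e i)"

lemma esize_eq_sum: "finite A \<Longrightarrow> keys e \<subseteq> A \<Longrightarrow> esize e = (\<Sum>i\<in>A. lookup e i)"
  unfolding esize_def by (rule sum.mono_neutral_left) (auto simp: in_keys_iff)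

lemma keys_add_nat: "keys (a + b :: 'a \<Rightarrow>\<^sub>0 nat) = keys a \<union> keys b"
  by (auto simp: in_keys_iff lookup_add)

lemma esize_add [simp]: "esize (a + b) = esize a + esize b"
  by (simp add: esize_eq_sum[of "keys a \<union> keys b"] keys_add_nat lookup_add sum.distrib)

lemma esize_zero [simp]: "esize 0 = 0"
  by (simp add: esize_def)

lemma esize_single [simp]: "esize (single i k) = k"
  by (cases "k = 0") (simp_all add: esize_def)

lemma esize_eq_0_iff [simp]: "esize e = 0 \<longleftrightarrow> e = 0"
  by (auto simp: esize_def in_keys_iff intro: poly_mapping_eqI)

lemma esize_pos_iff [simp]: "0 < esize e \<longleftrightarrow> e \<noteq> 0"
  by (metis esize_eq_0_iff neq0_conv)

lemma lookup_le_esize: "lookup e i \<le> esize e"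
  by (cases "i \<in> keys e") (auto simp: esize_def in_keys_iff intro!: member_le_sum)

lemma finite_expos_bounded:
  assumes "finite A"
  shows "finite {e :: 'a \<Rightarrow>\<^sub>0 nat. keys e \<subseteq> A \<and> (\<forall>i. lookup e i \<le> d)}"
proof (rule finite_imageD)
  have "lookup ` {e :: 'a \<Rightarrow>\<^sub>0 nat. keys e \<subseteq> A \<and> (\<forall>i. lookup e i \<le> d)}
    \<subseteq> {f. \<forall>x. (x \<in> A \<longrightarrow> f x \<in> {..d}) \<and> (x \<notin> A \<longrightarrow> f x = 0)}"
    by (auto simp: in_keys_iff)
  then show "finite (lookup ` {e :: 'a \<Rightarrow>\<^sub>0 nat. keys e \<subseteq> A \<and> (\<forall>i. lookup e i \<le> d)})"
    by (rule finite_subset) (rule finite_set_of_finite_funs[OF assms finite_atMost])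
qed (auto intro!: inj_onI poly_mapping_eqI)

lemma finite_expos_esize:
  assumes "finite A"
  shows "finite {e :: 'a \<Rightarrow>\<^sub>0 nat. keys e \<subseteq> A \<and> esize e \<le> d}"
  by (rule finite_subset[OF _ finite_expos_bounded[OF assms, of d]])
     (auto intro: order_trans[OF lookup_le_esize])

lemma partition_antimono: "is_partition lam \<Longrightarrow> i \<le> j \<Longrightarrow> lookup lam j \<le> lookup lam i"
  by (auto simp: is_partition_def antimono_def)

lemma is_partitionI: "(\<And>i. lookup lam (Suc i) \<le> lookup lam i) \<Longrightarrow> is_partition lam"
  unfolding is_partition_def by (rule decseq_SucI)

lemma is_partition_zero [simp]: "is_partition 0"
  by (rule is_partitionI) simp

lemma downset_eq_lessThan:
  assumes "finite A" "\<And>j j'. j < j' \<Longrightarrow> j' \<in> A \<Longrightarrow> (j::nat) \<in> A"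
  shows "A = {..<card A}"
proof (cases "A = {}")
  case False
  have "A = {..<Suc (Max A)}"
    using assms(2)[of _ "Max A"] Max_in[OF assms(1) False] Max_ge[OF assms(1)]
    by (metis (no_types, lifting) lessThan_iff less_Suc_eq_le order_le_imp_less_or_eq subsetI subset_antisym)
  then show ?thesis by (metis card_lessThan)
qed simp

lemma partition_keys:
  assumes "is_partition lam"
  shows "keys lam = {..<part_length lam}"
  unfolding part_length_def
proof (rule downset_eq_lessThan)
  fix i j assume "i < j" "j \<in> keys lam"
  then show "i \<in> keys lam"
    using partition_antimono[OF assms, of i j] by (auto simp: in_keys_iff)
qed simp

lemma part_length_le_iff: "is_partition lam \<Longrightarrow> part_length lam \<le> n \<longleftrightarrow> keys lam \<subseteq> {..<n}"
  by (simp add: partition_keys lessThan_subset_iff)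

lemma mem_diagram [simp]: "(i, j) \<in> diagram lam \<longleftrightarrow> j < lookup lam i"
  by (simp add: diagram_def)

lemma diagram_eq_Sigma: "diagram lam = Sigma (keys lam) (\<lambda>i. {..<lookup lam i})"
  by (auto simp: in_keys_iff)

lemma finite_diagram [simp]: "finite (diagram lam)"
  by (simp add: diagram_eq_Sigma)

lemma card_diagram: "card (diagram lam) = esize lam"
  unfolding diagram_eq_Sigma by (simp add: esize_def)

lemma diagram_inject: "diagram lam = diagram lam' \<longleftrightarrow> lam = lam'"
proof
  assume *: "diagram lam = diagram lam'"
  show "lam = lam'"
  proof (rule poly_mapping_eqI)
    fix i
    have "{..<lookup lam i} = {..<lookup lam' i}"
      using * by (auto simp: set_eq_iff)
    then show "lookup lam i = lookup lam' i" by simp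
  qed
qed simp

definition tableaux :: "expo \<Rightarrow> expo \<Rightarrow> (nat \<times> nat \<Rightarrow> nat) set" where
  "tableaux lam \<beta> = {T \<in> SSYT lam. has_content lam T \<beta>}"

lemma schur_eq: "schur lam \<beta> = int (card (tableaux lam \<beta>))"
  by (simp add: schur_def tableaux_def)

lemma tableaux_entry:
  assumes "T \<in> tableaux lam \<beta>" "c \<in> diagram lam"
  shows "T c \<in> keys \<beta>"
proof -
  have "card {c' \<in> diagram lam. T c' = T c} \<noteq> 0"
    using assms(2) by (cases c) (auto simp: card_eq_0_iff)
  with assms(1) show ?thesis by (simp add: tableaux_def has_content_def in_keys_iff)
qed

lemma finite_tableaux [simp]: "finite (tableaux lam \<beta>)"
  by (rule finite_subset[OF _ finite_PiE[OF finite_diagram finite_keys, of lam "\<lambda>_. \<beta>"]])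
     (auto simp: PiE_def SSYT_def dest: tableaux_entry, auto simp: tableaux_def SSYT_def)

lemma tableaux_esize:
  assumes "T \<in> tableaux lam \<beta>"
  shows "esize \<beta> = esize lam"
proof -
  have "esize lam = card (\<Union>k\<in>keys \<beta>. {c \<in> diagram lam. T c = k})"
    unfolding card_diagram[symmetric]
    by (rule arg_cong[of _ _ card]) (use tableaux_entry[OF assms] in auto)
  also have "\<dots> = (\<Sum>k\<in>keys \<beta>. card {c \<in> diagram lam. T c = k})"
    by (rule card_UN_disjoint) auto
  also have "\<dots> = esize \<beta>"
    using assms by (simp add: tableaux_def has_content_def esize_def)
  finally show ?thesis by simp
qed

lemma schur_esize: "schur lam \<beta> \<noteq> 0 \<Longrightarrow> esize \<beta> = esize lam"
  using tableaux_esize by (fastforce simp: schur_eq card_eq_0_iff)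

lemma schur_zero: "schur lam 0 = (if lam = 0 then 1 else 0)"
proof (cases "lam = 0")
  case True
  have "tableaux 0 0 = {\<lambda>_. undefined}"
    by (auto simp: tableaux_def SSYT_def has_content_def diagram_def)
  then show ?thesis using True by (simp add: schur_eq)
next
  case False
  then show ?thesis using schur_esize[of lam 0] by auto
qed

section \<open>Horizontal strips and the branching rule for Schur functions\<close>

definition interlacing :: "expo \<Rightarrow> expo set" where
  "interlacing lam =
    {\<kappa>. \<forall>i. lookup lam (Suc i) \<le> lookup \<kappa> i \<and> lookup \<kappa> i \<le> lookup lam i}"

lemma interlacing_le: "\<kappa> \<in> interlacing lam \<Longrightarrow> lookup \<kappa> i \<le> lookup lam i"
  by (simp add: interlacing_def)

lemma interlacing_partition: "\<kappa> \<in> interlacing lam \<Longrightarrow> is_partition \<kappa>"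
  by (rule is_partitionI) (auto simp: interlacing_def intro: order_trans)

lemma interlacing_keys: "\<kappa> \<in> interlacing lam \<Longrightarrow> keys \<kappa> \<subseteq> keys lam"
proof
  fix x assume "\<kappa> \<in> interlacing lam" "x \<in> keys \<kappa>"
  then show "x \<in> keys lam" using interlacing_le[of \<kappa> lam x] by (simp add: in_keys_iff)
qed

lemma interlacing_diagram: "\<kappa> \<in> interlacing lam \<Longrightarrow> diagram \<kappa> \<subseteq> diagram lam"
proof
  fix c assume "\<kappa> \<in> interlacing lam" "c \<in> diagram \<kappa>"
  then show "c \<in> diagram lam"
    using interlacing_le[of \<kappa> lam "fst c"] by (cases c) simp
qed

lemma interlacing_esize: "\<kappa> \<in> interlacing lam \<Longrightarrow> esize \<kappa> \<le> esize lam"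
  unfolding card_diagram[symmetric] by (intro card_mono interlacing_diagram) auto

lemma finite_interlacing [simp]: "finite (interlacing lam)"
  by (rule finite_subset[OF _ finite_expos_esize[OF finite_keys, of lam "esize lam"]])
     (auto dest: interlacing_keys interlacing_esize)

lemma SSYT_row: "T \<in> SSYT lam \<Longrightarrow> j \<le> j' \<Longrightarrow> j' < lookup lam i \<Longrightarrow> T (i, j) \<le> T (i, j')"
  by (cases "j = j'") (auto simp: SSYT_def)

lemma SSYT_col: "T \<in> SSYT lam \<Longrightarrow> i < i' \<Longrightarrow> j < lookup lam i' \<Longrightarrow> T (i, j) < T (i', j)"
  by (auto simp: SSYT_def)

lemma SSYT_I:
  assumes "\<And>c. c \<notin> diagram lam \<Longrightarrow> T c = undefined"
    "\<And>i j j'. j < j' \<Longrightarrow> j' < lookup lam i \<Longrightarrow> T (i, j) \<le> T (i, j')"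
    "\<And>i i' j. i < i' \<Longrightarrow> j < lookup lam i' \<Longrightarrow> T (i, j) < T (i', j)"
  shows "T \<in> SSYT lam"
  using assms by (auto simp: SSYT_def extensional_def)

definition inner_shape :: "nat \<Rightarrow> expo \<Rightarrow> (nat \<times> nat \<Rightarrow> nat) \<Rightarrow> expo" where
  "inner_shape n lam T = Abs_poly_mapping (\<lambda>i. card {j. j < lookup lam i \<and> T (i, j) < n})"

lemma lookup_inner_shape: "lookup (inner_shape n lam T) i = card {j. j < lookup lam i \<and> T (i, j) < n}"
  unfolding inner_shape_def
proof (subst lookup_Abs_poly_mapping)
  show "finite {i. card {j. j < lookup lam i \<and> T (i, j) < n} \<noteq> 0}"
    by (rule finite_subset[OF _ finite_keys[of lam]]) (auto simp: in_keys_iff card_gt_0_iff)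
qed simp

lemma diagram_inner_shape:
  assumes "T \<in> SSYT lam"
  shows "diagram (inner_shape n lam T) = {c \<in> diagram lam. T c < n}"
proof -
  have "{j. j < lookup lam i \<and> T (i, j) < n} = {..<lookup (inner_shape n lam T) i}" for i
    unfolding lookup_inner_shape
  proof (rule downset_eq_lessThan)
    fix j j' assume "j < j'" "j' \<in> {j. j < lookup lam i \<and> T (i, j) < n}"
    then show "j \<in> {j. j < lookup lam i \<and> T (i, j) < n}"
      using SSYT_row[OF assms, of j j' i] by auto
  qed auto
  then show ?thesis by (auto simp: set_eq_iff)
qed

text \<open>Column strictness: a cell directly above another cell of \<open>lam\<close> has an entry
  below one that is at most \<open>n\<close>, so it belongs to the inner shape. Hence the cells with
  entry \<open>n\<close> form a horizontal strip.\<close>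

lemma inner_shape_interlacing:
  assumes "is_partition lam" "T \<in> SSYT lam" "\<And>c. c \<in> diagram lam \<Longrightarrow> T c \<le> n"
  shows "inner_shape n lam T \<in> interlacing lam"
proof -
  note D = diagram_inner_shape[OF assms(2), of n]
  have "lookup lam (Suc i) \<le> lookup (inner_shape n lam T) i" for i
  proof (rule ccontr)
    let ?j = "lookup (inner_shape n lam T) i"
    assume "\<not> ?thesis"
    then have *: "?j < lookup lam (Suc i)" by simp
    then have "T (i, ?j) < T (Suc i, ?j)" using assms(2) by (intro SSYT_col) auto
    also have "\<dots> \<le> n" using * by (intro assms(3)) simp
    finally have "(i, ?j) \<in> {c \<in> diagram lam. T c < n}"
      using * partition_antimono[OF assms(1), of i "Suc i"] by auto
    then show False unfolding D[symmetric] by simp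
  qed
  moreover have "lookup (inner_shape n lam T) i \<le> lookup lam i" for i
  proof -
    have "(i, j) \<in> diagram lam" if "(i, j) \<in> diagram (inner_shape n lam T)" for j
      using that unfolding D by blast
    then show ?thesis by (metis mem_diagram not_le order_less_irrefl)
  qed
  ultimately show ?thesis by (simp add: interlacing_def)
qed

text \<open>Deleting the cells with the largest entry \<open>n\<close> leaves a tableau whose shape
  differs from \<open>lam\<close> by a horizontal strip of \<open>k\<close> cells, and the strip can
  be refilled with \<open>n\<close> in exactly one way. Both the bialternant formula and the count
  of lattice points are derived from this recursion.\<close>

lemma schur_branching:
  assumes lam: "is_partition lam" and \<beta>: "keys \<beta> \<subseteq> {..<n}"
  shows "schur lam (\<beta> + single n k) =
    (\<Sum>\<kappa> | \<kappa> \<in> interlacing lam \<and> esize lam = esize \<kappa> + k. schur \<kappa> \<beta>)"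
proof -
  let ?K = "{\<kappa>. \<kappa> \<in> interlacing lam \<and> esize lam = esize \<kappa> + k}"
  let ?\<beta> = "\<beta> + single n k"
  define f where "f T = (inner_shape n lam T, restrict T (diagram (inner_shape n lam T)))" for T
  \<comment> \<open>The inverse refills the strip with \<open>n\<close>; the value
    \<open>undefined\<close> outside \<open>lam\<close> keeps the tableau extensional.\<close>
  define g where "g = (\<lambda>(\<kappa>, T) c. if c \<in> diagram \<kappa> then T c else
    if c \<in> diagram lam then n else undefined)"
  have \<beta>0: "lookup \<beta> i = 0" if "n \<le> i" for i
    using \<beta> that by (meson in_keys_iff lessThan_iff not_le subsetD)
  have f_in: "f T \<in> Sigma ?K (\<lambda>\<kappa>. tableaux \<kappa> \<beta>)" if T: "T \<in> tableaux lam ?\<beta>" for T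
  proof -
    let ?\<kappa> = "inner_shape n lam T"
    have TS: "T \<in> SSYT lam" and cont: "has_content lam T ?\<beta>" using T by (auto simp: tableaux_def)
    note D = diagram_inner_shape[OF TS, of n]
    have le: "T c \<le> n" if "c \<in> diagram lam" for c
      using tableaux_entry[OF T that] \<beta> by (auto simp: keys_add_nat split: if_splits)
    have \<kappa>: "?\<kappa> \<in> interlacing lam" by (rule inner_shape_interlacing[OF lam TS le])
    have "diagram lam = diagram ?\<kappa> \<union> {c \<in> diagram lam. T c = n}" using le D by fastforce
    then have "esize lam = card (diagram ?\<kappa> \<union> {c \<in> diagram lam. T c = n})"
      by (metis card_diagram)
    also have "\<dots> = esize ?\<kappa> + card {c \<in> diagram lam. T c = n}"
      unfolding card_diagram[symmetric] by (rule card_Un_disjoint) (auto simp: D)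
    also have "card {c \<in> diagram lam. T c = n} = k"
      using cont by (simp add: has_content_def lookup_add \<beta>0)
    finally have size: "esize lam = esize ?\<kappa> + k" .
    have "restrict T (diagram ?\<kappa>) \<in> SSYT ?\<kappa>"
    proof (rule SSYT_I)
      fix i j j' assume "j < j'" "j' < lookup ?\<kappa> i"
      moreover from this have "j' < lookup lam i" using interlacing_le[OF \<kappa>, of i] by simp
      ultimately show "restrict T (diagram ?\<kappa>) (i, j) \<le> restrict T (diagram ?\<kappa>) (i, j')"
        using SSYT_row[OF TS, of j j' i] by simp
    next
      fix i i' j assume "i < i'" "j < lookup ?\<kappa> i'"
      moreover from this have "j < lookup lam i'" using interlacing_le[OF \<kappa>, of i'] by simp
      moreover have "j < lookup ?\<kappa> i"
        using calculation partition_antimono[OF interlacing_partition[OF \<kappa>], of i i'] by simp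
      ultimately show "restrict T (diagram ?\<kappa>) (i, j) < restrict T (diagram ?\<kappa>) (i', j)"
        using SSYT_col[OF TS, of i i' j] by simp
    qed simp
    moreover have "has_content ?\<kappa> (restrict T (diagram ?\<kappa>)) \<beta>"
      unfolding has_content_def
    proof
      fix i
      have "{c \<in> diagram ?\<kappa>. restrict T (diagram ?\<kappa>) c = i}
        = (if i < n then {c \<in> diagram lam. T c = i} else {})"
        unfolding D by auto
      then show "card {c \<in> diagram ?\<kappa>. restrict T (diagram ?\<kappa>) c = i} = lookup \<beta> i"
        using cont by (auto simp: has_content_def lookup_add lookup_single \<beta>0)
    qed
    ultimately show ?thesis using \<kappa> size by (simp add: f_def tableaux_def)
  qed
  have g_in: "g p \<in> tableaux lam ?\<beta> \<and> f (g p) = p" if p: "p \<in> Sigma ?K (\<lambda>\<kappa>. tableaux \<kappa> \<beta>)" for p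
  proof -
    obtain \<kappa> T where pe: "p = (\<kappa>, T)" and \<kappa>: "\<kappa> \<in> interlacing lam" and sz: "esize lam = esize \<kappa> + k"
      and T: "T \<in> tableaux \<kappa> \<beta>" using p by auto
    have TS: "T \<in> SSYT \<kappa>" and cont: "has_content \<kappa> T \<beta>" using T by (auto simp: tableaux_def)
    have lt: "T c < n" if "c \<in> diagram \<kappa>" for c
      using tableaux_entry[OF T that] \<beta> by auto
    note sub = interlacing_diagram[OF \<kappa>]
    let ?T = "g (\<kappa>, T)"
    have gS: "?T \<in> SSYT lam"
    proof (rule SSYT_I)
      fix c assume "c \<notin> diagram lam"
      then show "?T c = undefined" using sub by (auto simp: g_def)
    next
      fix i j j' assume *: "j < j'" "j' < lookup lam i"
      then show "?T (i, j) \<le> ?T (i, j')"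
        using SSYT_row[OF TS, of j j' i] lt[of "(i, j)"] by (auto simp: g_def less_imp_le)
    next
      fix i i' j assume *: "i < i'" "j < lookup lam i'"
      \<comment> \<open>Interlacing puts every cell that has a cell of \<open>lam\<close> below it
        into \<open>\<kappa>\<close>, so the strip meets no column twice.\<close>
      have "lookup lam i' \<le> lookup lam (Suc i)" using * by (intro partition_antimono[OF lam]) auto
      also have "\<dots> \<le> lookup \<kappa> i" using \<kappa> by (simp add: interlacing_def)
      finally have "(i, j) \<in> diagram \<kappa>" using * by simp
      then show "?T (i, j) < ?T (i', j)"
        using SSYT_col[OF TS *(1), of j] lt[of "(i, j)"] * by (auto simp: g_def)
    qed
    have "has_content lam ?T ?\<beta>"
      unfolding has_content_def
    proof
      fix i
      consider "i < n" | "i = n" | "i > n" by linarith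
      then show "card {c \<in> diagram lam. ?T c = i} = lookup ?\<beta> i"
      proof cases
        case 1
        then have "{c \<in> diagram lam. ?T c = i} = {c \<in> diagram \<kappa>. T c = i}"
          using sub by (auto simp: g_def)
        then show ?thesis using cont 1 by (simp add: has_content_def lookup_add lookup_single)
      next
        case 2
        then have "?T c = i \<longleftrightarrow> c \<notin> diagram \<kappa>" if "c \<in> diagram lam" for c
          using lt[of c] that by (auto simp: g_def)
        then have "{c \<in> diagram lam. ?T c = i} = diagram lam - diagram \<kappa>" by blast
        then show ?thesis
          using 2 sz sub by (simp add: card_Diff_subset card_diagram lookup_add \<beta>0)
      next
        case 3
        then have "?T c \<noteq> i" if "c \<in> diagram lam" for c
          using lt[of c] that by (auto simp: g_def)
        then have "{c \<in> diagram lam. ?T c = i} = {}" by blast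
        then show ?thesis using 3 by (simp add: lookup_add \<beta>0 lookup_single)
      qed
    qed
    with gS have in_t: "?T \<in> tableaux lam ?\<beta>" by (simp add: tableaux_def)
    have "diagram (inner_shape n lam ?T) = diagram \<kappa>"
      unfolding diagram_inner_shape[OF gS] using sub lt by (auto simp: g_def)
    then have shp: "inner_shape n lam ?T = \<kappa>" by (simp add: diagram_inject)
    have "restrict ?T (diagram \<kappa>) = T"
      using TS by (auto simp: g_def SSYT_def extensional_def restrict_def fun_eq_iff)
    with shp in_t show ?thesis by (simp add: pe f_def)
  qed
  have gf: "g (f T) = T" if T: "T \<in> tableaux lam ?\<beta>" for T
  proof
    fix c
    have TS: "T \<in> SSYT lam" using T by (auto simp: tableaux_def)
    have le: "T c \<le> n" if "c \<in> diagram lam" for c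
      using tableaux_entry[OF T that] \<beta> by (auto simp: keys_add_nat split: if_splits)
    show "g (f T) c = T c"
      using le[of c] TS by (cases c) (auto simp: g_def f_def diagram_inner_shape[OF TS] SSYT_def extensional_def)
  qed
  have "bij_betw f (tableaux lam ?\<beta>) (Sigma ?K (\<lambda>\<kappa>. tableaux \<kappa> \<beta>))"
    using gf g_in f_in by (intro bij_betw_byWitness[of _ g]) blast+
  then have "card (tableaux lam ?\<beta>) = card (Sigma ?K (\<lambda>\<kappa>. tableaux \<kappa> \<beta>))"
    by (rule bij_betw_same_card)
  also have "\<dots> = (\<Sum>\<kappa>\<in>?K. card (tableaux \<kappa> \<beta>))"
    by (rule card_SigmaI) (auto intro: finite_subset[OF _ finite_interlacing[of lam]])
  finally show ?thesis by (simp add: schur_eq)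
qed

subsection \<open>Series with binomial denominators\<close>

text \<open>Multiplication by \<open>x\<^sup>b\<close> on coefficient functions. The difference
  \<open>e - b\<close> is meaningful only if \<open>b\<close> can be split off from
  \<open>e\<close>, hence the case distinction.\<close>

definition shift :: "'a::cancel_comm_monoid_add \<Rightarrow> ('a \<Rightarrow> 'b::zero) \<Rightarrow> 'a \<Rightarrow> 'b" where
  "shift b F e = (if \<exists>d. e = b + d then F (e - b) else 0)"

definition bdiff :: "'a::cancel_comm_monoid_add \<Rightarrow> ('a \<Rightarrow> 'b::comm_ring_1) \<Rightarrow> 'a \<Rightarrow> 'b" where
  "bdiff b F e = F e - shift b F e"

definition bdiffs :: "'a::cancel_comm_monoid_add multiset \<Rightarrow> ('a \<Rightarrow> 'b::comm_ring_1) \<Rightarrow> 'a \<Rightarrow> 'b" where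
  "bdiffs M F = fold_mset bdiff F M"

definition fin_supp :: "('a \<Rightarrow> 'b::zero) \<Rightarrow> bool" where
  "fin_supp F \<longleftrightarrow> finite {e. F e \<noteq> 0}"

lemma shift_add_left [simp]: "shift b F (b + d) = F d"
  by (auto simp: shift_def)

lemma shift_neq_0_E:
  assumes "shift b F e \<noteq> 0"
  obtains d where "e = b + d" "F d \<noteq> 0"
  using assms by (auto simp: shift_def split: if_splits)

lemma shift_not_add: "\<nexists>d. e = b + d \<Longrightarrow> shift b F e = 0"
  by (auto simp: shift_def)

lemma shift_zero_left [simp]: "shift 0 F = F"
  by (auto simp: shift_def fun_eq_iff)

lemma shift_shift: "shift a (shift b F) = shift (a + b) F"
proof
  fix e show "shift a (shift b F) e = shift (a + b) F e"
  proof (cases "\<exists>d. e = (a + b) + d")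
    case True
    then obtain d where "e = a + (b + d)" by (auto simp: add.assoc)
    then show ?thesis by (metis add.assoc shift_add_left)
  next
    case False
    then have "shift a (shift b F) e = 0"
      by (metis add.assoc shift_neq_0_E)
    with False show ?thesis by (simp add: shift_not_add)
  qed
qed

lemma shift_add_fun: "shift b (\<lambda>e. F e + G e :: 'b::comm_ring_1) e = shift b F e + shift b G e"
  by (simp add: shift_def)

lemma shift_diff_fun: "shift b (\<lambda>e. F e - G e :: 'b::comm_ring_1) e = shift b F e - shift b G e"
  by (simp add: shift_def)

lemma shift_scale_fun: "shift b (\<lambda>e. r * F e :: 'b::comm_ring_1) e = r * shift b F e"
  by (simp add: shift_def)

lemma bdiff_add_fun: "bdiff b (\<lambda>e. F e + G e) = (\<lambda>e. bdiff b F e + bdiff b G e)"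
  by (simp add: bdiff_def fun_eq_iff shift_add_fun)

lemma bdiff_scale_fun: "bdiff b (\<lambda>e. r * F e) = (\<lambda>e. r * bdiff b F e)"
  by (simp add: bdiff_def fun_eq_iff shift_scale_fun algebra_simps)

lemma bdiff_shift: "bdiff a (shift b F) = shift b (bdiff a F)"
  unfolding bdiff_def[abs_def]
  by (simp add: fun_eq_iff shift_diff_fun shift_shift add.commute)

lemma bdiff_commute: "bdiff a (bdiff b F) = bdiff b (bdiff a F)"
proof -
  have "bdiff a (bdiff b F) = (\<lambda>e. bdiff a F e - shift b (bdiff a F) e)" for a b
    by (subst bdiff_shift[symmetric])
       (simp add: bdiff_def fun_eq_iff shift_def)
  then show ?thesis by (simp add: bdiff_def[abs_def])
qed

text \<open>This is 1 - x^(a+b) = (1 - x^a) + x^a (1 - x^b). It lets a multiple of an exponent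
  replace it in a denominator, and it splits the series in Elliott's reduction.\<close>

lemma bdiff_add_left: "bdiff (a + b) F e = bdiff a F e + shift a (bdiff b F) e"
  unfolding bdiff_def[abs_def] by (simp add: shift_diff_fun shift_shift)

interpretation bdiff: comp_fun_commute bdiff
  by standard (simp add: fun_eq_iff bdiff_commute)

lemma bdiffs_empty [simp]: "bdiffs {#} F = F"
  by (simp add: bdiffs_def)

lemma bdiffs_add_mset [simp]: "bdiffs (add_mset b M) F = bdiff b (bdiffs M F)"
  by (simp add: bdiffs_def)

lemma bdiffs_bdiff: "bdiffs M (bdiff b F) = bdiff b (bdiffs M F)"
  by (induction M) (simp_all add: bdiff_commute)

lemma bdiffs_union: "bdiffs (M + N) F = bdiffs M (bdiffs N F)"
  by (induction M) simp_all

lemma bdiffs_shift: "bdiffs M (shift b F) = shift b (bdiffs M F)"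
  by (induction M) (simp_all add: bdiff_shift)

lemma bdiffs_add_fun: "bdiffs M (\<lambda>e. F e + G e) = (\<lambda>e. bdiffs M F e + bdiffs M G e)"
  by (induction M) (simp_all add: bdiff_add_fun)

lemma bdiffs_scale_fun: "bdiffs M (\<lambda>e. r * F e) = (\<lambda>e. r * bdiffs M F e)"
  by (induction M) (simp_all add: bdiff_scale_fun)

lemma fin_supp_add: "fin_supp F \<Longrightarrow> fin_supp G \<Longrightarrow> fin_supp (\<lambda>e. F e + G e :: 'b::comm_ring_1)"
  unfolding fin_supp_def
  by (rule finite_subset[of _ "{e. F e \<noteq> 0} \<union> {e. G e \<noteq> 0}"]) auto

lemma fin_supp_scale: "fin_supp F \<Longrightarrow> fin_supp (\<lambda>e. r * F e :: 'b::comm_ring_1)"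
  unfolding fin_supp_def by (erule finite_subset[rotated]) auto

lemma fin_supp_shift: "fin_supp F \<Longrightarrow> fin_supp (shift b F)"
  unfolding fin_supp_def
  by (rule finite_subset[of _ "(+) b ` {e. F e \<noteq> 0}"]) (auto elim!: shift_neq_0_E)

lemma fin_supp_bdiff: "fin_supp F \<Longrightarrow> fin_supp (bdiff b F)"
  using fin_supp_add[OF _ fin_supp_scale[OF fin_supp_shift], of F F "-1" b]
  by (simp add: bdiff_def[abs_def])

lemma fin_supp_bdiffs: "fin_supp F \<Longrightarrow> fin_supp (bdiffs M F)"
  by (induction M) (simp_all add: fin_supp_bdiff)

text \<open>
  \<open>bdiffs M F\<close> is the product of \<open>F\<close> with all \<open>1 - x\<^sup>b\<close>, \<open>b \<in> M\<close>; so \<open>binomial_rational B F\<close> says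
  that \<open>F\<close> has a denominator of this form with exponents \<open>b\<close> in \<open>B\<close>.
\<close>

definition binomial_rational :: "'a::cancel_comm_monoid_add set \<Rightarrow> ('a \<Rightarrow> 'b::comm_ring_1) \<Rightarrow> bool" where
  "binomial_rational B F \<longleftrightarrow> (\<exists>M. set_mset M \<subseteq> B \<and> fin_supp (bdiffs M F))"

lemma binomial_rationalI: "set_mset M \<subseteq> B \<Longrightarrow> fin_supp (bdiffs M F) \<Longrightarrow> binomial_rational B F"
  by (auto simp: binomial_rational_def)

lemma binomial_rational_fin_supp: "fin_supp F \<Longrightarrow> binomial_rational B F"
  by (rule binomial_rationalI[of "{#}"]) simp_all

lemma binomial_rational_bdiff:
  assumes "binomial_rational B (bdiff b F)" "b \<in> B"
  shows "binomial_rational B F"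
proof -
  obtain M where "set_mset M \<subseteq> B" "fin_supp (bdiffs M (bdiff b F))"
    using assms by (auto simp: binomial_rational_def)
  with \<open>b \<in> B\<close> show ?thesis
    by (intro binomial_rationalI[of "add_mset b M"]) (auto simp: bdiffs_bdiff)
qed

lemma binomial_rational_add:
  assumes "binomial_rational B F" "binomial_rational B G"
  shows "binomial_rational B (\<lambda>e. F e + G e)"
proof -
  obtain M N where "set_mset M \<subseteq> B" "fin_supp (bdiffs M F)" "set_mset N \<subseteq> B" "fin_supp (bdiffs N G)"
    using assms by (auto simp: binomial_rational_def)
  moreover have "bdiffs (N + M) G = bdiffs (M + N) G"
    by (simp add: add.commute)
  ultimately show ?thesis
    by (intro binomial_rationalI[of "N + M"])
       (auto simp: bdiffs_add_fun bdiffs_union intro!: fin_supp_add fin_supp_bdiffs)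
qed

lemma binomial_rational_scale: "binomial_rational B F \<Longrightarrow> binomial_rational B (\<lambda>e. r * F e)"
  unfolding binomial_rational_def by (auto simp: bdiffs_scale_fun intro!: fin_supp_scale)

lemma binomial_rational_diff:
  assumes "binomial_rational B F" "binomial_rational B G"
  shows "binomial_rational B (\<lambda>e. F e - G e)"
  using binomial_rational_add[OF assms(1) binomial_rational_scale[OF assms(2), of "-1"]] by simp

lemma binomial_rational_shift: "binomial_rational B F \<Longrightarrow> binomial_rational B (shift b F)"
  unfolding binomial_rational_def by (auto simp: bdiffs_shift intro!: fin_supp_shift)

lemma binomial_rational_sum:
  assumes "\<And>i. i \<in> I \<Longrightarrow> binomial_rational B (F i)"
  shows "binomial_rational B (\<lambda>e. \<Sum>i\<in>I. F i e)"
  using assms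
proof (induction I rule: infinite_finite_induct)
  case (insert i I)
  then show ?case by (simp add: binomial_rational_add)
qed (auto intro!: binomial_rational_fin_supp simp: fin_supp_def)

section \<open>Division by binomials and Elliott's reduction in a graded monoid\<close>

locale graded_cone =
  fixes deg :: "'a::cancel_comm_monoid_add \<Rightarrow> nat" and B :: "'a set"
  assumes deg_add: "deg (a + b) = deg a + deg b"
    and deg_pos: "b \<in> B \<Longrightarrow> 0 < deg b"
    and add_closed: "a \<in> B \<Longrightarrow> b \<in> B \<Longrightarrow> a + b \<in> B"
begin

text \<open>Descending from \<open>e\<close> by \<open>b\<close> while the difference vanishes stays
  inside the support of \<open>F\<close>, and it must stop because the degree drops. The multiple of
  \<open>b\<close> is written as a constant sum since \<open>'a\<close> carries addition
  only.\<close>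

lemma bdiff_support:
  assumes "b \<in> B" "F e \<noteq> 0"
  shows "\<exists>d k. e = d + (\<Sum>i<k::nat. b) \<and> bdiff b F d \<noteq> 0"
  using assms(2)
proof (induction "deg e" arbitrary: e rule: less_induct)
  case less
  show ?case
  proof (cases "bdiff b F e = 0")
    case True
    then have "shift b F e \<noteq> 0" using less.prems by (simp add: bdiff_def)
    then obtain d where d: "e = b + d" "F d \<noteq> 0" by (rule shift_neq_0_E)
    then have "deg d < deg e" using deg_pos[OF assms(1)] by (simp add: deg_add)
    from less.hyps[OF this d(2)] obtain d' k where "d = d' + (\<Sum>i<k::nat. b)" "bdiff b F d' \<noteq> 0"
      by blast
    then show ?thesis
      using d by (intro exI[of _ d'] exI[of _ "Suc k"]) (simp add: algebra_simps)
  next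
    case False
    then show ?thesis by (intro exI[of _ e] exI[of _ 0]) simp
  qed
qed

text \<open>Division by 1 - x^b with the geometric series. Since \<open>b\<close> has positive
  degree, the terms with \<open>k > deg e\<close> vanish at \<open>e\<close>, so truncating at
  \<open>deg e\<close> or anywhere beyond gives the same finite sum.\<close>

lemma bdiff_surj:
  assumes "b \<in> B"
  obtains H where "bdiff b H = F"
proof -
  define s where "s k = (\<Sum>i<k::nat. b)" for k
  have s_Suc: "s (Suc k) = b + s k" for k
    by (simp add: s_def add.commute)
  have deg_s: "k \<le> deg (s k)" for k
  proof (induction k)
    case (Suc k)
    then show ?case using deg_pos[OF assms] by (simp add: s_Suc deg_add)
  qed simp
  have big: "shift (s k) F e = 0" if "deg e < k" for k e
  proof (rule ccontr)
    assume "shift (s k) F e \<noteq> 0"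
    then obtain d where "e = s k + d" by (rule shift_neq_0_E)
    then show False using that deg_s[of k] by (simp add: deg_add)
  qed
  define H where "H e = (\<Sum>k\<le>deg e. shift (s k) F e)" for e
  have H_ext: "H e = (\<Sum>k\<le>K. shift (s k) F e)" if "deg e \<le> K" for e K
    unfolding H_def using that by (intro sum.mono_neutral_left) (auto simp: big)
  have "bdiff b H e = F e" for e
  proof (cases "\<exists>d. e = b + d")
    case True
    then obtain d where d: "e = b + d" by blast
    have "deg d \<le> deg e" by (simp add: d deg_add)
    then have "shift b H e = (\<Sum>k\<le>deg e. shift (s k) F d)"
      by (simp add: d H_ext)
    also have "\<dots> = (\<Sum>k\<le>deg e. shift b (shift (s k) F) e)"
      by (simp add: d)
    also have "\<dots> = (\<Sum>k\<le>deg e. shift (s (Suc k)) F e)"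
      by (simp add: shift_shift s_Suc)
    finally have "F e + shift b H e = (\<Sum>k\<le>Suc (deg e). shift (s k) F e)"
      by (subst sum.atMost_Suc_shift) (simp add: s_def)
    also have "\<dots> = H e" by (rule H_ext[symmetric]) simp
    finally show ?thesis by (simp add: bdiff_def algebra_simps)
  next
    case False
    then have "shift (s k) F e = 0" if "k > 0" for k
      using that by (cases k) (auto simp: s_Suc add.assoc intro!: shift_not_add)
    then have "H e = (\<Sum>k\<in>{0}. shift (s k) F e)"
      unfolding H_def by (intro sum.mono_neutral_right) auto
    with False show ?thesis by (simp add: bdiff_def shift_not_add s_def)
  qed
  then show thesis by (intro that) blast
qed

text \<open>1 - x^b divides 1 - x^(q b), so a denominator factor can be scaled to any positive
  multiple of its level \<open>l b\<close>.\<close>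

lemma multiple_in_B:
  fixes l :: "'a \<Rightarrow> int"
  assumes "b \<in> B" "0 < q" and l: "\<And>a b. l (a + b) = l a + l b"
  shows "\<exists>b'\<in>B. l b' = int q * l b \<and>
    (\<forall>F :: 'a \<Rightarrow> 'b::comm_ring_1. fin_supp (bdiff b F) \<longrightarrow> fin_supp (bdiff b' F))"
  using assms(2)
proof (induction q rule: nat_induct_non_zero)
  case 1
  then show ?case using assms(1) by auto
next
  case (Suc q)
  then obtain b' where b': "b' \<in> B" "l b' = int q * l b"
    "\<And>F :: 'a \<Rightarrow> 'b. fin_supp (bdiff b F) \<Longrightarrow> fin_supp (bdiff b' F)" by blast
  have "fin_supp (bdiff (b' + b) F)" if "fin_supp (bdiff b F)" for F :: "'a \<Rightarrow> 'b"
    unfolding bdiff_add_left[abs_def] using that b'(3)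
    by (intro fin_supp_add fin_supp_shift) auto
  then show ?case
    using b' assms(1)
    by (intro bexI[of _ "b' + b"]) (auto simp: l add_closed algebra_simps)
qed

text \<open>Exponents in the support of \<open>F\<close> arise from the support of its product with
  1 - x^b by adding multiples of \<open>b\<close>. Each addition raises the level by at least 1, so
  below \<open>c\<close> there are finitely many starting points and boundedly many steps from
  each.\<close>

lemma fin_supp_below_pos:
  fixes l :: "'a \<Rightarrow> int"
  assumes l: "\<And>a b. l (a + b) = l a + l b"
    and "set_mset M \<subseteq> B" "\<And>b. b \<in># M \<Longrightarrow> 0 < l b"
    and "\<And>c. fin_supp (\<lambda>e. if l e < c then bdiffs M F e else 0)"
  shows "fin_supp (\<lambda>e. if l e < c then F e else 0)"
  using assms(2-)
proof (induction M arbitrary: c)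
  case (add b M)
  have "fin_supp (\<lambda>e. if l e < c then bdiffs M F e else 0)" for c
  proof -
    let ?A = "{e. (if l e < c then bdiff b (bdiffs M F) e else 0) \<noteq> 0}"
    have fin: "finite ?A" using add.prems(3)[of c] unfolding fin_supp_def bdiffs_add_mset .
    have lb: "0 < l b" and bB: "b \<in> B" using add.prems by auto
    have l0: "l 0 = 0" using l[of 0 0] by simp
    have lk: "l (\<Sum>i<k::nat. b) = int k * l b" for k
      by (induction k) (simp_all add: l l0 algebra_simps)
    have "{e. (if l e < c then bdiffs M F e else 0) \<noteq> 0}
      \<subseteq> (\<Union>d\<in>?A. (\<lambda>k. d + (\<Sum>i<k::nat. b)) ` {..nat (c - l d)})"
    proof
      fix e assume "e \<in> {e. (if l e < c then bdiffs M F e else 0) \<noteq> 0}"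
      then have e: "l e < c" "bdiffs M F e \<noteq> 0" by (auto split: if_splits)
      from bdiff_support[OF bB, of "bdiffs M F" e, OF e(2)] obtain d k
        where dk: "e = d + (\<Sum>i<k::nat. b)" "bdiff b (bdiffs M F) d \<noteq> 0" by blast
      have le: "l e = l d + int k * l b" by (simp add: dk(1) l lk)
      moreover have "int k * 1 \<le> int k * l b" using lb by (intro mult_left_mono) auto
      ultimately have "l d < c" "k \<le> nat (c - l d)" using e(1) by linarith+
      then show "e \<in> (\<Union>d\<in>?A. (\<lambda>k. d + (\<Sum>i<k::nat. b)) ` {..nat (c - l d)})"
        using dk by auto
    qed
    then show ?thesis unfolding fin_supp_def using fin by (elim finite_subset) auto
  qed
  with add show ?case by auto
qed (simp only: bdiffs_empty)

text \<open>A shift by an exponent of level 0 preserves the level and therefore commutes with the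
  truncation.\<close>

lemma bdiffs_restrict_level:
  fixes l :: "'a \<Rightarrow> int"
  assumes l: "\<And>a b. l (a + b) = l a + l b" and "\<And>b. b \<in># M \<Longrightarrow> l b = 0"
  shows "bdiffs M (\<lambda>e. if l e < c then F e else 0) = (\<lambda>e. if l e < c then bdiffs M F e else 0)"
  using assms(2)
proof (induction M)
  case (add b M)
  then have "l b = 0" by simp
  then have "bdiff b (\<lambda>e. if l e < c then G e else 0) = (\<lambda>e. if l e < c then bdiff b G e else 0)"
    for G :: "'a \<Rightarrow> 'b"
    by (auto simp: bdiff_def fun_eq_iff shift_def l)
  with add show ?case unfolding bdiffs_add_mset by simp
qed (simp only: bdiffs_empty)

text \<open>The factors of level 0 commute with the truncation and remain in the denominator. The
  factors of positive level disappear: dividing by them leaves only finitely many terms below level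
  \<open>c\<close>.\<close>

lemma binomial_rational_below_nonneg:
  fixes l :: "'a \<Rightarrow> int"
  assumes l: "\<And>a b. l (a + b) = l a + l b"
    and M: "set_mset M \<subseteq> B" "\<And>b. b \<in># M \<Longrightarrow> 0 \<le> l b" and fin: "fin_supp (bdiffs M F)"
  shows "binomial_rational B (\<lambda>e. if l e < c then F e else 0)"
proof -
  let ?Z = "filter_mset (\<lambda>b. l b = 0) M" and ?P = "filter_mset (\<lambda>b. l b \<noteq> 0) M"
  have M_eq: "M = ?P + ?Z" using multiset_partition[of M "\<lambda>b. l b \<noteq> 0"] by simp
  have "bdiffs ?P (bdiffs ?Z F) = bdiffs M F"
    unfolding bdiffs_union[symmetric] M_eq[symmetric] ..
  with fin have "fin_supp (bdiffs ?P (bdiffs ?Z F))" by simp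
  then have "fin_supp (\<lambda>e. if l e < c then bdiffs ?P (bdiffs ?Z F) e else 0)" for c
    unfolding fin_supp_def by (rule finite_subset[rotated]) (auto split: if_splits)
  then have "fin_supp (\<lambda>e. if l e < c then bdiffs ?Z F e else 0)"
    by (rule fin_supp_below_pos[where l = l and M = ?P and F = "bdiffs ?Z F", rotated -1])
       (use M in \<open>auto simp: order_less_le l\<close>)
  then have "fin_supp (bdiffs ?Z (\<lambda>e. if l e < c then F e else 0))"
    by (subst bdiffs_restrict_level[OF l]) auto
  then show ?thesis using M(1) by (intro binomial_rationalI[of ?Z]) auto
qed

text \<open>
  Elliott's reduction. If \<open>l u = - l v\<close> and \<open>H = F / (1 - x\<^sup>u\<^sup>+\<^sup>v)\<close>, then
  \<open>F = (1 - x\<^sup>v) H + x\<^sup>v (1 - x\<^sup>u) H\<close>: both summands have one denominator factor outside \<open>l = 0\<close> less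
  than \<open>F\<close>. Replacing \<open>u\<close> and \<open>v\<close> by multiples achieves \<open>l u = - l v\<close> for factors of opposite sign.
\<close>

lemma binomial_rational_restrict_aux:
  fixes l :: "'a \<Rightarrow> int" and F :: "'a \<Rightarrow> 'b::comm_ring_1"
  assumes l: "\<And>a b. l (a + b) = l a + l b"
    and "set_mset M \<subseteq> B" "fin_supp (bdiffs M F)"
  shows "binomial_rational B (\<lambda>e. if c \<le> l e then F e else 0)"
  using assms(2-)
proof (induction "size (filter_mset (\<lambda>b. l b \<noteq> 0) M)" arbitrary: M F rule: less_induct)
  case less
  show ?case
  proof (cases "(\<exists>u\<in>#M. 0 < l u) \<and> (\<exists>v\<in>#M. l v < 0)")
    case True
    then obtain u v where u: "u \<in># M" "0 < l u" and v: "v \<in># M" "l v < 0" by blast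
    then have "v \<in># M - {#u#}" by (cases "u = v") (auto simp: in_diff_count)
    then obtain N where M: "M = add_mset u (add_mset v N)"
      using u(1) by (metis insert_DiffM)
    with less.prems have uB: "u \<in> B" and vB: "v \<in> B" and NB: "set_mset N \<subseteq> B" by auto
    have fin: "fin_supp (bdiff u (bdiff v (bdiffs N F)))" using less.prems M by simp
    obtain u' where u': "u' \<in> B" "l u' = int (nat (- l v)) * l u"
      "\<And>F :: 'a \<Rightarrow> 'b. fin_supp (bdiff u F) \<Longrightarrow> fin_supp (bdiff u' F)"
      using multiple_in_B[OF uB _ l, of "nat (- l v)"] v by auto
    obtain v' where v': "v' \<in> B" "l v' = int (nat (l u)) * l v"
      "\<And>F :: 'a \<Rightarrow> 'b. fin_supp (bdiff v F) \<Longrightarrow> fin_supp (bdiff v' F)"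
      using multiple_in_B[OF vB _ l, of "nat (l u)"] u by auto
    have fin': "fin_supp (bdiff u' (bdiff v' (bdiffs N F)))"
      using v'(3)[of "bdiff u' (bdiffs N F)"] u'(3)[OF fin]
      by (simp only: bdiff_commute[of v u'] bdiff_commute[of v' u'])
    define w where "w = u' + v'"
    have wB: "w \<in> B" using u' v' add_closed by (simp add: w_def)
    have lw: "l w = 0" using u v by (simp add: w_def l u'(2) v'(2))
    obtain H where H: "bdiff w H = F" using bdiff_surj[OF wB] by blast
    have F_eq: "F = (\<lambda>e. bdiff v' H e + shift v' (bdiff u' H) e)"
      unfolding H[symmetric] w_def by (simp add: fun_eq_iff bdiff_add_left add.commute[of u'])
    \<comment> \<open>The measure counts only factors of nonzero level: \<open>w\<close> has level
      0, and one of the two scaled factors is gone.\<close>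
    have small: "size (filter_mset (\<lambda>b. l b \<noteq> 0) (add_mset a (add_mset w N)))
        < size (filter_mset (\<lambda>b. l b \<noteq> 0) M)" for a
      using u v lw by (simp add: M)
    \<comment> \<open>The factor for \<open>w\<close> turns \<open>H\<close> back into
      \<open>F\<close>. In both summands the remaining factors then combine, up to a shift, to the
      product known to be finite from \<open>fin'\<close>.\<close>
    have F': "bdiff w (bdiffs N H) = bdiffs N F"
      by (simp add: H bdiffs_bdiff[symmetric])
    have 1: "binomial_rational B (\<lambda>e. if c \<le> l e then bdiff v' H e else 0)"
    proof (rule less.hyps[OF small])
      show "fin_supp (bdiffs (add_mset u' (add_mset w N)) (bdiff v' H))"
        using fin' by (simp only: bdiffs_bdiff bdiffs_add_mset F' bdiff_commute[of v' u'])
    qed (use u'(1) wB NB in auto)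
    have 2: "binomial_rational B (\<lambda>e. if c \<le> l e then shift v' (bdiff u' H) e else 0)"
    proof (rule less.hyps[OF small])
      show "fin_supp (bdiffs (add_mset v' (add_mset w N)) (shift v' (bdiff u' H)))"
        using fin' by (simp only: bdiffs_shift fin_supp_shift bdiffs_bdiff bdiffs_add_mset F')
    qed (use v'(1) wB NB in auto)
    have "(\<lambda>e. if c \<le> l e then F e else 0) =
      (\<lambda>e. (if c \<le> l e then bdiff v' H e else 0) +
           (if c \<le> l e then shift v' (bdiff u' H) e else 0))"
      by (rule ext) (simp add: fun_cong[OF F_eq])
    with binomial_rational_add[OF 1 2] show ?thesis by simp
  next
    case False
    then consider "\<And>b. b \<in># M \<Longrightarrow> 0 \<le> l b" | "\<And>b. b \<in># M \<Longrightarrow> 0 \<le> - l b"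
      by (meson neg_0_le_iff_le not_le)
    then show ?thesis
    proof cases
      case 1
      have "binomial_rational B (\<lambda>e. F e - (if l e < c then F e else 0))"
        using binomial_rational_diff[OF binomial_rationalI[OF less.prems]
            binomial_rational_below_nonneg[OF l less.prems(1) 1 less.prems(2)]] .
      then show ?thesis by (rule back_subst[where P = "binomial_rational B"]) auto
    next
      case 2
      \<comment> \<open>With all levels nonpositive the lemma is applied to \<open>- l\<close>; over
        the integers \<open>c \<le> l e\<close> means \<open>- l e < 1 - c\<close>.\<close>
      have "binomial_rational B (\<lambda>e. if - l e < 1 - c then F e else 0)"
        using binomial_rational_below_nonneg[OF _ less.prems(1) 2 less.prems(2)] by (simp add: l)
      then show ?thesis by (rule back_subst[where P = "binomial_rational B"]) auto
    qed
  qed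
qed

lemma binomial_rational_restrict:
  fixes l :: "'a \<Rightarrow> int"
  assumes "\<And>a b. l (a + b) = l a + l b" "binomial_rational B F"
  shows "binomial_rational B (\<lambda>e. if c \<le> l e then F e else 0)"
  using assms(2) binomial_rational_restrict_aux[OF assms(1)]
  unfolding binomial_rational_def[of B F] by blast

lemma binomial_rational_restrict_finite:
  fixes l :: "'i \<Rightarrow> 'a \<Rightarrow> int"
  assumes "finite I" "\<And>i a b. l i (a + b) = l i a + l i b" "binomial_rational B F"
  shows "binomial_rational B (\<lambda>e. if \<forall>i\<in>I. c i \<le> l i e then F e else 0)"
  using assms(1)
proof (induction I)
  case (insert i I)
  have "binomial_rational B (\<lambda>e. if c i \<le> l i e then (if \<forall>i\<in>I. c i \<le> l i e then F e else 0) else 0)"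
    using binomial_rational_restrict[OF assms(2) insert.IH] .
  then show ?case by (rule back_subst[where P = "binomial_rational B"]) (auto simp: fun_eq_iff)
qed (use assms(3) in simp)

end

subsection \<open>Alternants\<close>

text \<open>Given by the Leibniz expansion because coefficients are read off from it; the
  determinant serves for the column operations.\<close>

definition alternant :: "nat \<Rightarrow> (nat \<Rightarrow> 'a::comm_ring_1) \<Rightarrow> (nat \<Rightarrow> nat) \<Rightarrow> 'a" where
  "alternant n x l = (\<Sum>p | p permutes {..<n}. of_int (sign p) * (\<Prod>j<n. x (p j) ^ l j))"

lemma det_mat_col:
  "det (mat n n (\<lambda>(i, j). f i j)) =
    (\<Sum>p | p permutes {..<n}. of_int (sign p) * (\<Prod>j<n. f (p j) j :: 'a::comm_ring_1))"
proof -
  have "p i < n" if "p permutes {..<n}" "i < n" for p i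
    using permutes_in_image[OF that(1), of i] that(2) by simp
  then show ?thesis
    by (subst mat_det_left_def[of _ n])
       (auto simp: atLeast0LessThan intro!: sum.cong prod.cong arg_cong[of _ _ "(*) _"])
qed

lemma alternant_eq_det: "alternant n x l = det (mat n n (\<lambda>(i, j). x i ^ l j))"
  by (simp add: alternant_def det_mat_col)

lemma alternant_cong: "(\<And>j. j < n \<Longrightarrow> l j = l' j) \<Longrightarrow> alternant n x l = alternant n x l'"
  by (auto simp: alternant_def intro!: sum.cong prod.cong arg_cong[of _ _ "(*) _"])

lemma det_mat_mult_rows:
  "det (mat n n (\<lambda>(i, j). c i * f i j)) = (\<Prod>i<n. c i) * det (mat n n (\<lambda>(i, j). f i j :: 'a::comm_ring_1))"
proof -
  have "(\<Prod>j<n. c (p j)) = (\<Prod>i<n. c i)" if "p permutes {..<n}" for p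
    using prod.permute[OF that, of c] by (simp add: comp_def)
  then show ?thesis
    unfolding det_mat_col sum_distrib_left
    by (intro sum.cong) (auto simp: prod.distrib mult_ac)
qed

lemma det_mat_sum_cols:
  fixes f :: "nat \<Rightarrow> nat \<Rightarrow> 'k \<Rightarrow> 'a::comm_ring_1"
  assumes "\<And>j. finite (K j)"
  shows "det (mat n n (\<lambda>(i, j). \<Sum>k\<in>K j. f i j k)) =
    (\<Sum>k\<in>PiE {..<n} K. det (mat n n (\<lambda>(i, j). f i j (k j))))"
proof -
  have "det (mat n n (\<lambda>(i, j). \<Sum>k\<in>K j. f i j k)) =
    (\<Sum>p | p permutes {..<n}. of_int (sign p) * (\<Sum>k\<in>PiE {..<n} K. \<Prod>j<n. f (p j) j (k j)))"
    unfolding det_mat_col using assms by (simp add: prod_sum_PiE)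
  also have "\<dots> = (\<Sum>k\<in>PiE {..<n} K. det (mat n n (\<lambda>(i, j). f i j (k j))))"
    unfolding det_mat_col sum_distrib_left by (rule sum.swap)
  finally show ?thesis .
qed

text \<open>The usual factorisation of a^(t-s) - b^(t-s), multiplied by a^s and reindexed so that
  the summation range \<open>{s..<t}\<close> can later be read as an interlacing condition.\<close>

lemma power_diff_geometric:
  fixes a b :: "'a::comm_ring_1"
  assumes "s < t"
  shows "a ^ t - b ^ (t - s) * a ^ s = (a - b) * (\<Sum>k\<in>{s..<t}. a ^ k * b ^ (t - 1 - k))"
proof -
  obtain d where d: "t = s + Suc d" using assms less_iff_Suc_add by auto
  have "(\<Sum>k\<in>{s..<t}. a ^ k * b ^ (t - 1 - k)) = (\<Sum>p<Suc d. a ^ (p + s) * b ^ (d - p))"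
    unfolding d using sum.shift_bounds_nat_ivl[of "\<lambda>k. a ^ k * b ^ (s + d - k)" 0 s "Suc d"]
    by (simp add: atLeast0LessThan add.commute del: sum.lessThan_Suc)
  also have "\<dots> = a ^ s * (\<Sum>p<Suc d. a ^ p * b ^ (d - p))"
    by (simp add: sum_distrib_left power_add mult_ac del: sum.lessThan_Suc)
  finally have "(a - b) * (\<Sum>k\<in>{s..<t}. a ^ k * b ^ (t - 1 - k)) = a ^ s * (a ^ Suc d - b ^ Suc d)"
    unfolding diff_power_eq_sum by (simp only: mult_ac)
  then show ?thesis
    by (simp add: d power_add algebra_simps)
qed

text \<open>
  Subtracting \<open>x\<^sub>n\<^sup>l\<^sup>(\<^sup>j\<^sup>)\<^sup>-\<^sup>l\<^sup>(\<^sup>j\<^sup>+\<^sup>1\<^sup>)\<close> times column \<open>j + 1\<close> from column \<open>j\<close> clears the last row except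
  for its last entry, and makes row \<open>i < n\<close> divisible by \<open>x\<^sub>i - x\<^sub>n\<close>.
\<close>

lemma alternant_Suc:
  fixes x :: "nat \<Rightarrow> 'a::comm_ring_1"
  assumes l: "\<And>j. j < n \<Longrightarrow> l (Suc j) < l j"
  shows "alternant (Suc n) x l = (\<Prod>i<n. x i - x n) * x n ^ l n *
    det (mat n n (\<lambda>(i, j). \<Sum>k\<in>{l (Suc j)..<l j}. x i ^ k * x n ^ (l j - 1 - k)))"
proof -
  let ?N = "Suc n"
  define A where "A = mat ?N ?N (\<lambda>(i, j). x i ^ l j)"
  \<comment> \<open>The column operations as right multiplication by a lower unitriangular matrix,
    which leaves the determinant unchanged.\<close>
  define U where "U = mat ?N ?N (\<lambda>(i, j). if i = j then 1 else
    if i = Suc j then - (x n ^ (l j - l (Suc j))) else 0)"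
  define C where "C = mat ?N ?N (\<lambda>(i, j). if j < n
    then x i ^ l j - x n ^ (l j - l (Suc j)) * x i ^ l (Suc j) else x i ^ l j)"
  have carr: "A \<in> carrier_mat ?N ?N" "U \<in> carrier_mat ?N ?N" "C \<in> carrier_mat ?N ?N"
    by (auto simp: A_def U_def C_def)
  have "diag_mat U = map (\<lambda>i. 1) [0..<?N]"
    by (auto simp: diag_mat_def U_def)
  then have "prod_list (diag_mat U) = 1"
    by (metis map_replicate_const prod_list_replicate power_one)
  then have "det U = 1"
    by (subst det_lower_triangular[OF _ carr(2)]) (auto simp: U_def)
  moreover have "A * U = C"
  proof (rule eq_matI)
    fix i j assume ij: "i < dim_row C" "j < dim_col C"
    then have i: "i < ?N" and j: "j < ?N" using carr by auto
    have "(A * U) $$ (i, j) = (\<Sum>k<?N. x i ^ l k *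
        (if k = j then 1 else if k = Suc j then - (x n ^ (l j - l (Suc j))) else 0))"
      using i j carr by (simp add: scalar_prod_def A_def U_def atLeast0LessThan del: sum.lessThan_Suc)
    also have "\<dots> = (\<Sum>k<?N. (if k = j then x i ^ l j else 0) +
        (if k = Suc j then - (x n ^ (l j - l (Suc j)) * x i ^ l (Suc j)) else 0))"
      by (intro sum.cong) auto
    also have "\<dots> = C $$ (i, j)"
      using i j unfolding sum.distrib by (simp add: C_def del: sum.lessThan_Suc)
    finally show "(A * U) $$ (i, j) = C $$ (i, j)" .
  qed (use carr in auto)
  ultimately have "alternant ?N x l = det C"
    using det_mult[OF carr(1,2)] by (simp add: alternant_eq_det A_def)
  also have "\<dots> = (\<Sum>j<?N. C $$ (n, j) * cofactor C n j)"
    by (rule laplace_expansion_row[OF carr(3)]) simp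
  also have "\<dots> = (\<Sum>j\<in>{n}. C $$ (n, j) * cofactor C n j)"
  proof (intro sum.mono_neutral_right ballI)
    fix j assume "j \<in> {..<?N} - {n}"
    then have "j < n" by auto
    then have "C $$ (n, j) = 0"
      using l[of j] by (simp add: C_def power_add[symmetric])
    then show "C $$ (n, j) * cofactor C n j = 0" by simp
  qed auto
  also have "\<dots> = x n ^ l n * det (mat_delete C n n)"
    by (simp add: C_def cofactor_def mult_2[symmetric])
  also have "mat_delete C n n = mat n n (\<lambda>(i, j). (x i - x n) *
      (\<Sum>k\<in>{l (Suc j)..<l j}. x i ^ k * x n ^ (l j - 1 - k)))"
    by (rule eq_matI) (auto simp: C_def mat_delete_def power_diff_geometric[OF l])
  also have "det \<dots> = (\<Prod>i<n. x i - x n) *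
    det (mat n n (\<lambda>(i, j). \<Sum>k\<in>{l (Suc j)..<l j}. x i ^ k * x n ^ (l j - 1 - k)))"
    by (rule det_mat_mult_rows)
  finally show ?thesis by (simp add: mult_ac)
qed

definition stair :: "nat \<Rightarrow> nat \<Rightarrow> nat" where
  "stair n j = n - 1 - j"

text \<open>Multilinearity in the columns turns \<open>alternant_Suc\<close> into a sum over choices
  \<open>k j\<close> with \<open>l (Suc j) \<le> k j < l j\<close>. Since
  \<open>stair (Suc n) j\<close> is one more than \<open>stair n j\<close> for \<open>j < n\<close>,
  writing \<open>k j\<close> as \<open>lookup \<kappa> j + stair n j\<close> makes this range
  exactly the interlacing condition.\<close>

lemma alternant_branching:
  fixes x :: "nat \<Rightarrow> 'a::comm_ring_1"
  assumes lam: "is_partition lam" and keys: "keys lam \<subseteq> {..<Suc n}"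
  shows "alternant (Suc n) x (\<lambda>j. lookup lam j + stair (Suc n) j) = (\<Prod>i<n. x i - x n) *
    (\<Sum>\<kappa> | \<kappa> \<in> interlacing lam \<and> keys \<kappa> \<subseteq> {..<n}.
       alternant n x (\<lambda>j. lookup \<kappa> j + stair n j) * x n ^ (esize lam - esize \<kappa>))"
proof -
  define l where "l j = lookup lam j + stair (Suc n) j" for j
  define K where "K j = {l (Suc j)..<l j}" for j
  let ?I = "{\<kappa>. \<kappa> \<in> interlacing lam \<and> keys \<kappa> \<subseteq> {..<n}}"
  define h where "h \<kappa> = (\<lambda>j\<in>{..<n}. lookup \<kappa> j + stair n j)" for \<kappa> :: expo
  define g where "g k = Abs_poly_mapping (\<lambda>j. if j < n then k j - stair n j else 0)" for k :: "nat \<Rightarrow> nat"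
  have lookup_g: "lookup (g k) j = (if j < n then k j - stair n j else 0)" for k j
    unfolding g_def by (subst lookup_Abs_poly_mapping) (auto intro: finite_subset[of _ "{..<n}"])
  have l_less: "l (Suc j) < l j" if "j < n" for j
    using partition_antimono[OF lam, of j "Suc j"] that by (auto simp: l_def stair_def)
  have bij: "bij_betw h ?I (PiE {..<n} K)"
  proof (rule bij_betw_byWitness[of _ g])
    show "\<forall>\<kappa>\<in>?I. g (h \<kappa>) = \<kappa>"
      by (auto intro!: poly_mapping_eqI simp: lookup_g h_def in_keys_iff subset_eq)
    show "\<forall>k\<in>PiE {..<n} K. h (g k) = k"
    proof
      fix k assume k: "k \<in> PiE {..<n} K"
      have "stair n j \<le> k j" if "j < n" for j
        using PiE_mem[OF k, of j] that by (auto simp: K_def l_def stair_def)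
      then show "h (g k) = k"
        using k by (intro ext) (auto simp: h_def lookup_g PiE_def extensional_def)
    qed
    show "h ` ?I \<subseteq> PiE {..<n} K"
    proof (intro subsetI, elim imageE)
      fix k \<kappa> assume k: "k = h \<kappa>" and \<kappa>: "\<kappa> \<in> ?I"
      have "lookup \<kappa> j + stair n j \<in> K j" if "j < n" for j
      proof -
        have "lookup lam (Suc j) \<le> lookup \<kappa> j" "lookup \<kappa> j \<le> lookup lam j"
          using \<kappa> by (auto simp: interlacing_def)
        then show ?thesis using that by (auto simp: K_def l_def stair_def)
      qed
      then show "k \<in> PiE {..<n} K" by (auto simp: k h_def)
    qed
    show "g ` PiE {..<n} K \<subseteq> ?I"
    proof (intro subsetI, elim imageE)
      fix \<kappa> k assume \<kappa>: "\<kappa> = g k" and k: "k \<in> PiE {..<n} K"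
      have "lookup lam (Suc j) \<le> lookup \<kappa> j \<and> lookup \<kappa> j \<le> lookup lam j" for j
      proof (cases "j < n")
        case True
        then show ?thesis using PiE_mem[OF k, of j]
          by (auto simp: \<kappa> lookup_g K_def l_def stair_def)
      next
        case False
        then have "Suc j \<notin> keys lam" using keys by auto
        with False show ?thesis by (simp add: \<kappa> lookup_g in_keys_iff)
      qed
      then show "\<kappa> \<in> ?I"
        by (auto simp: interlacing_def \<kappa> lookup_g in_keys_iff split: if_splits)
    qed
  qed
  have term_eq: "x n ^ l n * det (mat n n (\<lambda>(i, j). x i ^ h \<kappa> j * x n ^ (l j - 1 - h \<kappa> j))) =
      alternant n x (\<lambda>j. lookup \<kappa> j + stair n j) * x n ^ (esize lam - esize \<kappa>)" if \<kappa>: "\<kappa> \<in> ?I" for \<kappa>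
  proof -
    have le: "lookup \<kappa> j \<le> lookup lam j" for j using \<kappa> interlacing_le by blast
    have "x n ^ l n * det (mat n n (\<lambda>(i, j). x i ^ h \<kappa> j * x n ^ (l j - 1 - h \<kappa> j))) =
      x n ^ l n * ((\<Sum>p | p permutes {..<n}. of_int (sign p) * (\<Prod>j<n. x (p j) ^ h \<kappa> j)) *
        (\<Prod>j<n. x n ^ (l j - 1 - h \<kappa> j)))"
      unfolding det_mat_col prod.distrib by (simp add: sum_distrib_right mult.assoc)
    also have "\<dots> = alternant n x (h \<kappa>) * x n ^ (l n + (\<Sum>j<n. l j - 1 - h \<kappa> j))"
      by (simp add: alternant_def power_sum power_add mult_ac)
    also have "alternant n x (h \<kappa>) = alternant n x (\<lambda>j. lookup \<kappa> j + stair n j)"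
      by (rule alternant_cong) (simp add: h_def)
    \<comment> \<open>In the exponent of \<open>x n\<close> the staircase contributions cancel, and
      \<open>stair (Suc n) n\<close> is 0.\<close>
    also have "l n + (\<Sum>j<n. l j - 1 - h \<kappa> j) = lookup lam n + (\<Sum>j<n. lookup lam j - lookup \<kappa> j)"
      by (auto simp: l_def h_def stair_def intro!: sum.cong)
    also have "\<dots> = esize lam - esize \<kappa>"
      using keys \<kappa> le
      by (simp add: esize_eq_sum[of "{..<Suc n}" lam] esize_eq_sum[of "{..<n}" \<kappa>] sum_subtractf_nat sum_mono)
    finally show ?thesis .
  qed
  have "alternant (Suc n) x (\<lambda>j. lookup lam j + stair (Suc n) j) = alternant (Suc n) x l"
    by (simp add: l_def[abs_def])
  also have "\<dots> = (\<Prod>i<n. x i - x n) * (\<Sum>k\<in>PiE {..<n} K.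
      x n ^ l n * det (mat n n (\<lambda>(i, j). x i ^ k j * x n ^ (l j - 1 - k j))))"
  proof -
    have "alternant (Suc n) x l = (\<Prod>i<n. x i - x n) * x n ^ l n *
        det (mat n n (\<lambda>(i, j). \<Sum>k\<in>K j. x i ^ k * x n ^ (l j - 1 - k)))"
      unfolding K_def by (rule alternant_Suc) (rule l_less)
    also have "det (mat n n (\<lambda>(i, j). \<Sum>k\<in>K j. x i ^ k * x n ^ (l j - 1 - k))) =
        (\<Sum>k\<in>PiE {..<n} K. det (mat n n (\<lambda>(i, j). x i ^ k j * x n ^ (l j - 1 - k j))))"
      by (rule det_mat_sum_cols) (simp add: K_def)
    finally show ?thesis by (simp add: sum_distrib_left mult_ac)
  qed
  also have "\<dots> = (\<Prod>i<n. x i - x n) * (\<Sum>\<kappa>\<in>?I.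
      x n ^ l n * det (mat n n (\<lambda>(i, j). x i ^ h \<kappa> j * x n ^ (l j - 1 - h \<kappa> j))))"
    by (subst sum.reindex_bij_betw[OF bij, symmetric]) simp
  finally show ?thesis using term_eq by simp
qed

lemma interlacing_zero: "interlacing 0 = {0}"
  by (auto simp: interlacing_def intro: poly_mapping_eqI)

text \<open>The branching of the empty partition, whose only interlacing shape is itself.\<close>

lemma vandermonde_Suc:
  "alternant (Suc n) x (stair (Suc n)) = (\<Prod>i<n. x i - x n) * alternant n x (stair n)"
proof -
  have "{\<kappa>. \<kappa> \<in> interlacing 0 \<and> keys \<kappa> \<subseteq> {..<n}} = {0}" by (auto simp: interlacing_zero)
  then show ?thesis using alternant_branching[of 0 n x] by simp
qed

lemma vandermonde_nonzero:
  fixes x :: "nat \<Rightarrow> 'a::idom"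
  assumes "inj x"
  shows "alternant n x (stair n) \<noteq> 0"
proof (induction n)
  case (Suc n)
  then show ?case using assms by (auto simp: vandermonde_Suc inj_def)
qed (simp add: alternant_def)

subsection \<open>Monomials and permutations of the variables\<close>

unbundle no m_inv_syntax

definition var :: "nat \<Rightarrow> expo \<Rightarrow>\<^sub>0 int" where
  "var i = single (single i 1) 1"

lemma inj_var: "inj var"
proof (rule injI)
  fix i j assume "var i = var j"
  then have "lookup (var i) (single i 1) = lookup (var j) (single i 1)" by simp
  then have "single j (1::nat) = single i 1" by (simp add: var_def lookup_single when_def split: if_splits)
  then have "keys (single j (1::nat)) = keys (single i (1::nat))" by simp
  then show "i = j" by simp
qed

lemma lookup_monomial_mult:
  fixes p :: "'a::cancel_comm_monoid_add \<Rightarrow>\<^sub>0 'b::comm_ring_1"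
  shows "lookup (single e c * p) \<alpha> = c * shift e (lookup p) \<alpha>"
proof -
  have "lookup (single e c * p) \<alpha> = (\<Sum>l. (c * (\<Sum>q. lookup p q when \<alpha> = l + q) when l = e))"
    unfolding lookup_mult by (intro Sum_any.cong) (auto simp: lookup_single when_def)
  also have "\<dots> = c * (\<Sum>q. lookup p q when \<alpha> = e + q)" by simp
  also have "(\<Sum>q. lookup p q when \<alpha> = e + q) = shift e (lookup p) \<alpha>"
  proof (cases "\<exists>d. \<alpha> = e + d")
    case True
    then obtain d where d: "\<alpha> = e + d" by blast
    have "(\<Sum>q. lookup p q when \<alpha> = e + q) = (\<Sum>q. lookup p q when q = d)"
      by (intro Sum_any.cong) (auto simp: d when_def)
    then show ?thesis by (simp add: d)
  next
    case False
    then show ?thesis by (simp add: shift_def)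
  qed
  finally show ?thesis .
qed

lemma var_power: "var i ^ k = single (single i k) 1"
  by (induction k) (simp_all add: var_def mult_single single_add[symmetric])

lemma prod_monomials: "(\<Prod>i\<in>A. single (e i) (1::int)) = single (\<Sum>i\<in>A. e i) 1"
  by (induction A rule: infinite_finite_induct) (simp_all add: mult_single)

definition perm_expo :: "nat \<Rightarrow> (nat \<Rightarrow> nat) \<Rightarrow> (nat \<Rightarrow> nat) \<Rightarrow> expo" where
  "perm_expo n p l = (\<Sum>j<n. single (p j) (l j))"

lemma prod_var: "(\<Prod>j<n. var (p j) ^ l j) = single (perm_expo n p l) 1"
  by (simp add: var_power prod_monomials perm_expo_def)

lemma lookup_perm_expo:
  assumes "p permutes {..<n}" "j < n"
  shows "lookup (perm_expo n p l) (p j) = l j"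
proof -
  have "lookup (perm_expo n p l) (p j) = (\<Sum>i<n. if i = j then l j else 0)"
    unfolding perm_expo_def lookup_sum
    by (intro sum.cong) (auto simp: lookup_single when_def dest: injD[OF permutes_inj[OF assms(1)]])
  then show ?thesis using assms(2) by simp
qed

lemma keys_perm_expo:
  assumes "p permutes {..<n}"
  shows "keys (perm_expo n p l) \<subseteq> {..<n}"
proof -
  have "keys (perm_expo n p l) \<subseteq> (\<Union>j<n. keys (single (p j) (l j)))"
    unfolding perm_expo_def by (rule keys_sum)
  also have "\<dots> \<subseteq> {..<n}" using permutes_in_image[OF assms] by auto
  finally show ?thesis .
qed

lemma perm_expo_id: "lookup (perm_expo n id l) j = (if j < n then l j else 0)"
  using lookup_perm_expo[OF permutes_id, of j n l] keys_perm_expo[OF permutes_id, of n l]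
  by (auto simp: in_keys_iff)

lemma perm_expo_eqI:
  assumes "p permutes {..<n}" "keys \<alpha> \<subseteq> {..<n}" "\<And>j. j < n \<Longrightarrow> lookup \<alpha> (p j) = l j"
  shows "\<alpha> = perm_expo n p l"
proof (rule poly_mapping_eqI)
  fix i
  show "lookup \<alpha> i = lookup (perm_expo n p l) i"
  proof (cases "i < n")
    case True
    then obtain j where "j < n" "i = p j"
      using permutes_image[OF assms(1)] by (metis imageE lessThan_iff)
    then show ?thesis using assms lookup_perm_expo by simp
  next
    case False
    then show ?thesis
      using assms(2) keys_perm_expo[OF assms(1), of l] by (metis in_keys_iff lessThan_iff subsetD)
  qed
qed

lemma esize_perm_expo: "esize (perm_expo n p l) = (\<Sum>j<n. l j)"
  unfolding perm_expo_def by (induction n) simp_all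

lemma lookup_alternant_mult:
  "lookup (alternant n var l * F) \<alpha> =
    (\<Sum>p | p permutes {..<n}. sign p * shift (perm_expo n p l) (lookup F) \<alpha>)"
proof -
  have "alternant n var l * F = (\<Sum>p | p permutes {..<n}. single (perm_expo n p l) (sign p) * F)"
    unfolding alternant_def prod_var sum_distrib_right
    by (intro sum.cong refl) (simp add: single_of_int[symmetric] mult_single del: single_of_int)
  then show ?thesis by (simp add: lookup_sum lookup_monomial_mult)
qed

section \<open>Permutations of the variables acting on exponents\<close>

abbreviation act :: "(nat \<Rightarrow> nat) \<Rightarrow> expo \<Rightarrow> expo" where
  "act \<equiv> Poly_Mapping.map_key"

lemma lookup_act: "inj \<sigma> \<Longrightarrow> lookup (act \<sigma> \<alpha>) i = lookup \<alpha> (\<sigma> i)"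
  by (simp add: map_key.rep_eq)

lemma act_inv:
  assumes "\<sigma> permutes A"
  shows "act (inv \<sigma>) (act \<sigma> \<alpha>) = \<alpha>" "act \<sigma> (act (inv \<sigma>) \<alpha>) = \<alpha>"
  using permutes_inj[OF assms] permutes_inj[OF permutes_inv[OF assms]]
  by (auto intro!: poly_mapping_eqI simp: lookup_act permutes_inverses[OF assms])

lemma inj_act: "\<sigma> permutes A \<Longrightarrow> inj (act \<sigma>)"
  by (metis act_inv(1) injI)

lemma act_add: "inj \<sigma> \<Longrightarrow> act \<sigma> (a + b) = act \<sigma> a + act \<sigma> b"
  by (rule poly_mapping_eqI) (simp add: lookup_act lookup_add)

lemma keys_act_subset:
  assumes "\<sigma> permutes {..<n}"
  shows "keys (act \<sigma> \<alpha>) \<subseteq> {..<n} \<longleftrightarrow> keys \<alpha> \<subseteq> {..<n}"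
proof -
  have "keys (act \<tau> \<alpha>) \<subseteq> {..<n}" if "keys \<alpha> \<subseteq> {..<n}" "\<tau> permutes {..<n}" for \<tau> \<alpha>
  proof
    fix i assume "i \<in> keys (act \<tau> \<alpha>)"
    then have "\<tau> i \<in> keys \<alpha>" using permutes_inj[OF that(2)] by (simp add: in_keys_iff lookup_act)
    then have "\<tau> i < n" using that(1) by auto
    then show "i \<in> {..<n}" using permutes_in_image[OF that(2), of i] by simp
  qed
  then show ?thesis using assms by (metis act_inv(1) permutes_inv)
qed

lemma esize_act:
  assumes "\<sigma> permutes A"
  shows "esize (act \<sigma> \<alpha>) = esize \<alpha>"
  unfolding esize_def
  using permutes_inj[OF assms] permutes_inverses[OF assms]
  by (intro sum.reindex_bij_witness[of _ "inv \<sigma>" \<sigma>]) (auto simp: in_keys_iff lookup_act)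

text \<open>\<open>act \<sigma>\<close> composes the exponent with \<open>\<sigma>\<close> on the
  right, so it is the inverse permutation that moves the variable \<open>j\<close> to
  \<open>\<sigma> j\<close>.\<close>

lemma act_perm_expo:
  assumes "\<sigma> permutes {..<n}" "p permutes {..<n}"
  shows "act (inv \<sigma>) (perm_expo n p l) = perm_expo n (\<sigma> \<circ> p) l"
proof (rule perm_expo_eqI)
  show "\<sigma> \<circ> p permutes {..<n}" using assms by (intro permutes_compose)
  have i: "inv \<sigma> permutes {..<n}" using assms by (intro permutes_inv)
  show "keys (act (inv \<sigma>) (perm_expo n p l)) \<subseteq> {..<n}"
    using keys_act_subset[OF i] keys_perm_expo[OF assms(2)] by blast
  fix j assume "j < n"
  then show "lookup (act (inv \<sigma>) (perm_expo n p l)) ((\<sigma> \<circ> p) j) = l j"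
    using permutes_inj[OF i] permutes_inverses[OF assms(1)] lookup_perm_expo[OF assms(2)]
    by (simp add: lookup_act)
qed

lemma shift_act:
  assumes "\<sigma> permutes A"
  shows "shift e G (act \<sigma> \<alpha>) = shift (act (inv \<sigma>) e) (\<lambda>\<beta>. G (act \<sigma> \<beta>)) \<alpha>"
proof -
  have inj: "inj \<sigma>" "inj (inv \<sigma>)" using permutes_inj assms permutes_inv by blast+
  show ?thesis
  proof (cases "\<exists>d. act \<sigma> \<alpha> = e + d")
    case True
    then obtain d where d: "act \<sigma> \<alpha> = e + d" by blast
    then have "\<alpha> = act (inv \<sigma>) e + act (inv \<sigma>) d"
      by (metis act_add act_inv(1) assms inj(2))
    then have "shift (act (inv \<sigma>) e) (\<lambda>\<beta>. G (act \<sigma> \<beta>)) \<alpha> = G (act \<sigma> (act (inv \<sigma>) d))"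
      by (simp only: shift_add_left)
    then show ?thesis by (simp add: d act_inv(2)[OF assms])
  next
    case False
    then have "\<nexists>d. \<alpha> = act (inv \<sigma>) e + d"
      by (metis act_add act_inv(2) assms inj(1))
    with False show ?thesis by (simp add: shift_not_add)
  qed
qed

text \<open>Permuting the variables reindexes the Leibniz sum by left composition with
  \<open>\<sigma>\<close>, at the cost of its sign. \<open>F\<close> is arbitrary, so that the lemma
  can also be used to prove that a factor \<open>F\<close> is symmetric.\<close>

lemma lookup_alternant_mult_act:
  assumes \<sigma>: "\<sigma> permutes {..<n}"
  shows "lookup (alternant n var l * F) (act \<sigma> \<alpha>) =
    sign \<sigma> * lookup (alternant n var l * Poly_Mapping.map_key (act \<sigma>) F) \<alpha>"
proof -
  let ?G = "lookup (Poly_Mapping.map_key (act \<sigma>) F)"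
  have G: "?G = (\<lambda>\<beta>. lookup F (act \<sigma> \<beta>))"
    by (simp add: fun_eq_iff map_key.rep_eq[OF inj_act[OF \<sigma>]])
  have "lookup (alternant n var l * F) (act \<sigma> \<alpha>) =
      (\<Sum>p | p permutes {..<n}. sign p * shift (perm_expo n (\<sigma> \<circ> p) l) ?G \<alpha>)"
    unfolding lookup_alternant_mult G
    by (intro sum.cong refl) (simp add: shift_act[OF \<sigma>] act_perm_expo[OF \<sigma>])
  also have "\<dots> = (\<Sum>p | p permutes {..<n}. sign \<sigma> * (sign (\<sigma> \<circ> p) * shift (perm_expo n (\<sigma> \<circ> p) l) ?G \<alpha>))"
  proof (intro sum.cong refl)
    fix p assume "p \<in> {p. p permutes {..<n}}"
    then have "sign (\<sigma> \<circ> p) = sign \<sigma> * sign p"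
      using \<sigma> by (intro sign_compose) (auto intro: permutes_imp_permutation[of "{..<n}"])
    then show "sign p * shift (perm_expo n (\<sigma> \<circ> p) l) ?G \<alpha> =
        sign \<sigma> * (sign (\<sigma> \<circ> p) * shift (perm_expo n (\<sigma> \<circ> p) l) ?G \<alpha>)"
      by (simp add: mult.assoc[symmetric])
  qed
  also have "\<dots> = sign \<sigma> * (\<Sum>p | p permutes {..<n}. sign p * shift (perm_expo n p l) ?G \<alpha>)"
  proof -
    have "bij_betw ((\<circ>) \<sigma>) {p. p permutes {..<n}} {p. p permutes {..<n}}"
      by (rule bij_betw_byWitness[of _ "(\<circ>) (inv \<sigma>)"])
         (use \<sigma> permutes_inv[OF \<sigma>] in
           \<open>auto simp: o_assoc permutes_inv_o[OF \<sigma>] intro: permutes_compose\<close>)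
    from sum.reindex_bij_betw[OF this, of "\<lambda>p. sign p * shift (perm_expo n p l) ?G \<alpha>"]
    show ?thesis by (simp add: sum_distrib_left[symmetric])
  qed
  finally show ?thesis by (simp add: lookup_alternant_mult)
qed

subsection \<open>Schur polynomials as quotients of alternants\<close>

text \<open>Sets all variables with index at least \<open>n\<close> to 0, which leaves a polynomial
  of a homogeneous series.\<close>

definition restrict_vars :: "nat \<Rightarrow> (expo \<Rightarrow> int) \<Rightarrow> expo \<Rightarrow> int" where
  "restrict_vars n f \<alpha> = (if keys \<alpha> \<subseteq> {..<n} then f \<alpha> else 0)"

lemma finite_restrict_vars:
  assumes "\<And>\<alpha>. f \<alpha> \<noteq> 0 \<Longrightarrow> esize \<alpha> = d"
  shows "finite {\<alpha>. restrict_vars n f \<alpha> \<noteq> 0}"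
  by (rule finite_subset[OF _ finite_expos_esize[of "{..<n}" d]])
     (auto simp: restrict_vars_def assms split: if_splits)

definition schur_poly :: "nat \<Rightarrow> expo \<Rightarrow> expo \<Rightarrow>\<^sub>0 int" where
  "schur_poly n lam = Abs_poly_mapping (restrict_vars n (schur lam))"

lemma lookup_schur_poly: "lookup (schur_poly n lam) = restrict_vars n (schur lam)"
  unfolding schur_poly_def
  by (rule lookup_Abs_poly_mapping, rule finite_restrict_vars, rule schur_esize)

lemma schur_poly_0: "schur_poly 0 lam = (if lam = 0 then 1 else 0)"
  by (rule poly_mapping_eqI)
     (simp add: lookup_schur_poly restrict_vars_def schur_zero lookup_one when_def)

text \<open>The branching rule for all exponents of the last variable at once, in the form to be
  compared with \<open>alternant_branching\<close>.\<close>

lemma schur_poly_Suc: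
  assumes lam: "is_partition lam"
  shows "schur_poly (Suc n) lam =
    (\<Sum>\<kappa>\<in>interlacing lam. schur_poly n \<kappa> * var n ^ (esize lam - esize \<kappa>))"
proof (rule poly_mapping_eqI)
  fix \<beta>
  let ?R = "\<Sum>\<kappa>\<in>interlacing lam. schur_poly n \<kappa> * var n ^ (esize lam - esize \<kappa>)"
  have R: "lookup ?R \<beta> =
      (\<Sum>\<kappa>\<in>interlacing lam. shift (single n (esize lam - esize \<kappa>)) (restrict_vars n (schur \<kappa>)) \<beta>)"
    unfolding lookup_sum
    by (intro sum.cong refl, subst mult.commute)
       (simp add: var_power lookup_monomial_mult lookup_schur_poly)
  show "lookup (schur_poly (Suc n) lam) \<beta> = lookup ?R \<beta>"
  proof (cases "keys \<beta> \<subseteq> {..<Suc n}")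
    case True
    define k where "k = lookup \<beta> n"
    define \<beta>' where "\<beta>' = \<beta> - single n k"
    have \<beta>: "\<beta> = \<beta>' + single n k"
      by (rule poly_mapping_eqI) (auto simp: \<beta>'_def k_def lookup_add lookup_minus lookup_single when_def)
    have \<beta>': "keys \<beta>' \<subseteq> {..<n}"
    proof
      fix i assume "i \<in> keys \<beta>'"
      then have i: "lookup \<beta>' i \<noteq> 0" by (simp add: in_keys_iff)
      then have "i \<noteq> n" by (auto simp: \<beta>'_def k_def lookup_minus)
      moreover have "i \<in> keys \<beta>" using i by (auto simp: \<beta>'_def in_keys_iff lookup_minus)
      ultimately show "i \<in> {..<n}" using True by (auto simp: less_Suc_eq)
    qed
    \<comment> \<open>A polynomial free of the variable \<open>n\<close>, multiplied by its
      \<open>t\<close>-th power, contributes only where that variable has exponent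
      \<open>t\<close>.\<close>
    have shift_eq: "shift (single n t) (restrict_vars n g) \<beta> = (if t = k then g \<beta>' else 0)" for t g
    proof (cases "t = k")
      case True
      have "shift (single n k) (restrict_vars n g) (single n k + \<beta>') = g \<beta>'"
        using \<beta>' by (simp add: restrict_vars_def)
      then show ?thesis using True \<beta> by (simp add: add.commute)
    next
      case False
      have "shift (single n t) (restrict_vars n g) \<beta> = 0"
      proof (rule ccontr)
        assume "shift (single n t) (restrict_vars n g) \<beta> \<noteq> 0"
        then obtain d where d: "\<beta> = single n t + d" "restrict_vars n g d \<noteq> 0" by (rule shift_neq_0_E)
        then have "lookup d n = 0" by (auto simp: restrict_vars_def in_keys_iff split: if_splits)
        then show False using False d(1) by (simp add: k_def lookup_add)
      qed
      with False show ?thesis by simp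
    qed
    have "lookup (schur_poly (Suc n) lam) \<beta> =
        (\<Sum>\<kappa> | \<kappa> \<in> interlacing lam \<and> esize lam = esize \<kappa> + k. schur \<kappa> \<beta>')"
      using True schur_branching[OF lam \<beta>', of k] \<beta> by (simp add: lookup_schur_poly restrict_vars_def)
    also have "\<dots> = (\<Sum>\<kappa>\<in>interlacing lam. if esize lam - esize \<kappa> = k then schur \<kappa> \<beta>' else 0)"
      using interlacing_esize[of _ lam]
      by (subst sum.inter_filter[symmetric]) (auto intro!: sum.cong)
    finally show ?thesis unfolding R shift_eq .
  next
    case False
    have "shift (single n t) (restrict_vars n g) \<beta> = 0" for t g
    proof (rule ccontr)
      assume "shift (single n t) (restrict_vars n g) \<beta> \<noteq> 0"
      then obtain d where d: "\<beta> = single n t + d" "restrict_vars n g d \<noteq> 0" by (rule shift_neq_0_E)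
      then have "keys d \<subseteq> {..<n}" by (auto simp: restrict_vars_def split: if_splits)
      then have "keys \<beta> \<subseteq> {..<Suc n}" by (auto simp: d(1) keys_add_nat split: if_splits)
      then show False using False by blast
    qed
    then show ?thesis unfolding R using False by (simp add: lookup_schur_poly restrict_vars_def)
  qed
qed

text \<open>An interlacing shape loses at most one row, so a shape with more rows than variables is
  still nonempty when no variable is left.\<close>

lemma schur_poly_eq_0:
  "is_partition lam \<Longrightarrow> \<not> keys lam \<subseteq> {..<n} \<Longrightarrow> schur_poly n lam = 0"
proof (induction n arbitrary: lam)
  case 0
  then show ?case by (auto simp: schur_poly_0)
next
  case (Suc n)
  have "\<not> keys \<kappa> \<subseteq> {..<n}" if \<kappa>: "\<kappa> \<in> interlacing lam" for \<kappa>
  proof -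
    obtain i where i: "i \<in> keys lam" "Suc n \<le> i" using Suc.prems(2) by force
    then have "i - 1 \<in> keys \<kappa>"
      using \<kappa> by (cases i) (auto simp: interlacing_def in_keys_iff dest!: spec[of _ "i - 1"])
    then show ?thesis using i by auto
  qed
  then show ?case
    using Suc.IH interlacing_partition by (simp add: schur_poly_Suc[OF Suc.prems(1)])
qed

text \<open>Both sides satisfy the same recursion over interlacing shapes:
  \<open>schur_poly_Suc\<close> on the left, \<open>alternant_branching\<close> on the right, while
  the product of differences in front comes from \<open>vandermonde_Suc\<close>.\<close>

theorem bialternant:
  "is_partition lam \<Longrightarrow> keys lam \<subseteq> {..<n} \<Longrightarrow>
    alternant n var (stair n) * schur_poly n lam = alternant n var (\<lambda>j. lookup lam j + stair n j)"
proof (induction n arbitrary: lam)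
  case 0
  then show ?case by (simp add: schur_poly_0 alternant_def)
next
  case (Suc n)
  let ?I = "{\<kappa>. \<kappa> \<in> interlacing lam \<and> keys \<kappa> \<subseteq> {..<n}}"
  \<comment> \<open>Shapes with more than \<open>n\<close> rows occur in the branching of Schur
    polynomials but not in that of alternants; they contribute 0.\<close>
  have "schur_poly n \<kappa> = 0" if "\<kappa> \<in> interlacing lam - ?I" for \<kappa>
    using that interlacing_partition[of \<kappa> lam] by (intro schur_poly_eq_0) auto
  then have "schur_poly (Suc n) lam = (\<Sum>\<kappa>\<in>?I. schur_poly n \<kappa> * var n ^ (esize lam - esize \<kappa>))"
    unfolding schur_poly_Suc[OF Suc.prems(1)]
    by (intro sum.mono_neutral_right) auto
  then have "alternant (Suc n) var (stair (Suc n)) * schur_poly (Suc n) lam =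
    (\<Prod>i<n. var i - var n) *
      (\<Sum>\<kappa>\<in>?I. alternant n var (stair n) * schur_poly n \<kappa> * var n ^ (esize lam - esize \<kappa>))"
    by (simp add: vandermonde_Suc sum_distrib_left mult.assoc)
  also have "\<dots> = (\<Prod>i<n. var i - var n) * (\<Sum>\<kappa>\<in>?I.
      alternant n var (\<lambda>j. lookup \<kappa> j + stair n j) * var n ^ (esize lam - esize \<kappa>))"
    using Suc.IH interlacing_partition by (intro arg_cong[of _ _ "(*) _"] sum.cong refl) auto
  finally show ?case by (simp only: alternant_branching[OF Suc.prems])
qed

section \<open>Reading Schur coefficients off an alternant product\<close>

definition rho :: "nat \<Rightarrow> expo" where
  "rho n = perm_expo n id (stair n)"

lemma lookup_rho: "lookup (rho n) j = n - 1 - j"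
  by (simp add: rho_def perm_expo_id stair_def)

lemma keys_rho: "keys (rho n) \<subseteq> {..<n}"
  unfolding rho_def by (rule keys_perm_expo[OF permutes_id])

text \<open>Counting upwards from the last entry, strict decrease forces entry \<open>j\<close> to
  be at least \<open>n - 1 - j\<close>, so the truncated subtraction of \<open>rho n\<close> loses
  nothing.\<close>

lemma strictly_decreasing_eq_add_rho:
  assumes keys: "keys l \<subseteq> {..<n}" and dec: "\<And>j. Suc j < n \<Longrightarrow> lookup l (Suc j) < lookup l j"
  obtains lam where "is_partition lam" "keys lam \<subseteq> {..<n}" "l = lam + rho n"
proof -
  have "k \<le> lookup l (n - 1 - k)" if "k < n" for k
    using that
  proof (induction k)
    case (Suc k)
    then have "lookup l (Suc (n - 1 - Suc k)) < lookup l (n - 1 - Suc k)"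
      by (intro dec) auto
    moreover have "Suc (n - 1 - Suc k) = n - 1 - k" using Suc.prems by auto
    ultimately show ?case using Suc by simp
  qed simp
  note bound = this
  have ge: "n - 1 - j \<le> lookup l j" for j
  proof (cases "j < n")
    case True
    then have "n - 1 - (n - 1 - j) = j" by simp
    with bound[of "n - 1 - j"] True show ?thesis by simp
  qed simp
  define lam where "lam = l - rho n"
  have lk: "lookup lam j = lookup l j - (n - 1 - j)" for j
    by (simp add: lam_def lookup_minus lookup_rho)
  have "is_partition lam"
  proof (rule is_partitionI)
    fix j
    show "lookup lam (Suc j) \<le> lookup lam j"
    proof (cases "Suc j < n")
      case True
      then show ?thesis using dec[OF True] by (auto simp: lk)
    next
      case False
      then have "Suc j \<notin> keys l" using keys by auto
      then show ?thesis by (simp add: lk in_keys_iff)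
    qed
  qed
  moreover have "keys lam \<subseteq> {..<n}"
    using keys by (auto simp: in_keys_iff lk subset_eq)
  moreover have "l = lam + rho n"
    by (rule poly_mapping_eqI) (use ge in \<open>simp add: lookup_add lk lookup_rho\<close>)
  ultimately show thesis by (rule that)
qed

lemma add_rho_eq_perm_expo:
  assumes "keys lam \<subseteq> {..<n}"
  shows "lam + rho n = perm_expo n id (\<lambda>j. lookup lam j + stair n j)"
proof (rule perm_expo_eqI[OF permutes_id])
  show "keys (lam + rho n) \<subseteq> {..<n}" using assms keys_rho[of n] by (auto simp: keys_add_nat)
qed (simp add: lookup_add lookup_rho stair_def)

lemma add_rho_strict:
  assumes "is_partition lam" "i < j" "j < n"
  shows "lookup (lam + rho n) j < lookup (lam + rho n) i"
  using partition_antimono[OF assms(1), of i j] assms(2,3) by (simp add: lookup_add lookup_rho)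

text \<open>An increasing map satisfies \<open>j \<le> p j\<close>; the inverse is increasing too
  and gives the opposite inequality.\<close>

lemma strict_mono_permutes_id:
  assumes p: "p permutes {..<n}" and mono: "\<And>i j. i < j \<Longrightarrow> j < n \<Longrightarrow> p i < (p j :: nat)"
  shows "p = id"
proof -
  have ge: "j \<le> q j" if "j < n" "\<And>i j. i < j \<Longrightarrow> j < n \<Longrightarrow> q i < q j" for j and q :: "nat \<Rightarrow> nat"
    using that(1)
  proof (induction j)
    case (Suc j)
    then show ?case using that(2)[of j "Suc j"] by simp
  qed simp
  have "inv p i < inv p j" if "i < j" "j < n" for i j
  proof (rule ccontr)
    assume "\<not> ?thesis"
    moreover have "inv p i \<noteq> inv p j" using that permutes_inverses(1)[OF p] by (metis less_irrefl)
    ultimately have "inv p j < inv p i" by simp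
    moreover have "inv p i < n" using permutes_in_image[OF permutes_inv[OF p], of i] that by simp
    ultimately have "p (inv p j) < p (inv p i)" by (rule mono)
    then show False using that by (simp add: permutes_inverses[OF p])
  qed
  then have "p j \<le> inv p (p j)" if "j < n" for j
    using ge[of "p j" "inv p"] permutes_in_image[OF p, of j] that by simp
  then have "p j = j" if "j < n" for j
    using that ge[of j p] mono by (auto simp: permutes_inverses[OF p] intro: antisym)
  then show ?thesis using permutes_not_in[OF p] by (metis eq_id_iff lessThan_iff)
qed

lemma shift_lookup_one: "shift e (lookup 1) \<alpha> = (if \<alpha> = e then 1 else 0)"
  by (auto simp: shift_def lookup_one when_def)

text \<open>The exponents of the alternant are the rearrangements of
  \<open>\<kappa> + rho n\<close>. Its first \<open>n\<close> entries are strictly decreasing, so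
  only the identity leads to another such vector \<open>lam + rho n\<close>, and then
  \<open>\<kappa> = lam\<close>.\<close>

lemma lookup_alternant_add_rho:
  assumes \<kappa>: "is_partition \<kappa>" "keys \<kappa> \<subseteq> {..<n}" and lam: "is_partition lam" "keys lam \<subseteq> {..<n}"
  shows "lookup (alternant n var (\<lambda>j. lookup \<kappa> j + stair n j)) (lam + rho n) = (if \<kappa> = lam then 1 else 0)"
proof -
  let ?l = "\<lambda>j. lookup \<kappa> j + stair n j"
  have *: "p = id \<and> \<kappa> = lam" if p: "p permutes {..<n}" and eq: "lam + rho n = perm_expo n p ?l" for p
  proof -
    have eqj: "lookup (lam + rho n) (p j) = lookup (\<kappa> + rho n) j" if "j < n" for j
      unfolding eq lookup_perm_expo[OF p that] by (simp add: lookup_add lookup_rho stair_def)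
    have "p = id"
    proof (rule strict_mono_permutes_id[OF p], rule ccontr)
      fix i j assume ij: "i < j" "j < n" and "\<not> p i < p j"
      moreover have "p i \<noteq> p j" using ij injD[OF permutes_inj[OF p]] by auto
      ultimately have "p j < p i" by simp
      moreover have "p i < n" using permutes_in_image[OF p, of i] ij by simp
      ultimately have "lookup (lam + rho n) (p i) < lookup (lam + rho n) (p j)"
        by (intro add_rho_strict[OF lam(1)])
      then show False using eqj ij add_rho_strict[OF \<kappa>(1) ij] by auto
    qed
    moreover have "lam + rho n = \<kappa> + rho n"
      using eq \<open>p = id\<close> add_rho_eq_perm_expo[OF \<kappa>(2)] by simp
    ultimately show ?thesis by simp
  qed
  have "lookup (alternant n var ?l) (lam + rho n) =
      (\<Sum>p | p permutes {..<n}. sign p * (if lam + rho n = perm_expo n p ?l then 1 else 0))"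
    using lookup_alternant_mult[of n ?l 1 "lam + rho n"] by (simp only: shift_lookup_one mult_1_right)
  also have "\<dots> = (\<Sum>p | p permutes {..<n}. if p = id then (if \<kappa> = lam then 1 else 0) else 0)"
    using * add_rho_eq_perm_expo[OF lam(2)] by (intro sum.cong refl) auto
  also have "\<dots> = (if \<kappa> = lam then 1 else 0)"
    by (subst sum.delta) (auto simp: permutes_id finite_permutations)
  finally show ?thesis .
qed

text \<open>The coefficient at \<open>lam + rho n\<close> of the Vandermonde alternant times
  \<open>f\<close> in \<open>n\<close> variables. Spelled out as a signed sum of finitely many
  shifts, it can be applied verbatim to the series in both sets of variables.\<close>

definition schur_coeff :: "nat \<Rightarrow> (expo \<Rightarrow> int) \<Rightarrow> expo \<Rightarrow> int" where
  "schur_coeff n f lam = (\<Sum>p | p permutes {..<n}.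
     sign p * shift (perm_expo n p (stair n)) (restrict_vars n f) (lam + rho n))"

text \<open>Multiplication by the Vandermonde alternant turns each Schur polynomial into a single
  alternant, which \<open>lookup_alternant_add_rho\<close> separates from the others. Only
  \<open>f\<close> in \<open>n\<close> variables enters, so coefficients obtained from different
  numbers of variables can be compared.\<close>

lemma schur_coeff_eq:
  assumes L: "finite L" "\<And>\<kappa>. \<kappa> \<in> L \<Longrightarrow> is_partition \<kappa>"
    and f: "\<And>\<alpha>. keys \<alpha> \<subseteq> {..<n} \<Longrightarrow> f \<alpha> = (\<Sum>\<kappa>\<in>L. a \<kappa> * schur \<kappa> \<alpha>)"
    and lam: "is_partition lam" "keys lam \<subseteq> {..<n}"
  shows "schur_coeff n f lam = (if lam \<in> L then a lam else 0)"
proof -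
  define F where "F = (\<Sum>\<kappa>\<in>L. single 0 (a \<kappa>) * schur_poly n \<kappa>)"
  have "lookup F = restrict_vars n f"
    by (auto simp: F_def lookup_sum lookup_monomial_mult lookup_schur_poly restrict_vars_def f fun_eq_iff)
  then have "schur_coeff n f lam = lookup (alternant n var (stair n) * F) (lam + rho n)"
    by (simp add: schur_coeff_def lookup_alternant_mult)
  also have "alternant n var (stair n) * F =
      (\<Sum>\<kappa>\<in>L. single 0 (a \<kappa>) * (alternant n var (stair n) * schur_poly n \<kappa>))"
    by (simp add: F_def sum_distrib_left mult_ac)
  also have "lookup \<dots> (lam + rho n) =
      (\<Sum>\<kappa>\<in>L. a \<kappa> * lookup (alternant n var (stair n) * schur_poly n \<kappa>) (lam + rho n))"
    by (simp add: lookup_sum lookup_monomial_mult)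
  also have "\<dots> = (\<Sum>\<kappa>\<in>L. if \<kappa> = lam then a lam else 0)"
  proof (intro sum.cong refl)
    fix \<kappa> assume \<kappa>: "\<kappa> \<in> L"
    show "a \<kappa> * lookup (alternant n var (stair n) * schur_poly n \<kappa>) (lam + rho n) = (if \<kappa> = lam then a lam else 0)"
    proof (cases "keys \<kappa> \<subseteq> {..<n}")
      case True
      then show ?thesis
        using L(2)[OF \<kappa>] lam by (simp add: bialternant lookup_alternant_add_rho)
    next
      case False
      then show ?thesis using L(2)[OF \<kappa>] lam(2) by (auto simp: schur_poly_eq_0)
    qed
  qed
  also have "\<dots> = (if lam \<in> L then a lam else 0)" using L(1) by simp
  finally show ?thesis .
qed

lemma schur_expansion_coeff:
  assumes "is_schur_expansion f a" "is_partition lam" "keys lam \<subseteq> {..<n}"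
  shows "a lam = schur_coeff n f lam"
  using assms schur_coeff_eq[of "{lam. a lam \<noteq> 0}" n f a lam]
  by (auto simp: is_schur_expansion_def)

lemma schur_expansion_unique:
  assumes "is_schur_expansion f a" "is_schur_expansion f b"
  shows "a = b"
proof
  fix lam
  show "a lam = b lam"
  proof (cases "is_partition lam")
    case True
    then show ?thesis
      using schur_expansion_coeff[OF assms(1) True] schur_expansion_coeff[OF assms(2) True]
      by (metis part_length_le_iff order_refl)
  next
    case False
    then show ?thesis using assms by (metis is_schur_expansion_def)
  qed
qed

subsection \<open>Existence of Schur expansions\<close>

definition antisymmetric :: "nat \<Rightarrow> (expo \<Rightarrow> int) \<Rightarrow> bool" where
  "antisymmetric n H \<longleftrightarrow> (\<forall>\<sigma> \<alpha>. \<sigma> permutes {..<n} \<longrightarrow> H (act \<sigma> \<alpha>) = sign \<sigma> * H \<alpha>) \<and>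
     (\<forall>\<alpha>. H \<alpha> \<noteq> 0 \<longrightarrow> keys \<alpha> \<subseteq> {..<n})"

lemma sorting_permutation:
  assumes "inj_on (f :: nat \<Rightarrow> nat) {..<n}"
  obtains q where "q permutes {..<n}" "\<And>j. Suc j < n \<Longrightarrow> f (q (Suc j)) < f (q j)"
proof -
  define xs where "xs = rev (sorted_list_of_set (f ` {..<n}))"
  have len: "length xs = n" by (simp add: xs_def card_image[OF assms])
  have set: "set xs = f ` {..<n}" by (simp add: xs_def)
  have dist: "distinct xs" by (simp add: xs_def)
  define q where "q j = (if j < n then inv_into {..<n} f (xs ! j) else j)" for j
  have "bij_betw (\<lambda>j. xs ! j) {..<n} (f ` {..<n})"
    using bij_betw_nth[OF dist refl refl] by (simp add: set len)
  moreover have "bij_betw (inv_into {..<n} f) (f ` {..<n}) {..<n}"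
    using assms by (simp add: inj_on_imp_bij_betw bij_betw_inv_into)
  ultimately have "bij_betw (inv_into {..<n} f \<circ> (\<lambda>j. xs ! j)) {..<n} {..<n}"
    by (rule bij_betw_trans)
  then have "bij_betw q {..<n} {..<n}"
    by (rule bij_betw_cong[THEN iffD1, rotated]) (simp add: q_def)
  then have "q permutes {..<n}" by (rule bij_imp_permutes) (simp add: q_def)
  moreover have "f (q j) = xs ! j" if "j < n" for j
  proof -
    have "xs ! j \<in> f ` {..<n}" using that len set nth_mem by metis
    then show ?thesis using that by (simp add: q_def f_inv_into_f)
  qed
  moreover have "xs ! Suc j < xs ! j" if "Suc j < n" for j
  proof -
    have "sorted_wrt (\<lambda>x y. y < x) xs"
      unfolding xs_def sorted_wrt_rev by (rule strict_sorted_list_of_set)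
    then show ?thesis using that len by (auto simp: sorted_wrt_iff_nth_less)
  qed
  ultimately show thesis by (intro that) auto
qed

text \<open>Sorting an exponent with distinct entries brings it to the form
  \<open>lam + rho n\<close> and costs a sign. An exponent with a repeated entry is fixed by a
  transposition, so its coefficient equals its own negative.\<close>

lemma antisymmetric_eqI:
  assumes "antisymmetric n H" "antisymmetric n H'"
    and eq: "\<And>lam. is_partition lam \<Longrightarrow> keys lam \<subseteq> {..<n} \<Longrightarrow> H (lam + rho n) = H' (lam + rho n)"
  shows "H \<alpha> = H' \<alpha>"
proof (cases "keys \<alpha> \<subseteq> {..<n}")
  case True
  have anti: "G (act \<sigma> \<alpha>) = sign \<sigma> * G \<alpha>" if "\<sigma> permutes {..<n}" "G = H \<or> G = H'" for \<sigma> G \<alpha>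
    using that assms by (auto simp: antisymmetric_def)
  show ?thesis
  proof (cases "inj_on (lookup \<alpha>) {..<n}")
    case True
    then obtain q where q: "q permutes {..<n}"
      and dec: "\<And>j. Suc j < n \<Longrightarrow> lookup \<alpha> (q (Suc j)) < lookup \<alpha> (q j)"
      by (rule sorting_permutation) blast
    have "keys (act q \<alpha>) \<subseteq> {..<n}" using \<open>keys \<alpha> \<subseteq> {..<n}\<close> keys_act_subset[OF q] by blast
    then obtain lam where "is_partition lam" "keys lam \<subseteq> {..<n}" "act q \<alpha> = lam + rho n"
      by (rule strictly_decreasing_eq_add_rho) (use dec permutes_inj[OF q] in \<open>auto simp: lookup_act\<close>)
    then have "H (act q \<alpha>) = H' (act q \<alpha>)" using eq by simp
    then have "sign q * H \<alpha> = sign q * H' \<alpha>" using anti[OF q] by simp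
    then show ?thesis by simp
  next
    case False
    then obtain i j where ij: "i < n" "j < n" "i \<noteq> j" "lookup \<alpha> i = lookup \<alpha> j"
      by (auto simp: inj_on_def)
    have t: "Transposition.transpose i j permutes {..<n}" using ij by (intro permutes_swap_id) auto
    have "act (Transposition.transpose i j) \<alpha> = \<alpha>"
      using ij permutes_inj[OF t] by (intro poly_mapping_eqI) (auto simp: lookup_act transpose_def)
    then have "G \<alpha> = 0" if "G = H \<or> G = H'" for G
      using anti[OF t that, of \<alpha>] ij(3) by (simp add: sign_swap_id)
    from this[of H] this[of H'] show ?thesis by simp
  qed
next
  case False
  then show ?thesis using assms(1,2) unfolding antisymmetric_def by metis
qed

lemma antisymmetric_alternant_mult:
  assumes "\<And>\<sigma>. \<sigma> permutes {..<n} \<Longrightarrow> Poly_Mapping.map_key (act \<sigma>) F = F"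
    and "\<And>\<alpha>. lookup F \<alpha> \<noteq> 0 \<Longrightarrow> keys \<alpha> \<subseteq> {..<n}"
  shows "antisymmetric n (lookup (alternant n var l * F))"
  unfolding antisymmetric_def
proof (intro conjI allI impI)
  fix \<alpha> assume "lookup (alternant n var l * F) \<alpha> \<noteq> 0"
  then obtain p where p: "p permutes {..<n}" "shift (perm_expo n p l) (lookup F) \<alpha> \<noteq> 0"
    unfolding lookup_alternant_mult by (auto elim!: sum.not_neutral_contains_not_neutral)
  from p(2) obtain d where "\<alpha> = perm_expo n p l + d" "lookup F d \<noteq> 0" by (rule shift_neq_0_E)
  then show "keys \<alpha> \<subseteq> {..<n}" using keys_perm_expo[OF p(1), of l] assms(2)[of d] by (auto simp: keys_add_nat)
qed (simp add: lookup_alternant_mult_act assms(1))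

lemma antisymmetric_alternant: "antisymmetric n (lookup (alternant n var l))"
proof -
  have "Poly_Mapping.map_key (act \<sigma>) 1 = (1 :: expo \<Rightarrow>\<^sub>0 int)" if "\<sigma> permutes {..<n}" for \<sigma>
  proof -
    have "act \<sigma> \<alpha> = 0 \<longleftrightarrow> \<alpha> = 0" for \<alpha>
      using esize_act[OF that, of \<alpha>] by (metis esize_eq_0_iff)
    then show ?thesis
      by (intro poly_mapping_eqI) (simp add: map_key.rep_eq[OF inj_act[OF that]] lookup_one)
  qed
  then show ?thesis
    using antisymmetric_alternant_mult[of n 1 l] by (simp add: lookup_one when_def split: if_splits)
qed

text \<open>Symmetry follows from the bialternant formula: the Vandermonde alternant and its product
  with the Schur polynomial are both antisymmetric, and the nonzero alternant can be
  cancelled.\<close>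

lemma schur_symmetric:
  assumes lam: "is_partition lam" and \<sigma>: "\<sigma> permutes {..<n}" and \<alpha>: "keys \<alpha> \<subseteq> {..<n}"
  shows "schur lam (act \<sigma> \<alpha>) = schur lam \<alpha>"
proof (cases "keys lam \<subseteq> {..<n}")
  case True
  let ?A = "alternant n var (stair n)" and ?P = "schur_poly n lam"
  let ?P' = "Poly_Mapping.map_key (act \<sigma>) ?P"
  have "lookup (?A * ?P') \<beta> = lookup (?A * ?P) \<beta>" for \<beta>
  proof -
    have "sign \<sigma> * lookup (?A * ?P') \<beta> = lookup (?A * ?P) (act \<sigma> \<beta>)"
      by (rule lookup_alternant_mult_act[OF \<sigma>, symmetric])
    also have "\<dots> = sign \<sigma> * lookup (?A * ?P) \<beta>"
      using antisymmetric_alternant \<sigma> by (simp add: bialternant[OF lam True] antisymmetric_def)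
    finally show ?thesis by simp
  qed
  then have "?A * ?P' = ?A * ?P" by (rule poly_mapping_eqI)
  then have "?P' = ?P" using vandermonde_nonzero[OF inj_var, of n] by simp
  then have "lookup ?P' \<alpha> = lookup ?P \<alpha>" by simp
  then show ?thesis
    using \<alpha> keys_act_subset[OF \<sigma>, of \<alpha>]
    by (simp add: map_key.rep_eq[OF inj_act[OF \<sigma>]] lookup_schur_poly restrict_vars_def)
next
  case False
  have "schur lam \<beta> = 0" if "keys \<beta> \<subseteq> {..<n}" for \<beta>
    using that schur_poly_eq_0[OF lam False] fun_cong[OF lookup_schur_poly[of n lam], of \<beta>]
    by (simp add: restrict_vars_def)
  then show ?thesis using \<alpha> keys_act_subset[OF \<sigma>, of \<alpha>] by simp
qed

definition partitions_of :: "nat \<Rightarrow> expo set" where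
  "partitions_of d = {lam. is_partition lam \<and> esize lam = d}"

lemma partitions_of_keys:
  assumes "lam \<in> partitions_of d"
  shows "keys lam \<subseteq> {..<d}"
proof -
  have "card (keys lam) \<le> esize lam"
    unfolding esize_def using sum_mono[of "keys lam" "\<lambda>_. 1" "lookup lam"]
    by (auto simp: in_keys_iff Suc_le_eq)
  then show ?thesis
    using assms by (simp add: partitions_of_def part_length_le_iff[symmetric] part_length_def)
qed

lemma finite_partitions_of: "finite (partitions_of d)"
proof (rule finite_subset)
  show "partitions_of d \<subseteq> {e. keys e \<subseteq> {..<d} \<and> esize e \<le> d}"
    using partitions_of_keys[of _ d] by (auto simp: partitions_of_def)
qed (simp add: finite_expos_esize)

text \<open>After multiplication by the Vandermonde alternant both sides are antisymmetric and agree
  at every \<open>lam + rho n\<close>, so they are equal and the alternant cancels. The bound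
  \<open>d \<le> n\<close> gives every partition of \<open>d\<close> enough variables for the
  bialternant formula.\<close>

lemma schur_expansion_finite_vars:
  assumes hom: "\<And>\<alpha>. f \<alpha> \<noteq> 0 \<Longrightarrow> esize \<alpha> = d"
    and sym: "\<And>\<sigma> \<alpha>. \<sigma> permutes {..<n} \<Longrightarrow> keys \<alpha> \<subseteq> {..<n} \<Longrightarrow> f (act \<sigma> \<alpha>) = f \<alpha>"
    and dn: "d \<le> n" and \<alpha>: "keys \<alpha> \<subseteq> {..<n}"
  shows "f \<alpha> = (\<Sum>\<kappa>\<in>partitions_of d. schur_coeff n f \<kappa> * schur \<kappa> \<alpha>)"
proof -
  define F where "F = Abs_poly_mapping (restrict_vars n f)"
  have F: "lookup F = restrict_vars n f"
    unfolding F_def by (rule lookup_Abs_poly_mapping, rule finite_restrict_vars, rule hom)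
  let ?A = "alternant n var (stair n)"
  let ?G = "\<Sum>\<kappa>\<in>partitions_of d. single 0 (schur_coeff n f \<kappa>) * schur_poly n \<kappa>"
  have coeff: "lookup (?A * F) (lam + rho n) = schur_coeff n f lam" for lam
    by (simp add: lookup_alternant_mult F schur_coeff_def)
  have part: "is_partition \<kappa>" "keys \<kappa> \<subseteq> {..<n}" if "\<kappa> \<in> partitions_of d" for \<kappa>
    using that partitions_of_keys[OF that] dn by (auto simp: partitions_of_def)
  have AG: "?A * ?G = (\<Sum>\<kappa>\<in>partitions_of d. single 0 (schur_coeff n f \<kappa>) *
      alternant n var (\<lambda>j. lookup \<kappa> j + stair n j))"
    by (simp add: sum_distrib_left bialternant[symmetric] part mult_ac)
  have lAG: "lookup (?A * ?G) \<beta> = (\<Sum>\<kappa>\<in>partitions_of d. schur_coeff n f \<kappa> *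
      lookup (alternant n var (\<lambda>j. lookup \<kappa> j + stair n j)) \<beta>)" for \<beta>
    unfolding AG by (simp add: lookup_sum lookup_monomial_mult)
  have "lookup (?A * F) \<beta> = lookup (?A * ?G) \<beta>" for \<beta>
  proof (rule antisymmetric_eqI[of n])
    show "antisymmetric n (lookup (?A * F))"
    proof (rule antisymmetric_alternant_mult)
      fix \<sigma> assume \<sigma>: "\<sigma> permutes {..<n}"
      show "Poly_Mapping.map_key (act \<sigma>) F = F"
        by (rule poly_mapping_eqI)
           (simp add: map_key.rep_eq[OF inj_act[OF \<sigma>]] F restrict_vars_def keys_act_subset[OF \<sigma>] sym[OF \<sigma>])
    qed (simp add: F restrict_vars_def split: if_splits)
    show "antisymmetric n (lookup (?A * ?G))"
      unfolding antisymmetric_def lAG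
    proof (intro conjI allI impI)
      fix \<sigma> \<alpha> assume "\<sigma> permutes {..<n}"
      then have "lookup (alternant n var l) (act \<sigma> \<alpha>) = sign \<sigma> * lookup (alternant n var l) \<alpha>" for l
        using antisymmetric_alternant by (simp add: antisymmetric_def)
      then show "(\<Sum>\<kappa>\<in>partitions_of d. schur_coeff n f \<kappa> *
           lookup (alternant n var (\<lambda>j. lookup \<kappa> j + stair n j)) (act \<sigma> \<alpha>)) =
         sign \<sigma> * (\<Sum>\<kappa>\<in>partitions_of d. schur_coeff n f \<kappa> *
           lookup (alternant n var (\<lambda>j. lookup \<kappa> j + stair n j)) \<alpha>)"
        by (simp add: sum_distrib_left mult_ac)
    next
      fix \<alpha> assume "(\<Sum>\<kappa>\<in>partitions_of d. schur_coeff n f \<kappa> *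
           lookup (alternant n var (\<lambda>j. lookup \<kappa> j + stair n j)) \<alpha>) \<noteq> 0"
      then obtain \<kappa> where "lookup (alternant n var (\<lambda>j. lookup \<kappa> j + stair n j)) \<alpha> \<noteq> 0"
        by (metis (no_types, lifting) mult_zero_right sum.neutral)
      then show "keys \<alpha> \<subseteq> {..<n}" using antisymmetric_alternant[of n] by (auto simp: antisymmetric_def)
    qed
    fix lam assume lam: "is_partition lam" "keys lam \<subseteq> {..<n}"
    have "lookup (?A * ?G) (lam + rho n) =
        (\<Sum>\<kappa>\<in>partitions_of d. if \<kappa> = lam then schur_coeff n f lam else 0)"
      unfolding lAG by (intro sum.cong refl) (simp add: lookup_alternant_add_rho part lam)
    also have "\<dots> = (if lam \<in> partitions_of d then schur_coeff n f lam else 0)"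
      by (simp add: finite_partitions_of)
    \<comment> \<open>Comparing degrees, \<open>f\<close> contributes at \<open>lam + rho n\<close>
      only if \<open>lam\<close> has size \<open>d\<close>.\<close>
    also have "\<dots> = schur_coeff n f lam"
    proof (rule ccontr)
      assume *: "\<not> ?thesis"
      then have "schur_coeff n f lam \<noteq> 0" "lam \<notin> partitions_of d" by (auto split: if_splits)
      then obtain p where "shift (perm_expo n p (stair n)) (restrict_vars n f) (lam + rho n) \<noteq> 0"
        unfolding schur_coeff_def by (metis (no_types, lifting) mult_zero_right sum.neutral)
      then obtain \<beta> where \<beta>: "lam + rho n = perm_expo n p (stair n) + \<beta>" "restrict_vars n f \<beta> \<noteq> 0"
        by (rule shift_neq_0_E)
      then have "esize \<beta> = d" using hom by (auto simp: restrict_vars_def split: if_splits)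
      moreover have "esize (lam + rho n) = esize (perm_expo n p (stair n) + \<beta>)" by (simp only: \<beta>(1))
      ultimately have "esize lam = d" by (simp add: rho_def esize_perm_expo)
      then show False using \<open>lam \<notin> partitions_of d\<close> lam by (simp add: partitions_of_def)
    qed
    finally show "lookup (?A * F) (lam + rho n) = lookup (?A * ?G) (lam + rho n)"
      by (simp only: coeff)
  qed
  then have "?A * F = ?A * ?G" by (rule poly_mapping_eqI)
  from mult_left_cancel[THEN iffD1, OF vandermonde_nonzero[OF inj_var] this] have "F = ?G" .
  then have "lookup F \<alpha> = lookup ?G \<alpha>" by simp
  then show ?thesis
    using \<alpha> by (simp add: F restrict_vars_def lookup_sum lookup_monomial_mult lookup_schur_poly)
qed

text \<open>The coefficients are taken from \<open>d\<close> variables once and for all. An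
  expansion in \<open>n \<ge> d\<close> variables remains valid when restricted to \<open>d\<close>
  of them, and there \<open>schur_coeff_eq\<close> identifies its coefficients with the chosen
  ones.\<close>

theorem schur_expansion_exists:
  assumes hom: "\<And>\<alpha>. f \<alpha> \<noteq> 0 \<Longrightarrow> esize \<alpha> = d"
    and sym: "\<And>n \<sigma> \<alpha>. \<sigma> permutes {..<n} \<Longrightarrow> keys \<alpha> \<subseteq> {..<n} \<Longrightarrow> f (act \<sigma> \<alpha>) = f \<alpha>"
  shows "\<exists>a. is_schur_expansion f a"
proof -
  define a where "a lam = (if lam \<in> partitions_of d then schur_coeff d f lam else 0)" for lam
  have f_eq: "f \<alpha> = (\<Sum>\<kappa>\<in>partitions_of d. a \<kappa> * schur \<kappa> \<alpha>)" for \<alpha>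
  proof -
    obtain k where k: "keys \<alpha> \<subseteq> {..<k}" using finite_nat_iff_bounded finite_keys by blast
    define n where "n = max d k"
    have n: "d \<le> n" "keys \<alpha> \<subseteq> {..<n}" using k by (auto simp: n_def)
    have exp: "f \<beta> = (\<Sum>\<kappa>\<in>partitions_of d. schur_coeff n f \<kappa> * schur \<kappa> \<beta>)" if "keys \<beta> \<subseteq> {..<n}" for \<beta> :: expo
      by (rule schur_expansion_finite_vars[OF hom sym n(1) that])
    have "schur_coeff n f \<kappa> = a \<kappa>" if "\<kappa> \<in> partitions_of d" for \<kappa>
    proof -
      have "schur_coeff d f \<kappa> = (if \<kappa> \<in> partitions_of d then schur_coeff n f \<kappa> else 0)"
      proof (rule schur_coeff_eq[OF finite_partitions_of])
        fix \<beta> :: expo assume "keys \<beta> \<subseteq> {..<d}"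
        then show "f \<beta> = (\<Sum>\<kappa>\<in>partitions_of d. schur_coeff n f \<kappa> * schur \<kappa> \<beta>)"
          using n(1) by (intro exp) auto
      qed (use that partitions_of_keys in \<open>auto simp: partitions_of_def\<close>)
      then show ?thesis using that by (simp add: a_def)
    qed
    then show ?thesis using exp[OF n(2)] by simp
  qed
  have sub: "{lam. a lam \<noteq> 0} \<subseteq> partitions_of d" by (auto simp: a_def split: if_splits)
  have "is_schur_expansion f a"
    unfolding is_schur_expansion_def
  proof (intro conjI allI impI)
    show "finite {lam. a lam \<noteq> 0}" using sub finite_partitions_of by (rule finite_subset)
    show "is_partition lam" if "a lam \<noteq> 0" for lam using that sub by (auto simp: partitions_of_def)
    show "f \<alpha> = (\<Sum>lam | a lam \<noteq> 0. a lam * schur lam \<alpha>)" for \<alpha>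
      unfolding f_eq using sub finite_partitions_of by (intro sum.mono_neutral_right) auto
  qed
  then show ?thesis by blast
qed

subsection \<open>Plethysm\<close>

text \<open>The additive extension of \<open>\<theta>\<close>: the exponent that results when the
  monomial \<open>\<theta> k\<close> is substituted for variable \<open>k\<close> in the monomial
  \<open>\<beta>\<close>.\<close>

definition weight :: "('i \<Rightarrow> 'j \<Rightarrow>\<^sub>0 nat) \<Rightarrow> ('i \<Rightarrow>\<^sub>0 nat) \<Rightarrow> 'j \<Rightarrow>\<^sub>0 nat" where
  "weight \<theta> \<beta> = (\<Sum>k\<in>keys \<beta>. Poly_Mapping.map ((*) (lookup \<beta> k)) (\<theta> k))"

lemma lookup_weight:
  assumes "finite A" "keys \<beta> \<subseteq> A"
  shows "lookup (weight \<theta> \<beta>) j = (\<Sum>k\<in>A. lookup \<beta> k * lookup (\<theta> k) j)"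
proof -
  have "lookup (weight \<theta> \<beta>) j = (\<Sum>k\<in>keys \<beta>. lookup \<beta> k * lookup (\<theta> k) j)"
    unfolding weight_def lookup_sum by (intro sum.cong) (auto simp: map.rep_eq when_def)
  also have "\<dots> = (\<Sum>k\<in>A. lookup \<beta> k * lookup (\<theta> k) j)"
    using assms by (intro sum.mono_neutral_left) (auto simp: in_keys_iff)
  finally show ?thesis .
qed

lemma weight_add: "weight \<theta> (a + b) = weight \<theta> a + weight \<theta> b"
  by (rule poly_mapping_eqI)
     (simp add: lookup_add lookup_weight[of "keys a \<union> keys b"] keys_add_nat algebra_simps sum.distrib)

lemma weight_zero [simp]: "weight \<theta> 0 = 0"
  by (simp add: weight_def)

lemma keys_le_weight:
  assumes "k \<in> keys \<beta>"
  shows "keys (\<theta> k) \<subseteq> keys (weight \<theta> \<beta>)"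
proof
  fix j assume "j \<in> keys (\<theta> k)"
  then have "lookup \<beta> k * lookup (\<theta> k) j > 0" using assms by (simp add: in_keys_iff)
  also have "lookup \<beta> k * lookup (\<theta> k) j \<le> lookup (weight \<theta> \<beta>) j"
    unfolding lookup_weight[OF finite_keys order_refl] using assms
    by (intro member_le_sum) auto
  finally show "j \<in> keys (weight \<theta> \<beta>)" by (simp add: in_keys_iff)
qed

lemma keys_weight: "keys (weight \<theta> \<beta>) = (\<Union>k\<in>keys \<beta>. keys (\<theta> k))"
proof
  show "keys (weight \<theta> \<beta>) \<subseteq> (\<Union>k\<in>keys \<beta>. keys (\<theta> k))"
  proof
    fix j assume "j \<in> keys (weight \<theta> \<beta>)"
    then have "(\<Sum>k\<in>keys \<beta>. lookup \<beta> k * lookup (\<theta> k) j) \<noteq> 0"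
      by (simp add: in_keys_iff lookup_weight[OF finite_keys order_refl])
    then obtain k where "k \<in> keys \<beta>" "lookup (\<theta> k) j \<noteq> 0"
      by (metis (no_types, lifting) mult_zero_right sum.neutral)
    then show "j \<in> (\<Union>k\<in>keys \<beta>. keys (\<theta> k))" by (auto simp: in_keys_iff)
  qed
qed (use keys_le_weight in fast)

lemma esize_weight:
  assumes "\<And>k. k \<in> keys \<beta> \<Longrightarrow> esize (\<theta> k) = d"
  shows "esize (weight \<theta> \<beta>) = esize \<beta> * d"
proof -
  define A where "A = (\<Union>k\<in>keys \<beta>. keys (\<theta> k))"
  have fin: "finite A" by (simp add: A_def)
  have "keys (weight \<theta> \<beta>) \<subseteq> A" by (simp add: A_def keys_weight)
  then have "esize (weight \<theta> \<beta>) = (\<Sum>j\<in>A. \<Sum>k\<in>keys \<beta>. lookup \<beta> k * lookup (\<theta> k) j)"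
    by (simp add: esize_eq_sum[OF fin] lookup_weight[OF finite_keys order_refl])
  also have "\<dots> = (\<Sum>k\<in>keys \<beta>. lookup \<beta> k * (\<Sum>j\<in>A. lookup (\<theta> k) j))"
    by (subst sum.swap) (simp add: sum_distrib_left)
  also have "\<dots> = (\<Sum>k\<in>keys \<beta>. lookup \<beta> k * d)"
  proof (intro sum.cong refl)
    fix k assume k: "k \<in> keys \<beta>"
    then have "keys (\<theta> k) \<subseteq> A" by (auto simp: A_def)
    then show "lookup \<beta> k * (\<Sum>j\<in>A. lookup (\<theta> k) j) = lookup \<beta> k * d"
      using assms[OF k] by (simp add: esize_eq_sum[OF fin])
  qed
  also have "\<dots> = esize \<beta> * d"
    by (simp add: esize_def sum_distrib_right)
  finally show ?thesis .
qed

lemma countable_expo: "countable (UNIV :: expo set)"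
proof -
  have "e \<in> (\<Union>d. {e. keys e \<subseteq> {..<d} \<and> esize e \<le> d})" for e :: expo
  proof -
    obtain k where k: "keys e \<subseteq> {..<k}" using finite_nat_iff_bounded finite_keys by blast
    have "keys e \<subseteq> {..<max k (esize e)}" using k by auto
    then show ?thesis by (intro UN_I[of "max k (esize e)"]) auto
  qed
  then have "(UNIV :: expo set) \<subseteq> (\<Union>d. {e. keys e \<subseteq> {..<d} \<and> esize e \<le> d})" by blast
  moreover have "countable (\<Union>d. {e :: expo. keys e \<subseteq> {..<d} \<and> esize e \<le> d})"
    by (rule countable_UN) (simp_all add: countable_finite finite_expos_esize)
  ultimately show ?thesis by (rule countable_subset)
qed

text \<open>Countability makes \<open>to_nat_on\<close> and \<open>from_nat_into\<close> inverse to
  each other on the listing of monomials.\<close>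

lemma countable_monomials: "countable (monomials g)"
proof -
  have "countable (UNIV :: (expo \<times> nat) set)"
    unfolding UNIV_Times_UNIV[symmetric] by (intro countable_SIGMA countable_expo) auto
  then show ?thesis by (rule countable_subset[rotated]) simp
qed

definition monomial_index_in :: "(expo \<Rightarrow> int) \<Rightarrow> nat \<Rightarrow> nat set" where
  "monomial_index_in g n = {k \<in> monomial_index g. keys (nth_monomial g k) \<subseteq> {..<n}}"

lemma monomial_index_E:
  assumes "k \<in> monomial_index g"
  obtains i where "(nth_monomial g k, i) \<in> monomials g" "k = to_nat_on (monomials g) (nth_monomial g k, i)"
proof -
  obtain a where a: "a \<in> monomials g" "k = to_nat_on (monomials g) a"
    using assms by (auto simp: monomial_index_def)
  then have "nth_monomial g k = fst a"
    by (simp add: nth_monomial_def from_nat_into_to_nat_on[OF countable_monomials])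
  then show thesis using a that[of "snd a"] by simp
qed

lemma to_nat_on_monomials:
  assumes "(\<gamma>, i) \<in> monomials g"
  shows "to_nat_on (monomials g) (\<gamma>, i) \<in> monomial_index g"
    "nth_monomial g (to_nat_on (monomials g) (\<gamma>, i)) = \<gamma>"
  using assms
  by (auto simp: monomial_index_def nth_monomial_def from_nat_into_to_nat_on[OF countable_monomials])

lemma nth_monomial_schur:
  assumes "k \<in> monomial_index (schur \<mu>)"
  shows "esize (nth_monomial (schur \<mu>) k) = esize \<mu>"
proof -
  obtain i where "(nth_monomial (schur \<mu>) k, i) \<in> monomials (schur \<mu>)"
    using assms by (rule monomial_index_E)
  then have "schur \<mu> (nth_monomial (schur \<mu>) k) \<noteq> 0" by (auto simp: monomials_def)
  then show ?thesis by (rule schur_esize)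
qed

text \<open>All monomials of the Schur function have degree \<open>esize \<mu>\<close>, and in
  \<open>n\<close> variables there are finitely many of these, each with finite
  multiplicity.\<close>

lemma finite_monomial_index_in: "finite (monomial_index_in (schur \<mu>) n)"
proof (rule finite_subset)
  let ?M = "monomials (schur \<mu>)"
  let ?S = "SIGMA \<gamma>:{\<gamma>. keys \<gamma> \<subseteq> {..<n} \<and> esize \<gamma> \<le> esize \<mu>}. {..<nat (schur \<mu> \<gamma>)}"
  show "monomial_index_in (schur \<mu>) n \<subseteq> to_nat_on ?M ` ?S"
  proof
    fix k assume k: "k \<in> monomial_index_in (schur \<mu>) n"
    then have "k \<in> monomial_index (schur \<mu>)" by (simp add: monomial_index_in_def)
    moreover from this obtain i where "(nth_monomial (schur \<mu>) k, i) \<in> ?M"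
      "k = to_nat_on ?M (nth_monomial (schur \<mu>) k, i)" by (rule monomial_index_E)
    ultimately show "k \<in> to_nat_on ?M ` ?S"
      using k nth_monomial_schur[of k \<mu>]
      by (intro image_eqI) (auto simp: monomial_index_in_def monomials_def)
  qed
  show "finite (to_nat_on ?M ` ?S)"
    by (intro finite_imageI finite_SigmaI finite_expos_esize) auto
qed

definition plethysm_terms :: "expo \<Rightarrow> expo \<Rightarrow> nat \<Rightarrow> expo \<Rightarrow> expo set" where
  "plethysm_terms \<nu> \<mu> n \<alpha> = {\<beta>. schur \<nu> \<beta> \<noteq> 0 \<and> keys \<beta> \<subseteq> monomial_index_in (schur \<mu>) n \<and>
     weight (nth_monomial (schur \<mu>)) \<beta> = \<alpha>}"

lemma plethysm_index_iff:
  "(\<forall>j. lookup \<alpha> j = (\<Sum>k\<in>keys \<beta>. lookup \<beta> k * lookup (\<theta> k) j)) \<longleftrightarrow> weight \<theta> \<beta> = \<alpha>"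
  by (auto simp: poly_mapping_eq_iff fun_eq_iff lookup_weight[OF finite_keys order_refl])

text \<open>Exponents add without cancellation, so a product of listed monomials that involves only
  the first \<open>n\<close> variables has only such factors.\<close>

lemma plethysm_eq_sum_terms:
  assumes "keys \<alpha> \<subseteq> {..<n}"
  shows "plethysm (schur \<nu>) (schur \<mu>) \<alpha> = (\<Sum>\<beta>\<in>plethysm_terms \<nu> \<mu> n \<alpha>. schur \<nu> \<beta>)"
  unfolding plethysm_def plethysm_index_iff plethysm_terms_def
proof (rule sum.cong[OF Collect_cong refl])
  fix \<beta>
  show "(schur \<nu> \<beta> \<noteq> 0 \<and> keys \<beta> \<subseteq> monomial_index (schur \<mu>) \<and> weight (nth_monomial (schur \<mu>)) \<beta> = \<alpha>) =
    (schur \<nu> \<beta> \<noteq> 0 \<and> keys \<beta> \<subseteq> monomial_index_in (schur \<mu>) n \<and> weight (nth_monomial (schur \<mu>)) \<beta> = \<alpha>)"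
    using assms keys_le_weight[of _ \<beta> "nth_monomial (schur \<mu>)"]
    by (auto simp: monomial_index_in_def subset_eq)
qed

lemma plethysm_homogeneous:
  assumes "plethysm (schur \<nu>) (schur \<mu>) \<alpha> \<noteq> 0"
  shows "esize \<alpha> = esize \<nu> * esize \<mu>"
proof -
  obtain n where n: "keys \<alpha> \<subseteq> {..<n}" using finite_nat_iff_bounded finite_keys by blast
  obtain \<beta> where \<beta>: "\<beta> \<in> plethysm_terms \<nu> \<mu> n \<alpha>"
    using assms unfolding plethysm_eq_sum_terms[OF n] by (metis (no_types, lifting) sum.neutral)
  then have "esize \<beta> = esize \<nu>" by (intro schur_esize) (simp add: plethysm_terms_def)
  moreover have "esize (weight (nth_monomial (schur \<mu>)) \<beta>) = esize \<beta> * esize \<mu>"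
    using \<beta> by (intro esize_weight nth_monomial_schur) (auto simp: plethysm_terms_def monomial_index_in_def)
  ultimately show ?thesis using \<beta> by (simp add: plethysm_terms_def)
qed

lemma weight_act:
  assumes "\<pi> permutes A" "inj \<sigma>" and \<theta>: "\<And>k. k \<in> keys \<beta> \<Longrightarrow> \<theta> (\<pi> k) = act \<sigma> (\<theta> k)"
  shows "weight \<theta> (act (inv \<pi>) \<beta>) = act \<sigma> (weight \<theta> \<beta>)"
proof (rule poly_mapping_eqI)
  fix j
  have inj: "inj \<pi>" "inj (inv \<pi>)" using permutes_inj permutes_inv assms(1) by blast+
  have "keys (act (inv \<pi>) \<beta>) \<subseteq> \<pi> ` keys \<beta>"
    using permutes_inverses[OF assms(1)] inj
    by (auto simp: in_keys_iff lookup_act intro!: image_eqI[of _ \<pi> "inv \<pi> _"])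
  then have "lookup (weight \<theta> (act (inv \<pi>) \<beta>)) j =
      (\<Sum>k\<in>\<pi> ` keys \<beta>. lookup (act (inv \<pi>) \<beta>) k * lookup (\<theta> k) j)"
    by (intro lookup_weight) auto
  also have "\<dots> = (\<Sum>k\<in>keys \<beta>. lookup \<beta> k * lookup (\<theta> k) (\<sigma> j))"
    using inj assms(2) inj_on_subset[OF inj(1), of "keys \<beta>"]
    by (subst sum.reindex) (simp_all add: lookup_act permutes_inverses[OF assms(1)] \<theta>)
  finally show "lookup (weight \<theta> (act (inv \<pi>) \<beta>)) j = lookup (act \<sigma> (weight \<theta> \<beta>)) j"
    using assms(2) by (simp add: lookup_act lookup_weight[OF finite_keys order_refl])
qed

text \<open>By symmetry of the Schur function a monomial and its image under \<open>\<sigma>\<close>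
  have the same multiplicity, so the copies can be matched by their number \<open>i\<close>. The
  resulting injective self-map of a finite index set is a permutation.\<close>

lemma monomial_permutation:
  assumes \<mu>: "is_partition \<mu>" and \<sigma>: "\<sigma> permutes {..<n}"
  obtains \<pi> where "\<pi> permutes monomial_index_in (schur \<mu>) n"
    "\<And>k. k \<in> monomial_index_in (schur \<mu>) n \<Longrightarrow>
       nth_monomial (schur \<mu>) (\<pi> k) = act \<sigma> (nth_monomial (schur \<mu>) k)"
proof -
  let ?M = "monomials (schur \<mu>)" and ?I = "monomial_index_in (schur \<mu>) n"
  let ?\<theta> = "nth_monomial (schur \<mu>)"
  define \<pi> where "\<pi> k = (if k \<in> ?I then
      to_nat_on ?M (act \<sigma> (?\<theta> k), snd (from_nat_into ?M k)) else k)" for k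
  have M: "(act \<sigma> (?\<theta> k), snd (from_nat_into ?M k)) \<in> ?M" if "k \<in> ?I" for k
  proof -
    have k: "k \<in> monomial_index (schur \<mu>)" "keys (?\<theta> k) \<subseteq> {..<n}"
      using that by (auto simp: monomial_index_in_def)
    obtain i where i: "(?\<theta> k, i) \<in> ?M" "k = to_nat_on ?M (?\<theta> k, i)"
      using k(1) by (rule monomial_index_E)
    then have "snd (from_nat_into ?M k) = i"
      by (metis countable_monomials from_nat_into_to_nat_on snd_conv)
    then show ?thesis
      using i(1) schur_symmetric[OF \<mu> \<sigma> k(2)] by (simp add: monomials_def)
  qed
  have \<pi>_in: "\<pi> k \<in> ?I" and \<pi>_nth: "?\<theta> (\<pi> k) = act \<sigma> (?\<theta> k)" if "k \<in> ?I" for k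
    using to_nat_on_monomials[OF M[OF that]] that keys_act_subset[OF \<sigma>]
    by (auto simp: \<pi>_def monomial_index_in_def)
  have "inj_on \<pi> ?I"
  proof (rule inj_onI)
    fix k k' assume k: "k \<in> ?I" "k' \<in> ?I" and eq: "\<pi> k = \<pi> k'"
    then have "(act \<sigma> (?\<theta> k), snd (from_nat_into ?M k)) = (act \<sigma> (?\<theta> k'), snd (from_nat_into ?M k'))"
      using M inj_on_to_nat_on[OF countable_monomials, of "schur \<mu>"] by (auto simp: \<pi>_def inj_on_def)
    then have "?\<theta> k = ?\<theta> k'" "snd (from_nat_into ?M k) = snd (from_nat_into ?M k')"
      using injD[OF inj_act[OF \<sigma>]] by auto
    then have "from_nat_into ?M k = from_nat_into ?M k'"
      by (simp add: nth_monomial_def prod_eq_iff)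
    moreover have "k \<in> to_nat_on ?M ` ?M" "k' \<in> to_nat_on ?M ` ?M"
      using k by (auto simp: monomial_index_in_def monomial_index_def)
    ultimately show "k = k'"
      by (metis countable_monomials to_nat_on_from_nat_into)
  qed
  moreover from this have "\<pi> ` ?I = ?I"
    using \<pi>_in by (intro endo_inj_surj finite_monomial_index_in) auto
  ultimately have "\<pi> permutes ?I"
    by (intro bij_imp_permutes) (auto simp: bij_betw_def \<pi>_def)
  then show thesis using \<pi>_nth by (rule that)
qed

text \<open>A permutation of the variables becomes a permutation \<open>\<pi>\<close> of the listed
  monomials, that is, of the variables of the outer Schur function, which is itself
  symmetric.\<close>

lemma plethysm_symmetric:
  assumes \<nu>: "is_partition \<nu>" and \<mu>: "is_partition \<mu>"
    and \<sigma>: "\<sigma> permutes {..<n}" and \<alpha>: "keys \<alpha> \<subseteq> {..<n}"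
  shows "plethysm (schur \<nu>) (schur \<mu>) (act \<sigma> \<alpha>) = plethysm (schur \<nu>) (schur \<mu>) \<alpha>"
proof -
  let ?I = "monomial_index_in (schur \<mu>) n" and ?\<theta> = "nth_monomial (schur \<mu>)"
  obtain \<pi> where \<pi>: "\<pi> permutes ?I" and \<theta>: "\<And>k. k \<in> ?I \<Longrightarrow> ?\<theta> (\<pi> k) = act \<sigma> (?\<theta> k)"
    by (rule monomial_permutation[OF \<mu> \<sigma>]) blast
  \<comment> \<open>\<open>schur_symmetric\<close> speaks of initial segments of the variables;
    \<open>\<pi>\<close> fixes everything outside \<open>?I\<close> and so permutes
    \<open>{..<N}\<close> as well.\<close>
  obtain N where N: "?I \<subseteq> {..<N}" using finite_monomial_index_in finite_nat_iff_bounded by blast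
  have keys_act: "keys (act \<tau> \<beta>) \<subseteq> ?I" if "keys \<beta> \<subseteq> ?I" "\<tau> permutes ?I" for \<tau> \<beta>
  proof
    fix k assume "k \<in> keys (act \<tau> \<beta>)"
    then have "\<tau> k \<in> ?I" using that permutes_inj[OF that(2)] by (auto simp: in_keys_iff lookup_act)
    then show "k \<in> ?I" using permutes_in_image[OF that(2)] by blast
  qed
  have schur_eq: "schur \<nu> (act \<tau> \<beta>) = schur \<nu> \<beta>" if "keys \<beta> \<subseteq> ?I" "\<tau> permutes ?I" for \<tau> \<beta>
    using that N by (intro schur_symmetric[OF \<nu>, of _ N]) (auto intro: permutes_subset)
  have w: "weight ?\<theta> (act (inv \<pi>) \<beta>) = act \<sigma> (weight ?\<theta> \<beta>)" if "keys \<beta> \<subseteq> ?I" for \<beta>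
    using that by (intro weight_act[OF \<pi> permutes_inj[OF \<sigma>]] \<theta>) auto
  have \<pi>': "inv \<pi> permutes ?I" by (rule permutes_inv[OF \<pi>])
  have "(\<Sum>\<beta>\<in>plethysm_terms \<nu> \<mu> n (act \<sigma> \<alpha>). schur \<nu> \<beta>) = (\<Sum>\<beta>\<in>plethysm_terms \<nu> \<mu> n \<alpha>. schur \<nu> \<beta>)"
  proof (rule sum.reindex_bij_witness[of _ "act (inv \<pi>)" "act \<pi>"])
    fix \<beta> assume \<beta>: "\<beta> \<in> plethysm_terms \<nu> \<mu> n (act \<sigma> \<alpha>)"
    then have k: "keys \<beta> \<subseteq> ?I" by (simp add: plethysm_terms_def)
    show "act (inv \<pi>) (act \<pi> \<beta>) = \<beta>" by (rule act_inv[OF \<pi>])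
    show "schur \<nu> (act \<pi> \<beta>) = schur \<nu> \<beta>" by (rule schur_eq[OF k \<pi>])
    have "act \<sigma> (weight ?\<theta> (act \<pi> \<beta>)) = act \<sigma> \<alpha>"
      using w[OF keys_act[OF k \<pi>]] \<beta> by (simp add: act_inv[OF \<pi>] plethysm_terms_def)
    then show "act \<pi> \<beta> \<in> plethysm_terms \<nu> \<mu> n \<alpha>"
      using injD[OF inj_act[OF \<sigma>]] \<beta> schur_eq[OF k \<pi>] keys_act[OF k \<pi>] by (auto simp: plethysm_terms_def)
  next
    fix \<beta> assume \<beta>: "\<beta> \<in> plethysm_terms \<nu> \<mu> n \<alpha>"
    then have k: "keys \<beta> \<subseteq> ?I" by (simp add: plethysm_terms_def)
    show "act \<pi> (act (inv \<pi>) \<beta>) = \<beta>" by (rule act_inv[OF \<pi>])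
    show "act (inv \<pi>) \<beta> \<in> plethysm_terms \<nu> \<mu> n (act \<sigma> \<alpha>)"
      using \<beta> schur_eq[OF k \<pi>'] keys_act[OF k \<pi>'] w[OF k] by (auto simp: plethysm_terms_def)
  qed
  then show ?thesis
    using \<alpha> keys_act_subset[OF \<sigma>] by (simp add: plethysm_eq_sum_terms[of _ n])
qed

theorem plethysm_coeff_eq:
  assumes "is_partition \<nu>" "is_partition \<mu>" "is_partition lam" "keys lam \<subseteq> {..<n}"
  shows "plethysm_coeff \<nu> \<mu> lam = schur_coeff n (plethysm (schur \<nu>) (schur \<mu>)) lam"
proof -
  let ?f = "plethysm (schur \<nu>) (schur \<mu>)"
  have "\<exists>a. is_schur_expansion ?f a"
    by (rule schur_expansion_exists[OF plethysm_homogeneous plethysm_symmetric[OF assms(1,2)]])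
  then have "is_schur_expansion ?f (plethysm_coeff \<nu> \<mu>)"
    unfolding plethysm_coeff_def by (metis schur_expansion_unique theI)
  then show ?thesis using assms by (intro schur_expansion_coeff)
qed

subsection \<open>Tableaux as lattice points of a cone\<close>

lemma lookup_outside: "keys c \<subseteq> A \<Longrightarrow> x \<notin> A \<Longrightarrow> lookup c x = 0"
  by (metis in_keys_iff subsetD)

lemma weight_single: "weight \<theta> (single k 1) = \<theta> k"
  by (rule poly_mapping_eqI) (simp add: lookup_weight[of "{k}"])

lemma weight_weight: "weight \<theta> (weight \<eta> c) = weight (\<lambda>x. weight \<theta> (\<eta> x)) c"
proof (rule poly_mapping_eqI)
  fix j
  let ?A = "\<Union>x\<in>keys c. keys (\<eta> x)"
  have "lookup (weight \<theta> (weight \<eta> c)) j =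
      (\<Sum>k\<in>?A. (\<Sum>x\<in>keys c. lookup c x * lookup (\<eta> x) k) * lookup (\<theta> k) j)"
    by (subst lookup_weight[of ?A])
       (auto simp: keys_weight lookup_weight[OF finite_keys order_refl])
  also have "\<dots> = (\<Sum>x\<in>keys c. lookup c x * (\<Sum>k\<in>?A. lookup (\<eta> x) k * lookup (\<theta> k) j))"
    by (simp add: sum_distrib_left sum_distrib_right mult.assoc) (rule sum.swap)
  also have "\<dots> = (\<Sum>x\<in>keys c. lookup c x * lookup (weight \<theta> (\<eta> x)) j)"
    by (intro sum.cong refl arg_cong[of _ _ "(*) _"] lookup_weight[symmetric]) auto
  finally show "lookup (weight \<theta> (weight \<eta> c)) j = lookup (weight (\<lambda>x. weight \<theta> (\<eta> x)) c) j"
    by (simp add: lookup_weight[OF finite_keys order_refl])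
qed

text \<open>
  A tableau is encoded by the numbers \<open>c (i, k)\<close> of entries \<open>k\<close> in row \<open>i\<close>; \<open>row_part c i k\<close> counts the
  entries of row \<open>i\<close> that are smaller than \<open>k\<close>, and column strictness becomes a linear inequality.
\<close>

definition row_part :: "(nat \<times> nat \<Rightarrow>\<^sub>0 nat) \<Rightarrow> nat \<Rightarrow> nat \<Rightarrow> nat" where
  "row_part c i k = (\<Sum>k'<k. lookup c (i, k'))"

text \<open>Entries at most \<open>k\<close> in row \<open>i + 1\<close> must sit below entries less
  than \<open>k\<close> in row \<open>i\<close>. Both fill initial segments of their rows, so
  comparing their numbers suffices.\<close>

definition tableau_cone :: "nat \<Rightarrow> nat \<Rightarrow> (nat \<times> nat \<Rightarrow>\<^sub>0 nat) set" where
  "tableau_cone m N = {c. keys c \<subseteq> {..<m} \<times> {..<N} \<and>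
     (\<forall>i k. Suc i < m \<longrightarrow> k < N \<longrightarrow> row_part c (Suc i) (Suc k) \<le> row_part c i k)}"

definition row_sums :: "(nat \<times> nat \<Rightarrow>\<^sub>0 nat) \<Rightarrow> expo" where
  "row_sums = weight (\<lambda>x. single (fst x) 1)"

definition col_sums :: "(nat \<times> nat \<Rightarrow>\<^sub>0 nat) \<Rightarrow> expo" where
  "col_sums = weight (\<lambda>x. single (snd x) 1)"

lemma row_sums_add: "row_sums (a + b) = row_sums a + row_sums b"
  by (simp add: row_sums_def weight_add)

lemma col_sums_add: "col_sums (a + b) = col_sums a + col_sums b"
  by (simp add: col_sums_def weight_add)

lemma keys_col_sums: "keys (col_sums c) = snd ` keys c"
  by (auto simp: col_sums_def keys_weight)

lemma esize_row_sums: "esize (row_sums c) = esize c"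
  unfolding row_sums_def by (subst esize_weight[of _ _ 1]) simp_all

lemma lookup_row_sums:
  assumes "keys c \<subseteq> {..<m} \<times> {..<N}"
  shows "lookup (row_sums c) i = row_part c i N"
proof -
  have "lookup (row_sums c) i = (\<Sum>x\<in>{..<m} \<times> {..<N}. lookup c x * lookup (single (fst x) 1) i)"
    unfolding row_sums_def by (rule lookup_weight[OF _ assms]) simp
  also have "\<dots> = (\<Sum>a<m. \<Sum>b<N. if a = i then lookup c (i, b) else 0)"
    unfolding sum.cartesian_product by (intro sum.cong) (auto simp: lookup_single when_def)
  also have "\<dots> = (\<Sum>a<m. if a = i then row_part c i N else 0)"
    by (intro sum.cong) (auto simp: row_part_def)
  also have "\<dots> = row_part c i N"
  proof (cases "i < m")
    case False
    then have "lookup c (i, b) = 0" for b using lookup_outside[OF assms, of "(i, b)"] by simp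
    with False show ?thesis by (simp add: row_part_def)
  qed simp
  finally show ?thesis .
qed

definition last_col :: "nat \<Rightarrow> expo \<Rightarrow> nat \<times> nat \<Rightarrow>\<^sub>0 nat" where
  "last_col N e = weight (\<lambda>i. single (i, N) 1) e"

lemma lookup_last_col: "lookup (last_col N e) (i, k) = (if k = N then lookup e i else 0)"
proof -
  have "lookup (last_col N e) (i, k) = (\<Sum>a\<in>insert i (keys e). if a = i then (if k = N then lookup e i else 0) else 0)"
    unfolding last_col_def
    by (subst lookup_weight[OF finite.insertI[OF finite_keys] subset_insertI[of _ i]], intro sum.cong refl)
       (auto simp: lookup_single when_def)
  then show ?thesis by simp
qed

lemma row_sums_last_col: "row_sums (last_col N e) = e"
  unfolding row_sums_def last_col_def weight_weight weight_single
  by (rule poly_mapping_eqI) (auto simp: lookup_weight[OF finite_keys order_refl] lookup_single when_def in_keys_iff if_distrib cong: if_cong)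

lemma col_sums_last_col: "col_sums (last_col N e) = single N (esize e)"
  unfolding col_sums_def last_col_def weight_weight weight_single
  by (rule poly_mapping_eqI) (auto simp: lookup_weight[OF finite_keys order_refl] lookup_single when_def esize_def)

lemma keys_last_col: "keys (last_col N e) = (\<lambda>i. (i, N)) ` keys e"
  by (auto simp: last_col_def keys_weight)

lemma row_part_add_last_col:
  "k \<le> N \<Longrightarrow> row_part (c + last_col N e) i k = row_part c i k"
  "row_part (c + last_col N e) i (Suc N) = row_part c i N + lookup c (i, N) + lookup e i"
  by (auto simp: row_part_def lookup_add lookup_last_col intro!: sum.cong)

definition coded_tableaux :: "nat \<Rightarrow> nat \<Rightarrow> expo \<Rightarrow> expo \<Rightarrow> (nat \<times> nat \<Rightarrow>\<^sub>0 nat) set" where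
  "coded_tableaux m N \<nu> \<beta> = {c \<in> tableau_cone m N. row_sums c = \<nu> \<and> col_sums c = \<beta>}"

lemma finite_tableau_cone_row_sums: "finite {c \<in> tableau_cone m N. row_sums c = \<nu>}"
  by (rule finite_subset[OF _ finite_expos_esize[of "{..<m} \<times> {..<N}" "esize \<nu>"]])
     (auto simp: tableau_cone_def esize_row_sums)

lemma finite_coded_tableaux: "finite (coded_tableaux m N \<nu> \<beta>)"
  by (rule finite_subset[OF _ finite_tableau_cone_row_sums[of m N \<nu>]]) (auto simp: coded_tableaux_def)

text \<open>Branching on codes: column \<open>N\<close> records the difference of
  \<open>\<nu>\<close> and \<open>\<kappa>\<close>. Its nonnegativity is one half of interlacing,
  the cone inequality for \<open>k = N\<close> is the other half, and the remaining inequalities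
  involve only the earlier columns.\<close>

lemma coded_tableaux_Suc:
  assumes \<nu>: "keys \<nu> \<subseteq> {..<m}" and \<beta>: "keys \<beta> \<subseteq> {..<N}"
  shows "bij_betw (\<lambda>(\<kappa>, c). c + last_col N (\<nu> - \<kappa>))
    (SIGMA \<kappa>:{\<kappa> \<in> interlacing \<nu>. esize \<nu> = esize \<kappa> + k}. coded_tableaux m N \<kappa> \<beta>)
    (coded_tableaux m (Suc N) \<nu> (\<beta> + single N k))"
    (is "bij_betw ?h ?S ?A")
  unfolding bij_betw_def
proof (intro conjI)
  show "inj_on ?h ?S"
  proof (rule inj_onI, clarify)
    fix \<kappa>1 c1 \<kappa>2 c2
    assume c: "c1 \<in> coded_tableaux m N \<kappa>1 \<beta>" "c2 \<in> coded_tableaux m N \<kappa>2 \<beta>"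
      and eq: "c1 + last_col N (\<nu> - \<kappa>1) = c2 + last_col N (\<nu> - \<kappa>2)"
    have z: "lookup c1 (i, b) = 0" "lookup c2 (i, b) = 0" if "b \<ge> N" for i b
      using c that lookup_outside[of c1 "{..<m} \<times> {..<N}" "(i, b)"] lookup_outside[of c2 "{..<m} \<times> {..<N}" "(i, b)"]
      by (auto simp: coded_tableaux_def tableau_cone_def)
    have "lookup c1 (i, b) = lookup c2 (i, b)" for i b
    proof (cases "b < N")
      case True
      have "lookup (c1 + last_col N (\<nu> - \<kappa>1)) (i, b) = lookup (c2 + last_col N (\<nu> - \<kappa>2)) (i, b)"
        by (simp only: eq)
      with True show ?thesis by (simp add: lookup_add lookup_last_col)
    qed (simp add: z)
    then have "c1 = c2" by (intro poly_mapping_eqI) auto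
    with c show "\<kappa>1 = \<kappa>2 \<and> c1 = c2" by (auto simp: coded_tableaux_def)
  qed
  show "?h ` ?S = ?A"
  proof (intro equalityI subsetI)
    fix x assume "x \<in> ?h ` ?S"
    then obtain \<kappa> c where x: "x = c + last_col N (\<nu> - \<kappa>)" and \<kappa>: "\<kappa> \<in> interlacing \<nu>"
      and sz: "esize \<nu> = esize \<kappa> + k" and c: "c \<in> coded_tableaux m N \<kappa> \<beta>" by auto
    have add: "\<kappa> + (\<nu> - \<kappa>) = \<nu>"
      by (rule poly_mapping_eqI) (use interlacing_le[OF \<kappa>] in \<open>simp add: lookup_add lookup_minus\<close>)
    have "esize (\<kappa> + (\<nu> - \<kappa>)) = esize \<nu>" by (simp only: add)
    then have k: "esize (\<nu> - \<kappa>) = k" using sz by simp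
    have kc: "keys c \<subseteq> {..<m} \<times> {..<N}" and rc: "row_sums c = \<kappa>"
      using c by (auto simp: coded_tableaux_def tableau_cone_def)
    have "keys (\<nu> - \<kappa>) \<subseteq> keys \<nu>" by (auto simp: in_keys_iff lookup_minus)
    then have keys: "keys x \<subseteq> {..<m} \<times> {..<Suc N}"
      using kc \<nu> by (auto simp: x keys_add_nat keys_last_col)
    have part: "row_part c i N = lookup \<kappa> i" for i using lookup_row_sums[OF kc] rc by simp
    have z: "lookup c (i, N) = 0" for i using lookup_outside[OF kc, of "(i, N)"] by simp
    have "row_part x (Suc i) (Suc b) \<le> row_part x i b" if ib: "Suc i < m" "b < Suc N" for i b
    proof (cases "b < N")
      case True
      then show ?thesis using c ib
        by (simp add: x row_part_add_last_col coded_tableaux_def tableau_cone_def)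
    next
      case False
      with ib have b: "b = N" by simp
      have "row_part x (Suc i) (Suc b) = lookup (\<kappa> + (\<nu> - \<kappa>)) (Suc i)"
        by (simp add: x b row_part_add_last_col part z lookup_add)
      also have "\<dots> \<le> lookup \<kappa> i" unfolding add using \<kappa> by (simp add: interlacing_def)
      finally show ?thesis by (simp add: x b row_part_add_last_col part)
    qed
    with keys have "x \<in> tableau_cone m (Suc N)" by (simp add: tableau_cone_def)
    moreover have "row_sums x = \<nu>" by (simp add: x row_sums_add rc row_sums_last_col add)
    moreover have "col_sums x = \<beta> + single N k"
      using c by (simp add: x col_sums_add col_sums_last_col k coded_tableaux_def)
    ultimately show "x \<in> ?A" by (simp add: coded_tableaux_def)
  next
    fix x assume x: "x \<in> ?A"
    then have kx: "keys x \<subseteq> {..<m} \<times> {..<Suc N}" and rx: "row_sums x = \<nu>"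
      and cx: "col_sums x = \<beta> + single N k"
      and ineq: "\<And>i b. Suc i < m \<Longrightarrow> b < Suc N \<Longrightarrow> row_part x (Suc i) (Suc b) \<le> row_part x i b"
      by (auto simp: coded_tableaux_def tableau_cone_def)
    define c where "c = Abs_poly_mapping (\<lambda>y. if snd y < N then lookup x y else 0)"
    define e where "e = Abs_poly_mapping (\<lambda>i. lookup x (i, N))"
    have lc: "lookup c y = (if snd y < N then lookup x y else 0)" for y
      unfolding c_def by (subst lookup_Abs_poly_mapping) (auto intro: finite_subset[OF _ finite_keys[of x]] simp: in_keys_iff)
    have le: "lookup e i = lookup x (i, N)" for i
    proof -
      have "{i. lookup x (i, N) \<noteq> 0} \<subseteq> fst ` keys x" by (force simp: in_keys_iff)
      then show ?thesis
        unfolding e_def by (subst lookup_Abs_poly_mapping) (auto dest: finite_subset)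
    qed
    have x_zero: "lookup x (i, b) = 0" if "N < b \<or> m \<le> i" for i b
      using lookup_outside[OF kx, of "(i, b)"] that by auto
    have x_eq: "x = c + last_col N e"
    proof (rule poly_mapping_eqI)
      fix y show "lookup x y = lookup (c + last_col N e) y"
        by (cases y) (auto simp: lookup_add lc le lookup_last_col x_zero)
    qed
    have kc: "keys c \<subseteq> {..<m} \<times> {..<N}"
    proof
      fix y assume "y \<in> keys c"
      then have "y \<in> keys x" "snd y < N" by (auto simp: in_keys_iff lc split: if_splits)
      then show "y \<in> {..<m} \<times> {..<N}" using kx by (cases y) auto
    qed
    define \<kappa> where "\<kappa> = row_sums c"
    have part: "row_part c i N = lookup \<kappa> i" for i using lookup_row_sums[OF kc] \<kappa>_def by simp
    have z: "lookup c (i, N) = 0" for i by (simp add: lc)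
    have \<nu>_eq: "\<nu> = \<kappa> + e"
      using rx by (simp add: x_eq row_sums_add row_sums_last_col \<kappa>_def)
    then have e_eq: "e = \<nu> - \<kappa>" by simp
    have cols: "col_sums c + single N (esize e) = \<beta> + single N k"
      using cx by (simp add: x_eq col_sums_add col_sums_last_col)
    have "lookup (col_sums c) N = 0" "lookup \<beta> N = 0"
      using kc \<beta> by (auto simp: in_keys_iff[symmetric] keys_col_sums not_in_keys_iff_lookup_eq_zero[symmetric])
    moreover have "lookup (col_sums c + single N (esize e)) N = lookup (\<beta> + single N k) N" by (simp only: cols)
    ultimately have k: "esize e = k" by (simp add: lookup_add)
    with cols have "col_sums c = \<beta>" by simp
    moreover have "row_part c (Suc i) (Suc b) \<le> row_part c i b" if "Suc i < m" "b < N" for i b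
      using ineq[OF that(1), of b] that(2) by (simp add: x_eq row_part_add_last_col)
    then have "c \<in> tableau_cone m N" using kc by (simp add: tableau_cone_def)
    ultimately have c: "c \<in> coded_tableaux m N \<kappa> \<beta>" by (simp add: coded_tableaux_def \<kappa>_def)
    have "lookup \<nu> (Suc i) \<le> lookup \<kappa> i" for i
    proof (cases "Suc i < m")
      case True
      then show ?thesis using ineq[OF True, of N]
        by (simp add: x_eq row_part_add_last_col part z \<nu>_eq lookup_add)
    next
      case False
      then have "Suc i \<notin> keys \<nu>" using \<nu> by auto
      then show ?thesis by (simp add: in_keys_iff)
    qed
    then have "\<kappa> \<in> interlacing \<nu>" by (simp add: interlacing_def \<nu>_eq lookup_add)
    moreover have "esize \<nu> = esize \<kappa> + k" by (simp add: \<nu>_eq k)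
    ultimately have "(\<kappa>, c) \<in> ?S" using c by simp
    then show "x \<in> ?h ` ?S" by (rule rev_image_eqI) (simp add: x_eq e_eq[symmetric])
  qed
qed

text \<open>Tableaux and codes satisfy the same branching recursion in the number of letters and
  agree when there are none.\<close>

lemma schur_eq_card_coded_tableaux:
  "is_partition \<nu> \<Longrightarrow> keys \<nu> \<subseteq> {..<m} \<Longrightarrow> keys \<beta> \<subseteq> {..<N} \<Longrightarrow>
    schur \<nu> \<beta> = int (card (coded_tableaux m N \<nu> \<beta>))"
proof (induction N arbitrary: \<nu> \<beta>)
  case 0
  then have "\<beta> = 0" by simp
  have "tableau_cone m 0 = {0}" by (auto simp: tableau_cone_def)
  then have "coded_tableaux m 0 \<nu> 0 = (if \<nu> = 0 then {0} else {})"
    by (auto simp: coded_tableaux_def row_sums_def col_sums_def)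
  then show ?case using \<open>\<beta> = 0\<close> by (simp add: schur_zero)
next
  case (Suc N)
  define k where "k = lookup \<beta> N"
  define \<beta>' where "\<beta>' = \<beta> - single N k"
  have \<beta>: "\<beta> = \<beta>' + single N k"
    by (rule poly_mapping_eqI) (auto simp: \<beta>'_def k_def lookup_add lookup_minus lookup_single when_def)
  have \<beta>': "keys \<beta>' \<subseteq> {..<N}"
  proof
    fix i assume "i \<in> keys \<beta>'"
    then have i: "lookup \<beta>' i \<noteq> 0" by (simp add: in_keys_iff)
    then have "i \<noteq> N" by (auto simp: \<beta>'_def k_def lookup_minus)
    moreover have "i \<in> keys \<beta>" using i by (auto simp: \<beta>'_def in_keys_iff lookup_minus)
    ultimately show "i \<in> {..<N}" using Suc.prems(3) by (auto simp: less_Suc_eq)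
  qed
  let ?K = "{\<kappa> \<in> interlacing \<nu>. esize \<nu> = esize \<kappa> + k}"
  have "schur \<nu> \<beta> = (\<Sum>\<kappa>\<in>?K. schur \<kappa> \<beta>')"
    unfolding \<beta> by (rule schur_branching[OF Suc.prems(1) \<beta>'])
  also have "\<dots> = (\<Sum>\<kappa>\<in>?K. int (card (coded_tableaux m N \<kappa> \<beta>')))"
    using interlacing_partition interlacing_keys Suc.prems(2)
    by (intro sum.cong refl Suc.IH \<beta>') blast+
  also have "\<dots> = int (card (SIGMA \<kappa>:?K. coded_tableaux m N \<kappa> \<beta>'))"
    by (subst card_SigmaI) (auto simp: finite_coded_tableaux)
  also have "\<dots> = int (card (coded_tableaux m (Suc N) \<nu> \<beta>))"
    using bij_betw_same_card[OF coded_tableaux_Suc[OF Suc.prems(2) \<beta>', of k]] \<beta> by simp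
  finally show ?case .
qed

text \<open>The codes are sorted by their content \<open>col_sums c\<close>. The positions of
  monomials in \<open>n\<close> variables may have gaps below \<open>N\<close>, which is why the
  letters are restricted to them separately.\<close>

lemma plethysm_eq_card:
  assumes \<nu>: "is_partition \<nu>" "keys \<nu> \<subseteq> {..<m}" and \<alpha>: "keys \<alpha> \<subseteq> {..<n}"
    and N: "monomial_index_in (schur \<mu>) n \<subseteq> {..<N}"
  shows "plethysm (schur \<nu>) (schur \<mu>) \<alpha> =
    int (card {c \<in> tableau_cone m N. keys c \<subseteq> {..<m} \<times> monomial_index_in (schur \<mu>) n \<and>
       weight (\<lambda>x. nth_monomial (schur \<mu>) (snd x)) c = \<alpha> \<and> row_sums c = \<nu>})"
proof -
  let ?I = "monomial_index_in (schur \<mu>) n" and ?\<theta> = "nth_monomial (schur \<mu>)"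
  let ?T = "plethysm_terms \<nu> \<mu> n \<alpha>"
  have fin: "finite ?T"
    by (rule finite_subset[OF _ finite_expos_esize[OF finite_monomial_index_in, of \<mu> n "esize \<nu>"]])
       (auto simp: plethysm_terms_def dest: schur_esize)
  have sch: "schur \<nu> \<beta> = int (card (coded_tableaux m N \<nu> \<beta>))" if "keys \<beta> \<subseteq> ?I" for \<beta>
    using that N by (intro schur_eq_card_coded_tableaux \<nu>) auto
  have w: "weight ?\<theta> (col_sums c) = weight (\<lambda>x. ?\<theta> (snd x)) c" for c
    unfolding col_sums_def weight_weight weight_single ..
  have U: "{c \<in> tableau_cone m N. keys c \<subseteq> {..<m} \<times> ?I \<and> weight (\<lambda>x. ?\<theta> (snd x)) c = \<alpha> \<and> row_sums c = \<nu>}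
    = (\<Union>\<beta>\<in>?T. coded_tableaux m N \<nu> \<beta>)" (is "?X = _")
  proof (intro equalityI subsetI)
    fix c assume c: "c \<in> ?X"
    then have k: "keys (col_sums c) \<subseteq> ?I" by (auto simp: keys_col_sums)
    have c': "c \<in> coded_tableaux m N \<nu> (col_sums c)" using c by (simp add: coded_tableaux_def)
    then have "card (coded_tableaux m N \<nu> (col_sums c)) \<noteq> 0"
      using finite_coded_tableaux by (auto simp: card_eq_0_iff)
    then have "col_sums c \<in> ?T" using c k by (simp add: plethysm_terms_def sch w)
    with c' show "c \<in> (\<Union>\<beta>\<in>?T. coded_tableaux m N \<nu> \<beta>)" by blast
  next
    fix c assume "c \<in> (\<Union>\<beta>\<in>?T. coded_tableaux m N \<nu> \<beta>)"
    then obtain \<beta> where \<beta>: "\<beta> \<in> ?T" and c: "c \<in> coded_tableaux m N \<nu> \<beta>" by blast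
    then have cs: "col_sums c = \<beta>" "c \<in> tableau_cone m N" by (auto simp: coded_tableaux_def)
    then have "snd ` keys c \<subseteq> ?I" using \<beta> by (simp add: keys_col_sums[symmetric] plethysm_terms_def)
    moreover have "keys c \<subseteq> {..<m} \<times> {..<N}" using cs by (simp add: tableau_cone_def)
    ultimately have "keys c \<subseteq> {..<m} \<times> ?I" by force
    then show "c \<in> ?X"
      using cs \<beta> c w[of c] by (simp add: coded_tableaux_def plethysm_terms_def)
  qed
  have "plethysm (schur \<nu>) (schur \<mu>) \<alpha> = (\<Sum>\<beta>\<in>?T. int (card (coded_tableaux m N \<nu> \<beta>)))"
    unfolding plethysm_eq_sum_terms[OF \<alpha>] by (intro sum.cong refl sch) (simp add: plethysm_terms_def)
  also have "\<dots> = int (card (\<Union>\<beta>\<in>?T. coded_tableaux m N \<nu> \<beta>))"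
    by (subst card_UN_disjoint[OF fin]) (auto simp: finite_coded_tableaux, auto simp: coded_tableaux_def)
  finally show ?thesis unfolding U .
qed

subsection \<open>Rationality\<close>

text \<open>Summation over the fibres of \<open>\<phi>\<close> is the monomial substitution induced
  by \<open>\<phi>\<close>; it turns multiplication by 1 - x^b into multiplication by the binomial
  of \<open>\<phi> b\<close>. The condition on \<open>A\<close> makes the index set compatible with
  these shifts.\<close>

lemma binomial_rational_push_forward:
  fixes \<phi> :: "'a::cancel_comm_monoid_add \<Rightarrow> 'c::cancel_comm_monoid_add" and F :: "'a \<Rightarrow> 'b::comm_ring_1"
  assumes add: "\<And>a b. \<phi> (a + b) = \<phi> a + \<phi> b"
    and B: "\<And>b. b \<in> B \<Longrightarrow> \<phi> b \<in> B'" and A: "\<And>b d. b \<in> B \<Longrightarrow> b + d \<in> A \<longleftrightarrow> d \<in> A"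
    and fin: "\<And>e. finite {c \<in> A. \<phi> c = e}"
    and F: "binomial_rational B F"
  shows "binomial_rational B' (\<lambda>e. \<Sum>c | c \<in> A \<and> \<phi> c = e. F c)"
proof -
  define push where "push G e = (\<Sum>c | c \<in> A \<and> \<phi> c = e. G c)" for G :: "'a \<Rightarrow> 'b" and e
  have push_shift: "push (shift b G) = shift (\<phi> b) (push G)" if b: "b \<in> B" for b G
  proof
    fix e
    show "push (shift b G) e = shift (\<phi> b) (push G) e"
    proof (cases "\<exists>d. e = \<phi> b + d")
      case True
      then obtain d where d: "e = \<phi> b + d" by blast
      have "push (shift b G) e = (\<Sum>c\<in>(+) b ` {c \<in> A. \<phi> c = d}. shift b G c)"
        unfolding push_def
      proof (rule sum.mono_neutral_right)
        show "(+) b ` {c \<in> A. \<phi> c = d} \<subseteq> {c \<in> A. \<phi> c = e}"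
          using A[OF b] by (auto simp: d add)
        show "\<forall>c\<in>{c \<in> A. \<phi> c = e} - (+) b ` {c \<in> A. \<phi> c = d}. shift b G c = 0"
        proof (intro ballI, rule ccontr)
          fix c assume c: "c \<in> {c \<in> A. \<phi> c = e} - (+) b ` {c \<in> A. \<phi> c = d}" and "shift b G c \<noteq> 0"
          then obtain c' where "c = b + c'" by (blast elim: shift_neq_0_E)
          with c A[OF b, of c'] show False by (auto simp: d add)
        qed
      qed (rule fin)
      also have "\<dots> = push G d"
        unfolding push_def by (subst sum.reindex) (auto simp: inj_on_def)
      finally show ?thesis by (simp add: d)
    next
      case False
      have "shift b G c = 0" if "\<phi> c = e" for c
        using False that add by (intro shift_not_add) auto
      with False show ?thesis by (simp add: push_def shift_not_add)
    qed
  qed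
  have push_bdiff: "push (bdiff b G) = bdiff (\<phi> b) (push G)" if b: "b \<in> B" for b G
    using fun_cong[OF push_shift[OF b, of G]]
    by (auto simp: fun_eq_iff bdiff_def push_def sum_subtractf)
  obtain M where M: "set_mset M \<subseteq> B" "fin_supp (bdiffs M F)"
    using F by (auto simp: binomial_rational_def)
  have push_bdiffs: "push (bdiffs M F) = bdiffs (image_mset \<phi> M) (push F)"
    using M(1) by (induction M) (auto simp: push_bdiff)
  have "{e. push (bdiffs M F) e \<noteq> 0} \<subseteq> \<phi> ` {c. bdiffs M F c \<noteq> 0}"
  proof
    fix e assume "e \<in> {e. push (bdiffs M F) e \<noteq> 0}"
    then obtain c where "\<phi> c = e" "bdiffs M F c \<noteq> 0"
      unfolding push_def by (auto elim: sum.not_neutral_contains_not_neutral)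
    then show "e \<in> \<phi> ` {c. bdiffs M F c \<noteq> 0}" by blast
  qed
  then have "fin_supp (push (bdiffs M F))"
    using M(2) unfolding fin_supp_def by (meson finite_imageI finite_subset)
  then have "binomial_rational B' (push F)"
    using M(1) B by (intro binomial_rationalI[of "image_mset \<phi> M"]) (auto simp: push_bdiffs)
  then show ?thesis by (simp add: push_def[abs_def])
qed

text \<open>Division by x^r. Divisibility by x^r survives multiplication by each 1 - x^b, so both
  operations commute on the series in question.\<close>

lemma binomial_rational_unshift:
  fixes F :: "'a::cancel_comm_monoid_add \<Rightarrow> 'b::comm_ring_1"
  assumes supp: "\<And>e. F e \<noteq> 0 \<Longrightarrow> \<exists>d. e = d + r" and F: "binomial_rational B F"
  shows "binomial_rational B (\<lambda>e. F (e + r))"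
proof -
  have bdiff: "bdiff b (\<lambda>e. G (e + r)) = (\<lambda>e. bdiff b G (e + r))"
    and bdiff_supp: "bdiff b G e \<noteq> 0 \<Longrightarrow> \<exists>d. e = d + r"
    if G: "\<And>e. G e \<noteq> 0 \<Longrightarrow> \<exists>d. e = d + r" for b e and G :: "'a \<Rightarrow> 'b"
  proof -
    have "shift b (\<lambda>e. G (e + r)) e = shift b G (e + r)" for e
    proof (cases "\<exists>d. e = b + d")
      case True
      then show ?thesis by (auto simp: add.assoc)
    next
      case False
      have "shift b G (e + r) = 0"
      proof (rule ccontr)
        assume "shift b G (e + r) \<noteq> 0"
        then obtain d where d: "e + r = b + d" "G d \<noteq> 0" by (rule shift_neq_0_E)
        from G[OF d(2)] obtain d' where "d = d' + r" by blast
        with d(1) have "e = b + d'" by (simp add: add.assoc[symmetric])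
        with False show False by blast
      qed
      with False show ?thesis by (simp add: shift_not_add)
    qed
    then show "bdiff b (\<lambda>e. G (e + r)) = (\<lambda>e. bdiff b G (e + r))"
      by (simp add: bdiff_def fun_eq_iff)
    assume "bdiff b G e \<noteq> 0"
    then consider "G e \<noteq> 0" | "shift b G e \<noteq> 0" by (cases "G e = 0") (auto simp: bdiff_def)
    then show "\<exists>d. e = d + r"
    proof cases
      case 2
      then obtain d where d: "e = b + d" "G d \<noteq> 0" by (rule shift_neq_0_E)
      from G[OF d(2)] obtain d' where "d = d' + r" by blast
      with d(1) show ?thesis by (auto simp: add.assoc[symmetric])
    qed (rule G)
  qed
  have *: "bdiffs M (\<lambda>e. F (e + r)) = (\<lambda>e. bdiffs M F (e + r)) \<and>
      (\<forall>e. bdiffs M F e \<noteq> 0 \<longrightarrow> (\<exists>d. e = d + r))" for M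
  proof (induction M)
    case (add b M)
    then show ?case using bdiff[of "bdiffs M F" b] bdiff_supp[of "bdiffs M F" b] by simp
  qed (use supp in simp)
  obtain M where M: "set_mset M \<subseteq> B" "fin_supp (bdiffs M F)"
    using F by (auto simp: binomial_rational_def)
  have "finite ((\<lambda>e. e + r) -` {e. bdiffs M F e \<noteq> 0})"
    using M(2) unfolding fin_supp_def by (rule finite_vimageI) (simp add: inj_on_def)
  then have "fin_supp (bdiffs M (\<lambda>e. F (e + r)))"
    using * by (simp add: fin_supp_def vimage_def)
  then show ?thesis using M(1) by (intro binomial_rationalI)
qed

text \<open>The generating function of the orthant is the product of geometric series in its
  variables; multiplying by 1 - x_j removes variable \<open>j\<close>.\<close>

lemma binomial_rational_orthant:
  fixes J :: "'i set"
  assumes "finite K" "K \<subseteq> J"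
  shows "binomial_rational {c :: 'i \<Rightarrow>\<^sub>0 nat. keys c \<subseteq> J \<and> c \<noteq> 0} (\<lambda>c. if keys c \<subseteq> K then 1 else 0 :: rat)"
  using assms
proof (induction K)
  case empty
  have "{e :: 'i \<Rightarrow>\<^sub>0 nat. (if keys e \<subseteq> {} then 1 else 0 :: rat) \<noteq> 0} \<subseteq> {0}" by (auto split: if_splits)
  then show ?case
    by (intro binomial_rational_fin_supp) (auto simp: fin_supp_def intro: finite_subset)
next
  case (insert j K)
  let ?F = "\<lambda>K (c :: 'i \<Rightarrow>\<^sub>0 nat). if keys c \<subseteq> K then 1 else 0 :: rat"
  have "bdiff (single j 1) (?F (insert j K)) = ?F K"
  proof
    fix e :: "'i \<Rightarrow>\<^sub>0 nat"
    show "bdiff (single j 1) (?F (insert j K)) e = ?F K e"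
    proof (cases "j \<in> keys e")
      case True
      then have e: "e = single j 1 + (e - single j 1)"
        by (intro poly_mapping_eqI) (auto simp: lookup_add lookup_minus lookup_single when_def in_keys_iff)
      have "shift (single j 1) (?F (insert j K)) e = ?F (insert j K) (e - single j 1)"
        by (subst e) (rule shift_add_left)
      moreover have "keys e = insert j (keys (e - single j 1))"
        by (subst e) (simp add: keys_add_nat)
      ultimately show ?thesis using True insert.hyps(2) by (auto simp: bdiff_def)
    next
      case False
      then have "\<nexists>d. e = single j 1 + d" by (auto simp: keys_add_nat)
      with False show ?thesis by (auto simp: bdiff_def shift_not_add)
    qed
  qed
  with insert have "binomial_rational {c :: 'i \<Rightarrow>\<^sub>0 nat. keys c \<subseteq> J \<and> c \<noteq> 0} (bdiff (single j 1) (?F (insert j K)))"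
    by (simp only:) auto
  moreover have "single j (1::nat) \<noteq> 0"
    by (metis esize_single esize_zero one_neq_zero)
  then have "single j (1::nat) \<in> {c. keys c \<subseteq> J \<and> c \<noteq> 0}" using insert.prems by simp
  ultimately show ?case by (rule binomial_rational_bdiff)
qed

section \<open>From binomial denominators to rational functions and recurrences\<close>

lemma finite_expo_decompositions: "finite {(d, d'). d + d' = (e :: expo \<times> expo)}"
proof -
  let ?S = "\<lambda>a :: expo. {x. keys x \<subseteq> keys a \<and> (\<forall>i. lookup x i \<le> esize a)}"
  let ?T = "?S (fst e) \<times> ?S (snd e)"
  have "{(d, d'). d + d' = e} \<subseteq> ?T \<times> ?T"
    by (auto simp: mem_Times_iff keys_add_nat trans_le_add1 trans_le_add2 lookup_le_esize)
  moreover have "finite (?T \<times> ?T)"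
    by (intro finite_cartesian_product finite_expos_bounded finite_keys)
  ultimately show ?thesis by (rule finite_subset)
qed

text \<open>The monomial x^b can move from one factor to the other: either way the sum runs over the
  pairs \<open>(t, d')\<close> with \<open>b + t + d' = e\<close>.\<close>

lemma series_mult_bdiff: "series_mult (bdiff b Q) F = series_mult Q (bdiff b F)"
proof
  fix e :: "expo \<times> expo"
  let ?D = "{(d, d'). d + d' = e}"
  let ?E = "{(t, d'). b + t + d' = e}"
  have "(\<Sum>(d, d')\<in>?D. shift b Q d * F d') = (\<Sum>(t, d')\<in>?E. Q t * F d')"
  proof -
    have "(\<Sum>(d, d')\<in>?D. shift b Q d * F d') = (\<Sum>(d, d')\<in>(\<lambda>(t, d'). (b + t, d')) ` ?E. shift b Q d * F d')"
    proof (rule sum.mono_neutral_right[OF finite_expo_decompositions])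
      show "\<forall>x\<in>?D - (\<lambda>(t, d'). (b + t, d')) ` ?E. (case x of (d, d') \<Rightarrow> shift b Q d * F d') = 0"
      proof (clarify, rule ccontr)
        fix d d' assume n: "(d, d') \<notin> (\<lambda>(t, d'). (b + t, d')) ` {(t, d''). b + t + d'' = d + d'}" and "shift b Q d * F d' \<noteq> 0"
        then have "shift b Q d \<noteq> 0" by simp
        then obtain t where "d = b + t" by (rule shift_neq_0_E)
        then have "(d, d') = (\<lambda>(t, d'). (b + t, d')) (t, d')" "b + t + d' = d + d'" by (simp_all add: add_ac)
        with n show False by blast
      qed
    qed (auto simp: add_ac)
    then show ?thesis by (subst (asm) sum.reindex) (auto simp: inj_on_def case_prod_beta)
  qed
  moreover have "(\<Sum>(d, d')\<in>?D. Q d * shift b F d') = (\<Sum>(t, d')\<in>?E. Q t * F d')"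
  proof -
    have "(\<Sum>(d, d')\<in>?D. Q d * shift b F d') = (\<Sum>(d, d')\<in>(\<lambda>(t, d'). (t, b + d')) ` ?E. Q d * shift b F d')"
    proof (rule sum.mono_neutral_right[OF finite_expo_decompositions])
      show "\<forall>x\<in>?D - (\<lambda>(t, d'). (t, b + d')) ` ?E. (case x of (d, d') \<Rightarrow> Q d * shift b F d') = 0"
      proof (clarify, rule ccontr)
        fix d d' assume n: "(d, d') \<notin> (\<lambda>(t, d'). (t, b + d')) ` {(t, d''). b + t + d'' = d + d'}" and "Q d * shift b F d' \<noteq> 0"
        then have "shift b F d' \<noteq> 0" by simp
        then obtain t where "d' = b + t" by (rule shift_neq_0_E)
        then have "(d, d') = (\<lambda>(t, d'). (t, b + d')) (d, t)" "b + d + t = d + d'" by (simp_all add: add_ac)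
        with n show False by blast
      qed
    qed (auto simp: add_ac)
    then show ?thesis by (subst (asm) sum.reindex) (auto simp: inj_on_def case_prod_beta)
  qed
  ultimately show "series_mult (bdiff b Q) F e = series_mult Q (bdiff b F) e"
    by (simp add: series_mult_def bdiff_def algebra_simps case_prod_beta sum_subtractf)
qed

lemma add_in_expos_xy: "a + b \<in> expos_xy n m \<longleftrightarrow> a \<in> expos_xy n m \<and> b \<in> expos_xy n m"
  by (cases a; cases b) (auto simp: expos_xy_def keys_add_nat)

lemma bdiff_support_expos:
  assumes "\<And>e. G e \<noteq> 0 \<Longrightarrow> e \<in> expos_xy n m" "b \<in> expos_xy n m" "bdiff b G e \<noteq> 0"
  shows "e \<in> expos_xy n m"
proof -
  consider "G e \<noteq> 0" | "shift b G e \<noteq> 0" using assms(3) by (cases "G e = 0") (auto simp: bdiff_def)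
  then show ?thesis
  proof cases
    case 2
    then obtain d where "e = b + d" "G d \<noteq> 0" by (rule shift_neq_0_E)
    then show ?thesis using assms(1,2) by (simp add: add_in_expos_xy)
  qed (rule assms(1))
qed

text \<open>The witness is the expanded product of the binomials. Its constant term starts at 1 and
  is never changed, because no \<open>b\<close> is 0 and nonzero exponents cannot add up to
  0.\<close>

lemma bdiffs_eq_series_mult:
  assumes "set_mset M \<subseteq> expos_xy n m - {0}"
  shows "\<exists>Q. fin_supp Q \<and> (\<forall>e. Q e \<noteq> 0 \<longrightarrow> e \<in> expos_xy n m) \<and> Q 0 \<noteq> 0 \<and> series_mult Q F = bdiffs M F"
  using assms
proof (induction M arbitrary: F)
  case empty
  let ?Q = "\<lambda>e :: expo \<times> expo. if e = 0 then 1 else 0 :: rat"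
  have "series_mult ?Q F e = F e" for e
  proof -
    have "series_mult ?Q F e = (\<Sum>(d, d')\<in>{(0, e)}. ?Q d * F d')"
      unfolding series_mult_def
      by (rule sum.mono_neutral_right[OF finite_expo_decompositions]) (auto simp: zero_prod_def split: if_splits)
    then show ?thesis by simp
  qed
  then show ?case
    by (intro exI[of _ ?Q]) (auto simp: fin_supp_def expos_xy_def zero_prod_def)
next
  case (add b M)
  obtain Q where Q: "fin_supp Q" "\<And>e. Q e \<noteq> 0 \<Longrightarrow> e \<in> expos_xy n m" "Q 0 \<noteq> 0"
    "series_mult Q (bdiff b F) = bdiffs M (bdiff b F)"
    using add.IH[of "bdiff b F"] add.prems by auto
  have b: "b \<in> expos_xy n m" "b \<noteq> 0" using add.prems by auto
  have "0 \<noteq> b + d" for d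
  proof
    assume "0 = b + d"
    then have "esize (fst b + fst d) = 0" "esize (snd b + snd d) = 0"
      by (simp_all add: zero_prod_def plus_prod_def)
    then show False using b(2) by (simp add: zero_prod_def prod_eq_iff)
  qed
  then have "bdiff b Q 0 = Q 0" by (simp add: bdiff_def shift_not_add)
  then show ?case
    using Q bdiff_support_expos[OF Q(2) b(1)]
    by (intro exI[of _ "bdiff b Q"]) (auto simp: fin_supp_bdiff series_mult_bdiff bdiffs_bdiff)
qed

lemma binomial_rational_imp_rational_series:
  assumes F: "binomial_rational (expos_xy n m - {0}) F" and supp: "\<And>e. F e \<noteq> 0 \<Longrightarrow> e \<in> expos_xy n m"
  shows "is_rational_series n m F"
proof -
  obtain M where M: "set_mset M \<subseteq> expos_xy n m - {0}" "fin_supp (bdiffs M F)"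
    using F by (auto simp: binomial_rational_def)
  obtain Q where Q: "fin_supp Q" "\<And>e. Q e \<noteq> 0 \<Longrightarrow> e \<in> expos_xy n m" "Q 0 \<noteq> 0"
    "series_mult Q F = bdiffs M F" using bdiffs_eq_series_mult[OF M(1)] by blast
  have P: "e \<in> expos_xy n m" if "bdiffs M F e \<noteq> 0" for e
    using M(1) that
  proof (induction M arbitrary: e)
    case (add b M)
    then show ?case using bdiff_support_expos[of "bdiffs M F" n m b e] by simp
  qed (use supp in simp)
  have "lookup (Abs_poly_mapping Q) = Q" "lookup (Abs_poly_mapping (bdiffs M F)) = bdiffs M F"
    using Q(1) M(2) by (auto simp: fin_supp_def)
  then show ?thesis
    unfolding is_rational_series_def using Q P
    by (intro exI[of _ "Abs_poly_mapping (bdiffs M F)"] exI[of _ "Abs_poly_mapping Q"])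
       (auto simp: in_keys_iff)
qed

text \<open>Comparing coefficients in Q F = P and solving for the term with the constant coefficient
  of \<open>Q\<close> gives the recurrence; the only possible exceptions are the finitely many
  exponents of \<open>P\<close>.\<close>

lemma rational_series_imp_linear_recurrence:
  assumes "is_rational_series n m F"
  shows "satisfies_linear_recurrence n m F"
proof -
  obtain P Q :: "(expo \<times> expo) \<Rightarrow>\<^sub>0 rat" where Q: "keys Q \<subseteq> expos_xy n m" "lookup Q 0 \<noteq> 0"
    and eq: "series_mult (lookup Q) F = lookup P"
    using assms by (auto simp: is_rational_series_def)
  define S where "S = keys Q - {0}"
  define c where "c s = - lookup Q s / lookup Q 0" for s
  have "F e = (\<Sum>(s, d) | s \<in> S \<and> s + d = e. c s * F d)" if "e \<notin> keys P" for e
  proof -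
    let ?R = "{(s, d). s \<in> S \<and> s + d = e}"
    have fin: "finite ?R" by (rule finite_subset[OF _ finite_expo_decompositions[of e]]) auto
    have "0 = series_mult (lookup Q) F e" using that by (simp add: eq in_keys_iff)
    also have "\<dots> = (\<Sum>(s, d)\<in>insert (0, e) ?R. lookup Q s * F d)"
      unfolding series_mult_def
      by (rule sum.mono_neutral_right[OF finite_expo_decompositions]) (auto simp: S_def in_keys_iff)
    also have "\<dots> = lookup Q 0 * F e + (\<Sum>(s, d)\<in>?R. lookup Q s * F d)"
      using fin by (subst sum.insert) (auto simp: S_def)
    also have "(\<Sum>(s, d)\<in>?R. lookup Q s * F d) = - (lookup Q 0 * (\<Sum>(s, d)\<in>?R. c s * F d))"
      using Q(2) by (simp add: sum_distrib_left sum_negf[symmetric] c_def case_prod_beta)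
    finally show ?thesis using Q(2) by simp
  qed
  then have "{e \<in> expos_xy n m. F e \<noteq> (\<Sum>(s, d) | s \<in> S \<and> s + d = e. c s * F d)} \<subseteq> keys P" by blast
  then have "finite {e \<in> expos_xy n m. F e \<noteq> (\<Sum>(s, d) | s \<in> S \<and> s + d = e. c s * F d)}"
    by (rule finite_subset) simp
  then show ?thesis
    unfolding satisfies_linear_recurrence_def using Q(1)
    by (intro exI[of _ S] exI[of _ c]) (auto simp: S_def)
qed

text \<open>Inequalities are imposed twice, on the codes to cut out the tableau cone and on pairs of
  exponents to select partitions. This interpretation and the next make the reduction available in
  both monoids.\<close>

interpretation orthant: graded_cone esize "{c :: 'i \<Rightarrow>\<^sub>0 nat. keys c \<subseteq> J \<and> c \<noteq> 0}" for J :: "'i set"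
proof
  fix a b :: "'i \<Rightarrow>\<^sub>0 nat"
  assume "a \<in> {c. keys c \<subseteq> J \<and> c \<noteq> 0}" "b \<in> {c. keys c \<subseteq> J \<and> c \<noteq> 0}"
  moreover from this have "esize (a + b) \<noteq> 0" by simp
  then have "a + b \<noteq> 0" by (metis esize_zero)
  ultimately show "a + b \<in> {c. keys c \<subseteq> J \<and> c \<noteq> 0}" by (auto simp: keys_add_nat)
next
  fix b :: "'i \<Rightarrow>\<^sub>0 nat" assume "b \<in> {c. keys c \<subseteq> J \<and> c \<noteq> 0}"
  then show "0 < esize b" by simp
qed simp

interpretation expos_xy: graded_cone "\<lambda>(a, b). esize a + esize b" "expos_xy n m - {0}" for n m
proof
  fix a b :: "expo \<times> expo"
  assume "a \<in> expos_xy n m - {0}" "b \<in> expos_xy n m - {0}"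
  moreover from this have "esize (fst a) + esize (snd a) \<noteq> 0" by (auto simp: zero_prod_def prod_eq_iff)
  then have "a + b \<noteq> 0"
    by (metis esize_add esize_zero add_is_0 fst_add fst_zero snd_add snd_zero)
  ultimately show "a + b \<in> expos_xy n m - {0}" by (simp add: add_in_expos_xy)
next
  fix b :: "expo \<times> expo" assume "b \<in> expos_xy n m - {0}"
  then show "0 < (case b of (a, b) \<Rightarrow> esize a + esize b)"
    by (cases b) (auto simp: zero_prod_def)
qed (auto split: prod.splits)

lemma row_part_add: "row_part (a + b) i k = row_part a i k + row_part b i k"
  by (simp add: row_part_def lookup_add sum.distrib)

lemma binomial_rational_tableau_cone:
  assumes "finite J" "J \<subseteq> {..<m} \<times> {..<N}"
  shows "binomial_rational {c. keys c \<subseteq> J \<and> c \<noteq> 0}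
    (\<lambda>c. if c \<in> tableau_cone m N \<and> keys c \<subseteq> J then 1 else 0 :: rat)"
proof -
  define l where "l p c = int (row_part c (fst p) (snd p)) - int (row_part c (Suc (fst p)) (Suc (snd p)))"
    for p :: "nat \<times> nat" and c
  let ?P = "{(i, k). Suc i < m \<and> k < N}"
  have fin: "finite ?P" by (rule finite_subset[of _ "{..<m} \<times> {..<N}"]) auto
  have "binomial_rational {c. keys c \<subseteq> J \<and> c \<noteq> 0}
      (\<lambda>c. if \<forall>p\<in>?P. 0 \<le> l p c then (if keys c \<subseteq> J then 1 else 0 :: rat) else 0)"
    by (rule orthant.binomial_rational_restrict_finite[OF fin _ binomial_rational_orthant])
       (auto simp: l_def row_part_add assms)
  then show ?thesis
    by (rule back_subst[where P = "binomial_rational _"])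
       (use assms(2) in \<open>auto simp: fun_eq_iff tableau_cone_def l_def\<close>)
qed

theorem theorem6p2:
  fixes n m :: nat and \<mu> :: "nat \<Rightarrow>\<^sub>0 nat"
  assumes "n \<ge> 1" and "m \<ge> 1"
    and "is_partition \<mu>" and "part_length \<mu> \<le> n"
  shows "is_rational_series n m (plethysm_series n m \<mu>) \<and>
         satisfies_linear_recurrence n m (plethysm_series n m \<mu>)"
proof -
  let ?I = "monomial_index_in (schur \<mu>) n" and ?\<theta> = "nth_monomial (schur \<mu>)"
  let ?J = "{..<m} \<times> ?I" and ?B = "expos_xy n m - {0}"
  obtain N where N: "?I \<subseteq> {..<N}" using finite_monomial_index_in finite_nat_iff_bounded by blast
  \<comment> \<open>The second component determines \<open>esize c\<close>. Hence the fibres are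
    finite and no nonzero code is sent to 0, even if \<open>\<mu>\<close> is empty and the first
    component vanishes.\<close>
  define \<phi> where "\<phi> c = (weight (\<lambda>x. ?\<theta> (snd x)) c, row_sums c)" for c
  define W where "W e = (\<Sum>c | c \<in> {c. keys c \<subseteq> ?J} \<and> \<phi> c = e.
    if c \<in> tableau_cone m N \<and> keys c \<subseteq> ?J then 1 else 0 :: rat)" for e
  have \<phi>_expos: "\<phi> c \<in> expos_xy n m" if "keys c \<subseteq> ?J" for c
    using that by (fastforce simp: \<phi>_def expos_xy_def keys_weight row_sums_def monomial_index_in_def)
  have fin: "finite {c. keys c \<subseteq> ?J \<and> \<phi> c = e}" for e
    by (rule finite_subset[OF _ finite_expos_esize[of ?J "esize (snd e)"]])
       (auto simp: \<phi>_def esize_row_sums finite_monomial_index_in)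
  have W_rat: "binomial_rational ?B W"
    unfolding W_def
  proof (rule binomial_rational_push_forward[where B = "{c. keys c \<subseteq> ?J \<and> c \<noteq> 0}"])
    show "\<phi> (a + b) = \<phi> a + \<phi> b" for a b by (simp add: \<phi>_def weight_add row_sums_add)
    show "\<phi> b \<in> ?B" if "b \<in> {c. keys c \<subseteq> ?J \<and> c \<noteq> 0}" for b
    proof -
      have "esize (snd (\<phi> b)) \<noteq> 0" using that by (simp add: \<phi>_def esize_row_sums)
      then have "\<phi> b \<noteq> 0" by (auto simp: zero_prod_def)
      then show ?thesis using that \<phi>_expos by auto
    qed
    show "binomial_rational {c. keys c \<subseteq> ?J \<and> c \<noteq> 0}
       (\<lambda>c. if c \<in> tableau_cone m N \<and> keys c \<subseteq> ?J then 1 else 0 :: rat)"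
      using N by (intro binomial_rational_tableau_cone) (auto simp: finite_monomial_index_in)
  qed (use fin in \<open>auto simp: keys_add_nat\<close>)
  have W_supp: "e \<in> expos_xy n m" if "W e \<noteq> 0" for e
  proof -
    have "{c. c \<in> {c. keys c \<subseteq> ?J} \<and> \<phi> c = e} \<noteq> {}"
      using that unfolding W_def by (metis (no_types, lifting) sum.empty)
    then show ?thesis using \<phi>_expos by blast
  qed
  have W_plethysm: "W (\<alpha>, \<nu>) = of_int (restrict_vars n (plethysm (schur \<nu>) (schur \<mu>)) \<alpha>)"
    if \<nu>: "is_partition \<nu>" "keys \<nu> \<subseteq> {..<m}" for \<alpha> \<nu>
  proof (cases "keys \<alpha> \<subseteq> {..<n}")
    case True
    have "W (\<alpha>, \<nu>) = of_nat (card {c \<in> {c. keys c \<subseteq> ?J \<and> \<phi> c = (\<alpha>, \<nu>)}. c \<in> tableau_cone m N})"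
    proof -
      have "W (\<alpha>, \<nu>) = (\<Sum>c | keys c \<subseteq> ?J \<and> \<phi> c = (\<alpha>, \<nu>). if c \<in> tableau_cone m N then 1 else 0)"
        unfolding W_def by (intro sum.cong) auto
      then show ?thesis using fin[of "(\<alpha>, \<nu>)"] by (simp add: sum.inter_filter[symmetric])
    qed
    also have "{c \<in> {c. keys c \<subseteq> ?J \<and> \<phi> c = (\<alpha>, \<nu>)}. c \<in> tableau_cone m N} =
      {c \<in> tableau_cone m N. keys c \<subseteq> ?J \<and> weight (\<lambda>x. ?\<theta> (snd x)) c = \<alpha> \<and> row_sums c = \<nu>}"
      by (auto simp: \<phi>_def)
    finally show ?thesis
      using True plethysm_eq_card[OF \<nu> True N] by (simp add: restrict_vars_def)
  next
    case False
    then have "W (\<alpha>, \<nu>) = 0" using W_supp[of "(\<alpha>, \<nu>)"] by (auto simp: expos_xy_def)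
    with False show ?thesis by (simp add: restrict_vars_def)
  qed
  \<comment> \<open>The Vandermonde alternant in the x-variables times \<open>W\<close>; at
    \<open>(lam + rho n, \<nu>)\<close> this is the sum that defines
    \<open>schur_coeff\<close>.\<close>
  define A where "A e = (\<Sum>p | p permutes {..<n}.
    of_int (sign p) * shift (perm_expo n p (stair n), 0) W e)" for e
  have A_rat: "binomial_rational ?B A"
    unfolding A_def by (intro binomial_rational_sum binomial_rational_scale binomial_rational_shift W_rat)
  have A_supp: "e \<in> expos_xy n m" if ne: "A e \<noteq> 0" for e
  proof -
    obtain p where p: "p permutes {..<n}" "shift (perm_expo n p (stair n), 0) W e \<noteq> 0"
      using ne unfolding A_def by (metis (no_types, lifting) mem_Collect_eq mult_zero_right sum.neutral)
    then obtain d where d: "e = (perm_expo n p (stair n), 0) + d" "W d \<noteq> 0"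
      by (auto elim: shift_neq_0_E)
    have "(perm_expo n p (stair n), 0) \<in> expos_xy n m"
      using keys_perm_expo[OF p(1), of "stair n"] by (simp add: expos_xy_def)
    then show ?thesis using d W_supp by (simp add: add_in_expos_xy)
  qed
  define lx ly where "lx j e = int (lookup (fst e) j) - int (lookup (fst e) (Suc j))"
    and "ly j e = int (lookup (snd e) j) - int (lookup (snd e) (Suc j))" for j and e :: "expo \<times> expo"
  \<comment> \<open>Of the signed rearrangements of \<open>lam + rho n\<close> only the strictly
    decreasing one passes. The comparisons in x stop before entry \<open>n\<close>, since the last
    entry of \<open>lam + rho n\<close> may be 0; in y the last comparison is with entry
    \<open>m\<close>, which is 0.\<close>
  define A' where "A' e = (if \<forall>j\<in>{j. Suc j < n}. 1 \<le> lx j e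
    then (if \<forall>j\<in>{..<m}. 0 \<le> ly j e then A e else 0) else 0)" for e
  have "finite {j. Suc j < n}" by (rule finite_subset[of _ "{..<n}"]) auto
  then have A'_rat: "binomial_rational ?B A'"
    unfolding A'_def
    by (intro expos_xy.binomial_rational_restrict_finite A_rat) (auto simp: lx_def ly_def lookup_add)
  have A'_supp: "\<exists>lam \<nu>. e = (lam + rho n, \<nu>) \<and> is_partition lam \<and> keys lam \<subseteq> {..<n} \<and>
      is_partition \<nu> \<and> keys \<nu> \<subseteq> {..<m}" if "A' e \<noteq> 0" for e
  proof -
    obtain x \<nu> where e: "e = (x, \<nu>)" by (cases e)
    have "A e \<noteq> 0" and dec: "\<And>j. Suc j < n \<Longrightarrow> 1 \<le> lx j e" and ly: "\<And>j. j < m \<Longrightarrow> 0 \<le> ly j e"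
      using that by (auto simp: A'_def split: if_splits)
    then have keys: "keys x \<subseteq> {..<n}" "keys \<nu> \<subseteq> {..<m}"
      using A_supp[of e] by (auto simp: e expos_xy_def)
    have "lookup x (Suc j) < lookup x j" if "Suc j < n" for j
      using dec[OF that] by (simp add: lx_def e)
    with keys(1) obtain lam where lam: "is_partition lam" "keys lam \<subseteq> {..<n}" "x = lam + rho n"
      by (rule strictly_decreasing_eq_add_rho)
    have "is_partition \<nu>"
    proof (rule is_partitionI)
      fix j show "lookup \<nu> (Suc j) \<le> lookup \<nu> j"
        using ly[of j] lookup_outside[OF keys(2), of "Suc j"] by (cases "j < m") (auto simp: ly_def e)
    qed
    with lam keys(2) show ?thesis by (auto simp: e)
  qed
  have series_eq: "plethysm_series n m \<mu> = (\<lambda>e. A' (e + (rho n, 0)))"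
  proof
    fix e :: "expo \<times> expo"
    obtain lam \<nu> where e: "e = (lam, \<nu>)" by (cases e)
    let ?c = "is_partition lam \<and> keys lam \<subseteq> {..<n} \<and> is_partition \<nu> \<and> keys \<nu> \<subseteq> {..<m}"
    have series: "plethysm_series n m \<mu> e = (if ?c then of_int (plethysm_coeff \<nu> \<mu> lam) else 0)"
      using part_length_le_iff by (auto simp: plethysm_series_def e)
    show "plethysm_series n m \<mu> e = A' (e + (rho n, 0))"
    proof (cases ?c)
      case True
      then have lam: "is_partition lam" "keys lam \<subseteq> {..<n}" and \<nu>: "is_partition \<nu>" "keys \<nu> \<subseteq> {..<m}"
        by auto
      have "1 \<le> lx j (e + (rho n, 0))" if "Suc j < n" for j
        using add_rho_strict[OF lam(1), of j "Suc j" n] that by (simp add: lx_def e)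
      moreover have "0 \<le> ly j (e + (rho n, 0))" for j
        using partition_antimono[OF \<nu>(1), of j "Suc j"] by (simp add: ly_def e)
      ultimately have "A' (e + (rho n, 0)) = A (e + (rho n, 0))" by (simp add: A'_def)
      also have "\<dots> = of_int (schur_coeff n (plethysm (schur \<nu>) (schur \<mu>)) lam)"
      proof -
        \<comment> \<open>A shift in the x-exponent alone keeps \<open>\<nu>\<close> fixed, so the
          formula for \<open>W\<close> applies term by term.\<close>
        have "shift (a, 0) W (x, \<nu>) =
            of_int (shift a (restrict_vars n (plethysm (schur \<nu>) (schur \<mu>))) x)" for a x
        proof (cases "\<exists>d. x = a + d")
          case True
          then obtain d where d: "x = a + d" by blast
          then have "(x, \<nu>) = (a, 0) + (d, \<nu>)" by simp
          then have "shift (a, 0) W (x, \<nu>) = W (d, \<nu>)" by (simp only: shift_add_left)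
          then show ?thesis by (simp add: d W_plethysm[OF \<nu>])
        next
          case False
          then show ?thesis by (auto simp: shift_def)
        qed
        then show ?thesis by (simp add: A_def e schur_coeff_def)
      qed
      finally show ?thesis
        using True plethysm_coeff_eq[OF \<nu>(1) assms(3) lam] by (simp add: series)
    next
      case False
      have "A' (e + (rho n, 0)) = 0"
      proof (rule ccontr)
        assume "A' (e + (rho n, 0)) \<noteq> 0"
        from A'_supp[OF this] False show False by (auto simp: e)
      qed
      with False show ?thesis by (auto simp: series)
    qed
  qed
  have "binomial_rational ?B (plethysm_series n m \<mu>)"
    unfolding series_eq
  proof (rule binomial_rational_unshift[OF _ A'_rat])
    fix e assume "A' e \<noteq> 0"
    from A'_supp[OF this] obtain lam \<nu> where "e = (lam + rho n, \<nu>)" by blast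
    then show "\<exists>d. e = d + (rho n, 0)" by (intro exI[of _ "(lam, \<nu>)"]) simp
  qed
  moreover have "e \<in> expos_xy n m" if "plethysm_series n m \<mu> e \<noteq> 0" for e
    using that part_length_le_iff
    by (cases e) (auto simp: plethysm_series_def expos_xy_def split: if_splits)
  ultimately have "is_rational_series n m (plethysm_series n m \<mu>)"
    by (rule binomial_rational_imp_rational_series)
  then show ?thesis using rational_series_imp_linear_recurrence by blast
qed

end
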